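(* Let $H\in(1/2,1)$, let $F=Z_1^{H,3}$ be the third-order Hermite process with self-similarity index $H$ at time one, and let $\|DF\|_{\mathfrak H_1}=\big(\int_0^1|D_rF|^2\,dr\big)^{1/2}$ be the Malliavin norm of $F$ restricted to $[0,1]$. Then for every $p>0$, \[ \mathbb E\big[\|DF\|_{\mathfrak H_1}^{-p}\big]<\infty . \] More precisely, for every integer $m\ge1$ there exists $C_m<\infty$ such that \[ \mathbb P\{\|DF\|_{\mathfrak H_1}\le\varepsilon\}\le C_m\varepsilon^m\qquad\text{for all }\varepsilon>0 . \]
   Context: Let $B=(B(h),h\in\mathfrak H)$ be an isonormal Gaussian process over $\mathfrak H=L^2(\mathbb R)$. $I_q$ denotes the multiple Wiener--It\^o integral of order $q$ with respect to $B$, and $D$ the Malliavin derivative; for $F=I_q(f)$ with symmetric $f\in L^2(\mathbb R^q)$, $D_rF=qI_{q-1}(f(\cdot,r))$, $r\in\mathbb R$. Fix $H\in(1/2,1)$ and put $H_0=1+\frac{H-1}{3}\in(5/6,1)$. The Hermite process of order three is $Z_t^{H,3}=I_3(L_t^{H,3})$, $t\ge 0$, with \[ L_t^{H,3}(\xi_1,\xi_2,\xi_3)=c(H,3)\int_0^t\prod_{j=1}^3(s-\xi_j)_+^{H_0-3/2}\,ds, \] where $x_+^{a}=x^a$ for $x>0$ and $x_+^a=0$ for $x\le0$, and the constant $c(H,3)>0$ is chosen so that $\mathbb E[(Z_1^{H,3})^2]=1$. Here $\mathfrak H_1=L^2([0,1])$. *)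

theory Defs
  imports "HOL-Probability.Probability"
begin

definition L2 :: "'b measure \<Rightarrow> ('b \<Rightarrow> real) set" where
  "L2 N = {f \<in> borel_measurable N. integrable N (\<lambda>x. (f x)\<^sup>2)}"

text \<open>The zero variable counts as (degenerate) Gaussian.\<close>

definition centered_gaussian :: "'a measure \<Rightarrow> ('a \<Rightarrow> real) \<Rightarrow> bool" where
  "centered_gaussian M X \<longleftrightarrow> X \<in> borel_measurable M \<and>
     ((AE \<omega> in M. X \<omega> = 0) \<or>
      (\<exists>\<sigma>>0. distributed M lborel X (normal_density 0 \<sigma>)))"

text \<open>The process is indexed by square-integrable functions rather than by their classes; the
  covariance condition makes \<open>B h\<close> and \<open>B g\<close> almost surely equal if \<open>h = g\<close> almost everywhere.\<close>

definition isonormal :: "'a measure \<Rightarrow> ((real \<Rightarrow> real) \<Rightarrow> 'a \<Rightarrow> real) \<Rightarrow> bool" where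
  "isonormal M B \<longleftrightarrow> prob_space M \<and>
     (\<forall>S a. finite S \<and> S \<subseteq> L2 lborel \<longrightarrow>
        centered_gaussian M (\<lambda>\<omega>. \<Sum>h\<in>S. a h * B h \<omega>)) \<and>
     (\<forall>h\<in>L2 lborel. \<forall>g\<in>L2 lborel.
        (LINT \<omega>|M. B h \<omega> * B g \<omega>) = (LINT x|lborel. h x * g x))"

text \<open>Points of \<open>\<real>\<^sup>q\<close> are extensional functions on \<open>{..<q}\<close>, so coordinates are
  numbered from \<open>0\<close>.\<close>

abbreviation lborel_pow :: "nat \<Rightarrow> (nat \<Rightarrow> real) measure" where
  "lborel_pow q \<equiv> PiM {..<q} (\<lambda>_. lborel)"

text \<open>An elementary function of order \<open>q\<close> is
  \<open>\<Sum> a(i\<^sub>1,\<dots>,i\<^sub>q) 1\<^bsub>A(i\<^sub>1) \<times> \<dots> \<times> A(i\<^sub>q)\<^esub>\<close> with pairwise disjoint sets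
  \<open>A 0, \<dots>, A (n - 1)\<close> of finite measure, where the coefficient vanishes whenever two of the
  indices coincide. The index tuple is encoded as \<open>i \<in> {..<q} \<rightarrow>\<^sub>E {..<n}\<close>.\<close>

definition elementary_data ::
    "nat \<Rightarrow> nat \<Rightarrow> (nat \<Rightarrow> real set) \<Rightarrow> ((nat \<Rightarrow> nat) \<Rightarrow> real) \<Rightarrow> bool" where
  "elementary_data q n A a \<longleftrightarrow>
     (\<forall>k<n. A k \<in> sets lborel \<and> emeasure lborel (A k) < \<infinity>) \<and>
     disjoint_family_on A {..<n} \<and>
     (\<forall>i \<in> {..<q} \<rightarrow>\<^sub>E {..<n}. \<not> inj_on i {..<q} \<longrightarrow> a i = 0)"

definition elementary_fun ::
    "nat \<Rightarrow> nat \<Rightarrow> (nat \<Rightarrow> real set) \<Rightarrow> ((nat \<Rightarrow> nat) \<Rightarrow> real) \<Rightarrow> (nat \<Rightarrow> real) \<Rightarrow> real" where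
  "elementary_fun q n A a x =
     (\<Sum>i \<in> {..<q} \<rightarrow>\<^sub>E {..<n}. a i * (\<Prod>j<q. indicator (A (i j)) (x j)))"

definition elementary_integral ::
    "((real \<Rightarrow> real) \<Rightarrow> 'a \<Rightarrow> real) \<Rightarrow> nat \<Rightarrow> nat \<Rightarrow> (nat \<Rightarrow> real set) \<Rightarrow>
     ((nat \<Rightarrow> nat) \<Rightarrow> real) \<Rightarrow> 'a \<Rightarrow> real" where
  "elementary_integral B q n A a \<omega> =
     (\<Sum>i \<in> {..<q} \<rightarrow>\<^sub>E {..<n}. a i * (\<Prod>j<q. B (indicator (A (i j))) \<omega>))"

text \<open>\<open>wiener_ito M B q f X\<close>: the random variable \<open>X\<close> is a version of \<open>I\<^sub>q(f)\<close>, i.e. the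
  \<open>L\<^sup>2(P)\<close>-limit of the integrals of elementary functions converging to \<open>f\<close> in
  \<open>L\<^sup>2(\<real>\<^sup>q)\<close>. As usual \<open>f\<close> need not be symmetric; then \<open>I\<^sub>q(f)\<close> equals the integral
  of the symmetrization.\<close>

definition wiener_ito ::
    "'a measure \<Rightarrow> ((real \<Rightarrow> real) \<Rightarrow> 'a \<Rightarrow> real) \<Rightarrow> nat \<Rightarrow> ((nat \<Rightarrow> real) \<Rightarrow> real) \<Rightarrow>
     ('a \<Rightarrow> real) \<Rightarrow> bool" where
  "wiener_ito M B q f X \<longleftrightarrow> f \<in> L2 (lborel_pow q) \<and> X \<in> L2 M \<and>
     (\<exists>n A a.
        (\<forall>k. elementary_data q (n k) (A k) (a k)) \<and>
        (\<lambda>k. \<integral>\<^sup>+x. ennreal ((elementary_fun q (n k) (A k) (a k) x - f x)\<^sup>2) \<partial>lborel_pow q)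
           \<longlonglongrightarrow> 0 \<and>
        (\<lambda>k. \<integral>\<^sup>+\<omega>. ennreal ((elementary_integral B q (n k) (A k) (a k) \<omega> - X \<omega>)\<^sup>2) \<partial>M)
           \<longlonglongrightarrow> 0)"

definition symmetric_kernel :: "nat \<Rightarrow> ((nat \<Rightarrow> real) \<Rightarrow> real) \<Rightarrow> bool" where
  "symmetric_kernel q f \<longleftrightarrow>
     (\<forall>\<pi>. \<pi> permutes {..<q} \<longrightarrow> (AE x in lborel_pow q. f (x \<circ> \<pi>) = f x))"

text \<open>\<open>U\<close> is a jointly measurable version of the Malliavin derivative of an element \<open>F\<close> of the
  \<open>q\<close>-th Wiener chaos, \<open>q \<ge> 1\<close>: if \<open>F = I\<^sub>q(f)\<close> with \<open>f\<close> symmetric, then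
  \<open>U r = q I\<^bsub>q-1\<^esub>(f(\<cdot>, r))\<close> almost surely for almost every \<open>r\<close>. The kernel \<open>f\<close> is
  determined by \<open>F\<close> up to null sets.\<close>

definition malliavin_derivative ::
    "'a measure \<Rightarrow> ((real \<Rightarrow> real) \<Rightarrow> 'a \<Rightarrow> real) \<Rightarrow> nat \<Rightarrow> ('a \<Rightarrow> real) \<Rightarrow>
     (real \<Rightarrow> 'a \<Rightarrow> real) \<Rightarrow> bool" where
  "malliavin_derivative M B q F U \<longleftrightarrow>
     (\<lambda>(r, \<omega>). U r \<omega>) \<in> borel_measurable (lborel \<Otimes>\<^sub>M M) \<and>
     (\<exists>f. symmetric_kernel q f \<and> wiener_ito M B q f F \<and>
        (AE r in lborel. \<exists>X. wiener_ito M B (q - 1) (\<lambda>y. f (y(q - 1 := r))) X \<and>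
           (AE \<omega> in M. U r \<omega> = real q * X \<omega>)))"

definition H1_norm :: "(real \<Rightarrow> 'a \<Rightarrow> real) \<Rightarrow> 'a \<Rightarrow> real" where
  "H1_norm U \<omega> = sqrt (LINT r:{0..1}|lborel. (U r \<omega>)\<^sup>2)"

text \<open>Positive part power; \<open>powr\<close> itself is not zero at negative arguments.\<close>

definition pos_powr :: "real \<Rightarrow> real \<Rightarrow> real" where
  "pos_powr x a = (if x > 0 then x powr a else 0)"

definition hermite_kernel ::
    "nat \<Rightarrow> real \<Rightarrow> real \<Rightarrow> real \<Rightarrow> (nat \<Rightarrow> real) \<Rightarrow> real" where
  "hermite_kernel q H c t \<xi> =
     (let H0 = 1 + (H - 1) / real q
      in c * (LINT s:{0..t}|lborel. (\<Prod>j<q. pos_powr (s - \<xi> j) (H0 - 3/2))))"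

text \<open>Hermite process of order \<open>q\<close> and self-similarity index \<open>H\<close>; the constant is fixed by the
  normalization at time one.\<close>

definition hermite_process ::
    "'a measure \<Rightarrow> ((real \<Rightarrow> real) \<Rightarrow> 'a \<Rightarrow> real) \<Rightarrow> nat \<Rightarrow> real \<Rightarrow>
     (real \<Rightarrow> 'a \<Rightarrow> real) \<Rightarrow> bool" where
  "hermite_process M B q H Z \<longleftrightarrow>
     (\<exists>c>0. (\<forall>t\<ge>0. wiener_ito M B q (hermite_kernel q H c t) (Z t)) \<and>
            (LINT \<omega>|M. (Z 1 \<omega>)\<^sup>2) = 1)"

text \<open>\<open>E[Y\<^bsup>-p\<^esup>]\<close> for \<open>Y \<ge> 0\<close> and \<open>p > 0\<close>, as an extended real with the value
  \<open>\<infinity>\<close> for \<open>0\<^bsup>-p\<^esup>\<close>; note that \<open>0 powr (-p) = 0\<close> would silently discard the event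
  \<open>Y = 0\<close>.\<close>

definition negative_moment :: "'a measure \<Rightarrow> ('a \<Rightarrow> real) \<Rightarrow> real \<Rightarrow> ennreal" where
  "negative_moment M Y p = (\<integral>\<^sup>+\<omega>. inverse (ennreal (Y \<omega> powr p)) \<partial>M)"

end

theory Submission imports Defs
begin

text \<open>For almost every \<open>r\<close> the derivative \<open>D\<^sub>rF = 3 I\<^sub>2(L(\<cdot>, \<cdot>, r))\<close> is a variable in the second Wiener
chaos, and many of these variables cannot be small at the same time. Fix \<open>n\<close>, the wanted power of
\<open>\<epsilon>\<close>, and \<open>n\<close> disjoint subintervals of \<open>[0, 1]\<close> of length \<open>\<eta>\<close>. If the norm is at most \<open>\<epsilon>\<close>,
Jensen's inequality on each subinterval bounds \<open>1\<close> by \<open>exp (1/2)\<close> times the product of the averages of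
\<open>exp (- \<eta> (D\<^sub>rF)\<^sup>2 / (2 \<epsilon>\<^sup>2))\<close> over these subintervals (\<open>exp_Jensen_set\<close>). Taking expectations, it suffices
to bound \<open>E (exp (- (\<Sum>j<n. (\<rho> X\<^sub>j)\<^sup>2) / 2))\<close> by a constant times \<open>\<rho>\<^sup>-\<^sup>n\<close>, where
\<open>X\<^sub>j = I\<^sub>2(L(\<cdot>, \<cdot>, r\<^sub>j))\<close> and \<open>r\<^sub>j\<close> ranges over the \<open>j\<close>-th subinterval; the constant must not depend on the
points \<open>r\<^sub>j\<close>. Since \<open>exp (- s\<^sup>2 / 2)\<close> is the characteristic function of a standard normal variable, this
expectation is a Gaussian average of the joint characteristic function of \<open>X\<^sub>0, \<dots>, X\<^bsub>n-1\<^esub>\<close>, and the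
bound follows if that function decays like \<open>\<bar>t\<bar>\<close> to the power \<open>-2n\<close> (\<open>expectation_exp_square_bound\<close>).

Decay is obtained by decoupling. Expand the white noise along orthonormal functions \<open>E\<^sub>k\<close> in two groups
and an independent remainder. The variable \<open>\<Sum>j. t\<^sub>j X\<^sub>j\<close> becomes a quadratic polynomial in the
Gaussian coordinates; the Cauchy-Schwarz inequality in the coordinates of the first group eliminates
everything except the bilinear part between the groups, and the squared modulus of the characteristic
function is at most \<open>E (exp (- \<bar>H (y - y')\<bar>\<^sup>2 / 2))\<close> for independent standard Gaussian vectors \<open>y\<close> and \<open>y'\<close>
(\<open>decoupling\<close>, \<open>char_second_chaos_bound\<close>). The matrix \<open>H\<close> consists of the symmetrized integrals of
\<open>\<Sum>j. t\<^sub>j L(\<cdot>, \<cdot>, r\<^sub>j)\<close> against the products of \<open>E\<^sub>k\<close> and \<open>E\<^sub>l\<close>. If it is diagonally dominant with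
diagonal at least \<open>\<delta>\<close>, the expectation is at most a constant times \<open>\<delta>\<close> to the power minus the number of
rows (\<open>decoupled_diagonally_dominant\<close>).

The dominance comes from the singularity of the kernel. Up to a constant,
\<open>L(u, v, r) = \<integral>\<^sub>0\<^sup>1 (s - u)\<^sub>+\<^sup>a (s - v)\<^sub>+\<^sup>a (s - r)\<^sub>+\<^sup>a ds\<close> with \<open>a = (H - 1) / 3 - 1 / 2\<close>, and
\<open>2a + 1 < 0\<close> because \<open>H < 1\<close>: the kernel is unbounded near \<open>u = v > r\<close>, but bounded when \<open>u\<close>, \<open>v\<close>, \<open>r\<close> are
separated, and also near \<open>u = v\<close> when \<open>r\<close> lies to the right. To the right of the interval of \<open>r\<^sub>i\<close>
there are \<open>4n\<close> pairs of adjacent intervals of length \<open>h\<close>, and the functions \<open>E\<^sub>k\<close> are their normalized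
indicators. For the cluster next to \<open>r\<^sub>i\<close> the diagonal entries of \<open>L(\<cdot>, \<cdot>, r\<^sub>i)\<close> are large for small \<open>h\<close>, those
of \<open>L(\<cdot>, \<cdot>, r\<^sub>j)\<close> are no larger for \<open>j < i\<close> and bounded for \<open>j > i\<close>, and all entries off the diagonal are
bounded (\<open>kernel_matrix_bounds\<close>). Choosing the cluster \<open>i\<close> with the largest \<open>\<bar>t\<^sub>i\<bar> (4n)\<^sup>-\<^sup>i\<close> makes the
contributions of \<open>j < i\<close> harmless, and a small \<open>h\<close> takes care of the bounded entries
(\<open>triangular_dominance\<close>, \<open>second_chaos_small_ball\<close>).

Two points concern the meaning of the norm. The Malliavin derivative is taken with some symmetric kernel
of \<open>F\<close>; its sections are identified with those of \<open>L\<close>, tested on finitely many products, through the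
expectations \<open>E (F exp (i B(h)))\<close> and polarization (\<open>wiener_ito_section_unique\<close>). And the
Bochner integral in the norm would be zero for a path that is not square integrable; the bound
\<open>E (I\<^sub>2(f)\<^sup>2) \<le> 4 \<integral> f\<^sup>2\<close> excludes such paths almost surely (\<open>chaos_derivative_square_integrable\<close>). The
negative moments follow from the small ball estimates by a dyadic decomposition.\<close>

section \<open>Characteristic functions determine joint laws\<close>

lemma (in prob_space) integrable_bounded_complex:
  fixes u :: "'a \<Rightarrow> complex"
  assumes "u \<in> borel_measurable M" "\<And>x. x \<in> space M \<Longrightarrow> cmod (u x) \<le> C"
  shows "integrable M u"
  using assms by (intro integrable_const_bound[where B = C]) auto

lemma (in prob_space) integrable_bounded_real:
  fixes u :: "'a \<Rightarrow> real"
  assumes "u \<in> borel_measurable M" "\<And>x. x \<in> space M \<Longrightarrow> \<bar>u x\<bar> \<le> C"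
  shows "integrable M u"
  using assms by (intro integrable_const_bound[where B = C]) auto

text \<open>Divided by its total mass, the weight is a probability density, and Levy's uniqueness theorem
applies to the law of \<open>X\<close> under this density. If the total mass is zero, both sides vanish.\<close>

lemma weighted_char_unique_nonneg:
  fixes X g :: "'a \<Rightarrow> real" and X' g' :: "'b \<Rightarrow> real"
  assumes M: "prob_space M" "prob_space M'"
    and meas [measurable]: "X \<in> borel_measurable M" "X' \<in> borel_measurable M'"
      "g \<in> borel_measurable M" "g' \<in> borel_measurable M'"
    and g: "\<And>x. 0 \<le> g x" "\<And>x. g x \<le> C" and g': "\<And>x. 0 \<le> g' x" "\<And>x. g' x \<le> C"
    and eq: "\<And>s. (CLINT x|M. g x * iexp (s * X x)) = (CLINT x|M'. g' x * iexp (s * X' x))"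
    and A [measurable]: "A \<in> sets borel"
  shows "(LINT x|M. g x * indicator A (X x)) = (LINT x|M'. g' x * indicator A (X' x))"
proof -
  define c where "c = (LINT x|M. g x)"
  have char: "real_distribution (distr (density M (\<lambda>x. ennreal (g x / c))) borel X) \<and>
      (\<forall>s. char (distr (density M (\<lambda>x. ennreal (g x / c))) borel X) s =
        (CLINT x|M. g x * iexp (s * X x)) / c) \<and>
      measure (distr (density M (\<lambda>x. ennreal (g x / c))) borel X) A =
        (LINT x|M. g x * indicator A (X x)) / c"
    if "prob_space M" and [measurable]: "X \<in> borel_measurable M" "g \<in> borel_measurable M"
      and g: "\<And>x. 0 \<le> g x" "\<And>x. g x \<le> C" and c: "c = (LINT x|M. g x)" "c > 0"
    for M :: "'c measure" and X g c
  proof -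
    interpret prob_space M by fact
    have int: "integrable M g"
      by (rule integrable_bounded_real[where C = C]) (use g in auto)
    let ?D = "density M (\<lambda>x. ennreal (g x / c))"
    have "emeasure ?D (space M) = 1"
    proof -
      have "emeasure ?D (space M) = (\<integral>\<^sup>+x. ennreal (g x / c) \<partial>M)"
        by (subst emeasure_density) (auto intro!: nn_integral_cong simp: indicator_def)
      also have "\<dots> = ennreal (LINT x|M. g x / c)"
        using c g int by (intro nn_integral_eq_integral) auto
      also have "\<dots> = 1" using c by simp
      finally show ?thesis .
    qed
    then interpret D: prob_space ?D by (intro prob_spaceI) simp
    have 1: "real_distribution (distr ?D borel X)"
      by (intro D.real_distribution_distr) simp
    have 2: "char (distr ?D borel X) s = (CLINT x|M. g x * iexp (s * X x)) / c" for s
    proof -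
      have "char (distr ?D borel X) s = (CLINT x|?D. iexp (s * X x))"
        unfolding char_def by (subst integral_distr) auto
      also have "\<dots> = (CLINT x|M. (g x / c) *\<^sub>R iexp (s * X x))"
        using g c by (subst integral_density) auto
      also have "\<dots> = (CLINT x|M. (g x * iexp (s * X x)) / c)"
        by (simp add: scaleR_conv_of_real)
      finally show ?thesis by simp
    qed
    have "measure (distr ?D borel X) A = measure ?D (X -` A \<inter> space M)"
      by (subst measure_distr) auto
    also have "\<dots> = (LINT x|?D. indicator (X -` A \<inter> space M) x)"
      by simp
    also have "\<dots> = (LINT x|M. (g x / c) *\<^sub>R indicator (X -` A \<inter> space M) x)"
      using g c by (subst integral_density) auto
    also have "\<dots> = (LINT x|M. g x * indicator A (X x) / c)"
      by (intro Bochner_Integration.integral_cong) (auto simp: indicator_def)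
    finally show ?thesis using 1 2 by simp
  qed
  have c': "c = (LINT x|M'. g' x)"
    using eq[of 0] by (simp add: c_def)
  interpret M: prob_space M by fact
  interpret M': prob_space M' by fact
  have i: "integrable M g" "integrable M' g'"
    by (auto intro!: M.integrable_bounded_real[where C = C] M'.integrable_bounded_real[where C = C]
        simp: g g')
  show ?thesis
  proof (cases "c = 0")
    case True
    have "AE x in M. g x = 0" "AE x in M'. g' x = 0"
      using integral_nonneg_eq_0_iff_AE[OF i(1)] integral_nonneg_eq_0_iff_AE[OF i(2)]
        True c' c_def g g' by auto
    then have "AE x in M. g x * indicator A (X x) = 0" "AE x in M'. g' x * indicator A (X' x) = 0"
      by auto
    then show ?thesis by (simp add: integral_eq_zero_AE)
  next
    case False
    then have "c > 0" using g by (simp add: c_def less_le integral_nonneg_AE)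
    note 1 = char[OF M(1) meas(1,3) g c_def this] and 2 = char[OF M(2) meas(2,4) g' c' this]
    have "char (distr (density M (\<lambda>x. ennreal (g x / c))) borel X) =
        char (distr (density M' (\<lambda>x. ennreal (g' x / c))) borel X')"
      using 1 2 eq by (intro ext) simp
    then have "distr (density M (\<lambda>x. ennreal (g x / c))) borel X =
        distr (density M' (\<lambda>x. ennreal (g' x / c))) borel X'"
      using 1 2 by (intro Levy_uniqueness) auto
    with 1 2 have "(LINT x|M. g x * indicator A (X x)) / c = (LINT x|M'. g' x * indicator A (X' x)) / c"
      by metis
    then show ?thesis using False by simp
  qed
qed

text \<open>The nonnegative weights \<open>g\<close> and \<open>Re u + g\<close> both satisfy the hypothesis of the previous lemma, because
the Fourier transform of \<open>Re u\<close> is the mean of that of \<open>u\<close> and its reflected conjugate. The imaginary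
part of \<open>u\<close> is the real part of \<open>- \<i> u\<close>.\<close>

lemma weighted_char_unique:
  fixes X g :: "'a \<Rightarrow> real" and X' g' :: "'b \<Rightarrow> real"
    and u :: "'a \<Rightarrow> complex" and u' :: "'b \<Rightarrow> complex"
  assumes M: "prob_space M" "prob_space M'"
    and meas [measurable]: "X \<in> borel_measurable M" "X' \<in> borel_measurable M'"
      "g \<in> borel_measurable M" "g' \<in> borel_measurable M'"
      "u \<in> borel_measurable M" "u' \<in> borel_measurable M'"
    and u: "\<And>x. cmod (u x) \<le> g x" "\<And>x. cmod (u' x) \<le> g' x"
    and C: "\<And>x. g x \<le> C" "\<And>x. g' x \<le> C"
    and eq: "\<And>s. (CLINT x|M. g x * iexp (s * X x)) = (CLINT x|M'. g' x * iexp (s * X' x))"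
    and equ: "\<And>s. (CLINT x|M. u x * iexp (s * X x)) = (CLINT x|M'. u' x * iexp (s * X' x))"
    and A [measurable]: "A \<in> sets borel"
  shows "(CLINT x|M. u x * indicator A (X x)) = (CLINT x|M'. u' x * indicator A (X' x))"
proof -
  interpret M: prob_space M by fact
  interpret M': prob_space M' by fact
  have C0: "0 \<le> C" using norm_ge_zero[of "u undefined"] u(1)[of undefined] C(1)[of undefined] by linarith
  have bu: "cmod (u x) \<le> C" "cmod (u' y) \<le> C" for x y
    using u C by (meson order.trans)+
  have gn: "0 \<le> g x" "0 \<le> g' y" for x y
    using u by (meson norm_ge_zero order.trans)+
  have Re_part: "(LINT x|M. Re (v x) * indicator A (X x)) = (LINT x|M'. Re (v' x) * indicator A (X' x))"
    if [measurable]: "v \<in> borel_measurable M" "v' \<in> borel_measurable M'"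
      and v: "\<And>x. cmod (v x) \<le> g x" "\<And>x. cmod (v' x) \<le> g' x"
      and eqv: "\<And>s. (CLINT x|M. v x * iexp (s * X x)) = (CLINT x|M'. v' x * iexp (s * X' x))"
    for v v'
  proof -
    have bv: "cmod (v x) \<le> C" "cmod (v' y) \<le> C" for x y
      using v C by (meson order.trans)+
    have bRe: "\<bar>Re (v x)\<bar> \<le> g x" "\<bar>Re (v' y)\<bar> \<le> g' y" for x y
      using v abs_Re_le_cmod by (meson order.trans)+
    have re: "(CLINT x|N. (Re (w x) + h x) * iexp (s * Y x)) =
        ((CLINT x|N. w x * iexp (s * Y x)) + cnj (CLINT x|N. w x * iexp (- s * Y x))) / 2
        + (CLINT x|N. h x * iexp (s * Y x))"
      if "prob_space N" and [measurable]: "w \<in> borel_measurable N" "Y \<in> borel_measurable N" "h \<in> borel_measurable N"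
       and b: "\<And>x. cmod (w x) \<le> C" "\<And>x. \<bar>h x\<bar> \<le> C"
      for N :: "'c measure" and w Y h s
    proof -
      interpret prob_space N by fact
      have i: "integrable N (\<lambda>x. w x * iexp (s * Y x))" for s
        by (rule integrable_bounded_complex[where C = C]) (auto simp: norm_mult b)
      have i2: "integrable N (\<lambda>x. h x * iexp (s * Y x))"
        by (rule integrable_bounded_complex[where C = C]) (auto simp: norm_mult b)
      have "(CLINT x|N. (Re (w x) + h x) * iexp (s * Y x)) =
         (CLINT x|N. (w x * iexp (s * Y x) + cnj (w x * iexp (- s * Y x))) / 2 + h x * iexp (s * Y x))"
      proof (intro Bochner_Integration.integral_cong refl)
        fix x
        have c: "cnj (iexp (- s * Y x)) = iexp (s * Y x)"
          by (simp add: exp_cnj)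
        have "complex_of_real (Re (w x)) = (w x + cnj (w x)) / 2"
          by (simp add: complex_add_cnj)
        then have "(Re (w x) + h x) * iexp (s * Y x) = (w x * iexp (s * Y x) + cnj (w x) * iexp (s * Y x)) / 2 + h x * iexp (s * Y x)"
          by (simp add: ring_distribs add_divide_distrib)
        then show "(Re (w x) + h x) * iexp (s * Y x) =
          (w x * iexp (s * Y x) + cnj (w x * iexp (- s * Y x))) / 2 + h x * iexp (s * Y x)"
          unfolding complex_cnj_mult c .
      qed
      also have "\<dots> = ((CLINT x|N. w x * iexp (s * Y x)) + (CLINT x|N. cnj (w x * iexp (- s * Y x)))) / 2
        + (CLINT x|N. h x * iexp (s * Y x))"
        using i[of s] i[of "-s"] i2
        by (subst Bochner_Integration.integral_add)
          (auto simp del: complex_cnj_mult)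
      also have "(CLINT x|N. cnj (w x * iexp (- s * Y x))) = cnj (CLINT x|N. w x * iexp (- s * Y x))"
        by (rule Bochner_Integration.integral_cnj)
      finally show ?thesis .
    qed
    have h: "\<bar>g x\<bar> \<le> C" "\<bar>g' y\<bar> \<le> C" for x y
      using C gn by auto
    have bb: "\<bar>Re (v x)\<bar> \<le> C" "\<bar>Re (v' y)\<bar> \<le> C" for x y
      using bRe C by (meson order.trans)+
    have sh: "0 \<le> Re (v x) + g x" "Re (v x) + g x \<le> 2 * C" "0 \<le> Re (v' y) + g' y" "Re (v' y) + g' y \<le> 2 * C" for x y
      using bRe(1)[of x] bRe(2)[of y] C(1)[of x] C(2)[of y] by (auto simp: abs_le_iff)
    have "(LINT x|M. (Re (v x) + g x) * indicator A (X x)) = (LINT x|M'. (Re (v' x) + g' x) * indicator A (X' x))"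
    proof (rule weighted_char_unique_nonneg[OF M, where C = "2 * C"])
      fix s
      show "(CLINT x|M. complex_of_real (Re (v x) + g x) * iexp (s * X x)) =
         (CLINT x|M'. complex_of_real (Re (v' x) + g' x) * iexp (s * X' x))"
        unfolding of_real_add
        using re[OF M(1) that(1) meas(1,3) bv(1) h(1)] re[OF M(2) that(2) meas(2,4) bv(2) h(2)]
          eqv[of s] eqv[of "-s"] eq[of s] by simp
    qed (use sh in auto)
    moreover have "(LINT x|M. g x * indicator A (X x)) = (LINT x|M'. g' x * indicator A (X' x))"
      by (rule weighted_char_unique_nonneg[OF M, where C = C]) (use eq C gn in auto)
    moreover have "integrable M (\<lambda>x. Re (v x) * indicator A (X x))" "integrable M (\<lambda>x. g x * indicator A (X x))"
      by (rule M.integrable_bounded_real[where C = C];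
          use bb h C0 in \<open>auto simp: indicator_def\<close>)+
    moreover have "integrable M' (\<lambda>x. Re (v' x) * indicator A (X' x))" "integrable M' (\<lambda>x. g' x * indicator A (X' x))"
      by (rule M'.integrable_bounded_real[where C = C];
          use bb h C0 in \<open>auto simp: indicator_def\<close>)+
    ultimately show ?thesis by (simp add: ring_distribs)
  qed
  have i: "integrable M (\<lambda>x. u x * indicator A (X x))"
    by (rule M.integrable_bounded_complex[where C = C]) (use bu C0 in \<open>auto simp: indicator_def\<close>)
  have i': "integrable M' (\<lambda>x. u' x * indicator A (X' x))"
    by (rule M'.integrable_bounded_complex[where C = C]) (use bu C0 in \<open>auto simp: indicator_def\<close>)
  have ind: "Re (indicator A y) = indicator A y" "Im (indicator A y) = 0" for y :: real
    by (auto simp: indicator_def)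
  show ?thesis
  proof (rule complex_eqI)
    show "Re (CLINT x|M. u x * indicator A (X x)) = Re (CLINT x|M'. u' x * indicator A (X' x))"
      using Re_part[of u u'] u equ by (simp add: integral_Re[OF i, symmetric] integral_Re[OF i', symmetric] ind)
    have "(LINT x|M. Re (- \<i> * u x) * indicator A (X x)) = (LINT x|M'. Re (- \<i> * u' x) * indicator A (X' x))"
      using equ u by (intro Re_part) (auto simp: norm_mult mult.assoc)
    then show "Im (CLINT x|M. u x * indicator A (X x)) = Im (CLINT x|M'. u' x * indicator A (X' x))"
      by (simp add: integral_Im[OF i, symmetric] integral_Im[OF i', symmetric] ind)
  qed
qed

text \<open>Induction on the coordinates reduces to the one-dimensional case: for the coordinate \<open>k0\<close>, the
exponential of the other coordinates is part of a complex weight; afterwards the indicator of the event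
in the coordinate \<open>k0\<close> is absorbed into the real weight. This is why the statement carries a weight.\<close>

lemma joint_char_weighted_boxes:
  fixes X :: "'i \<Rightarrow> 'a \<Rightarrow> real" and X' :: "'i \<Rightarrow> 'b \<Rightarrow> real"
    and g :: "'a \<Rightarrow> real" and g' :: "'b \<Rightarrow> real"
  assumes "finite I" and M: "prob_space M" "prob_space M'"
    and "\<And>k. k \<in> I \<Longrightarrow> X k \<in> borel_measurable M" "\<And>k. k \<in> I \<Longrightarrow> X' k \<in> borel_measurable M'"
    and "g \<in> borel_measurable M" "g' \<in> borel_measurable M'"
    and "\<And>x. 0 \<le> g x \<and> g x \<le> 1" "\<And>x. 0 \<le> g' x \<and> g' x \<le> 1"
    and "\<And>t. (CLINT x|M. g x * iexp (\<Sum>k\<in>I. t k * X k x)) = (CLINT x|M'. g' x * iexp (\<Sum>k\<in>I. t k * X' k x))"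
    and "\<And>k. k \<in> I \<Longrightarrow> A k \<in> sets borel"
  shows "(LINT x|M. g x * (\<Prod>k\<in>I. indicator (A k) (X k x))) = (LINT x|M'. g' x * (\<Prod>k\<in>I. indicator (A k) (X' k x)))"
  using assms(1,4-)
proof (induction I arbitrary: g g' rule: finite_induct)
  case empty
  then show ?case by simp
next
  case (insert k0 I)
  have [measurable]: "X k0 \<in> borel_measurable M" "X' k0 \<in> borel_measurable M'"
    "g \<in> borel_measurable M" "g' \<in> borel_measurable M'" "A k0 \<in> sets borel"
    and [measurable]: "\<And>k. k \<in> I \<Longrightarrow> X k \<in> borel_measurable M" "\<And>k. k \<in> I \<Longrightarrow> X' k \<in> borel_measurable M'"
    using insert.prems by auto
  note g = insert.prems(5,6) and eq = insert.prems(7)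
  have ind: "complex_of_real (indicat_real (A k0) y) = indicator (A k0) y" for y
    by (simp add: indicator_def)
  have upd0: "(\<Sum>k\<in>I. ((\<lambda>_. 0)(k0 := s)) k * Y k) = 0" for s and Y :: "'i \<Rightarrow> real"
    using insert.hyps by (intro sum.neutral) auto
  have upd: "(\<Sum>k\<in>I. (t(k0 := s)) k * Y k) = (\<Sum>k\<in>I. t k * Y k)" for t s and Y :: "'i \<Rightarrow> real"
    using insert.hyps by (intro sum.cong) auto
  have key: "(CLINT x|M. (g x * iexp (\<Sum>k\<in>I. t k * X k x)) * indicator (A k0) (X k0 x)) =
      (CLINT x|M'. (g' x * iexp (\<Sum>k\<in>I. t k * X' k x)) * indicator (A k0) (X' k0 x))" for t
  proof (rule weighted_char_unique[OF M, where C = 1 and g = g and g' = g'])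
    fix s
    show "(CLINT x|M. g x * iexp (s * X k0 x)) = (CLINT x|M'. g' x * iexp (s * X' k0 x))"
      using eq[of "(\<lambda>_. 0)(k0 := s)"] insert.hyps unfolding sum.insert[OF insert.hyps] upd0 by simp
    show "(CLINT x|M. g x * iexp (\<Sum>k\<in>I. t k * X k x) * iexp (s * X k0 x)) =
      (CLINT x|M'. g' x * iexp (\<Sum>k\<in>I. t k * X' k x) * iexp (s * X' k0 x))"
      using eq[of "t(k0 := s)"] unfolding sum.insert[OF insert.hyps] upd
      by (simp only: of_real_add distrib_left exp_add mult_ac fun_upd_same)
  qed (use g in \<open>auto simp: norm_mult\<close>)
  have "(LINT x|M. (g x * indicator (A k0) (X k0 x)) * (\<Prod>k\<in>I. indicator (A k) (X k x))) =
    (LINT x|M'. (g' x * indicator (A k0) (X' k0 x)) * (\<Prod>k\<in>I. indicator (A k) (X' k x)))"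
  proof (rule insert.IH)
    fix t
    show "(CLINT x|M. complex_of_real (g x * indicat_real (A k0) (X k0 x)) * iexp (\<Sum>k\<in>I. t k * X k x)) =
      (CLINT x|M'. complex_of_real (g' x * indicat_real (A k0) (X' k0 x)) * iexp (\<Sum>k\<in>I. t k * X' k x))"
      using key[of t] unfolding of_real_mult ind by (simp only: mult_ac)
  qed (use g insert.prems in \<open>auto simp: indicator_def\<close>)
  then show ?case using insert.hyps by (simp add: mult.assoc)
qed

text \<open>The multivariate form of Levy's uniqueness theorem. Boxes generate the product sigma-algebra and are
closed under intersection, so that equality on boxes suffices.\<close>

lemma joint_law_eqI_char:
  fixes X :: "'i \<Rightarrow> 'a \<Rightarrow> real" and X' :: "'i \<Rightarrow> 'b \<Rightarrow> real"
  assumes I: "finite I" and M: "prob_space M" "prob_space M'"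
    and X: "\<And>k. k \<in> I \<Longrightarrow> X k \<in> borel_measurable M" "\<And>k. k \<in> I \<Longrightarrow> X' k \<in> borel_measurable M'"
    and eq: "\<And>t. (CLINT x|M. iexp (\<Sum>k\<in>I. t k * X k x)) = (CLINT x|M'. iexp (\<Sum>k\<in>I. t k * X' k x))"
  shows "distr M (PiM I (\<lambda>_. borel)) (\<lambda>x. \<lambda>k\<in>I. X k x) = distr M' (PiM I (\<lambda>_. borel)) (\<lambda>x. \<lambda>k\<in>I. X' k x)"
    (is "?P = ?Q")
proof (rule measure_eqI_PiM_finite[OF I])
  interpret M: prob_space M by fact
  interpret M': prob_space M' by fact
  have [measurable]: "(\<lambda>x. \<lambda>k\<in>I. X k x) \<in> measurable M (PiM I (\<lambda>_. borel))"
     "(\<lambda>x. \<lambda>k\<in>I. X' k x) \<in> measurable M' (PiM I (\<lambda>_. borel))"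
    using X by (auto intro!: measurable_restrict)
  have box: "emeasure (distr N (PiM I (\<lambda>_. borel)) (\<lambda>x. \<lambda>k\<in>I. Y k x)) (Pi\<^sub>E I A) =
      ennreal (LINT x|N. 1 * (\<Prod>k\<in>I. indicator (A k) (Y k x)))"
    if N: "prob_space N" and Y: "\<And>k. k \<in> I \<Longrightarrow> Y k \<in> borel_measurable N" and A: "\<And>k. k \<in> I \<Longrightarrow> A k \<in> sets borel"
    for N :: "'c measure" and Y and A :: "'i \<Rightarrow> real set"
  proof -
    interpret prob_space N by fact
    have m [measurable]: "(\<lambda>x. \<lambda>k\<in>I. Y k x) \<in> measurable N (PiM I (\<lambda>_. borel))"
      using Y by (auto intro!: measurable_restrict)
    have [measurable]: "Pi\<^sub>E I A \<in> sets (PiM I (\<lambda>_. borel))"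
      using A I by (auto intro!: sets_PiM_I_finite)
    let ?S = "(\<lambda>x. \<lambda>k\<in>I. Y k x) -` (Pi\<^sub>E I A) \<inter> space N"
    have S: "?S \<in> sets N" by measurable
    have "(\<Prod>k\<in>I. indicator (A k) (Y k x)) = indicat_real ?S x" if "x \<in> space N" for x
    proof (cases "\<forall>k\<in>I. Y k x \<in> A k")
      case True
      then show ?thesis using that by (simp add: PiE_iff)
    next
      case False
      then have "x \<notin> ?S" by (auto simp: PiE_iff)
      moreover have "(\<Prod>k\<in>I. indicat_real (A k) (Y k x)) = 0"
        using False by (intro prod_zero[OF I]) (auto simp: indicator_eq_0_iff)
      ultimately show ?thesis by simp
    qed
    then have "(LINT x|N. 1 * (\<Prod>k\<in>I. indicator (A k) (Y k x))) = (LINT x|N. indicat_real ?S x)"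
      by (intro Bochner_Integration.integral_cong) auto
    also have "\<dots> = measure N ?S" using S by simp
    finally have eqS: "(LINT x|N. 1 * (\<Prod>k\<in>I. indicator (A k) (Y k x))) = measure N ?S" .
    have "emeasure (distr N (PiM I (\<lambda>_. borel)) (\<lambda>x. \<lambda>k\<in>I. Y k x)) (Pi\<^sub>E I A) = emeasure N ?S"
      by (rule emeasure_distr) (rule m, measurable)
    then show ?thesis unfolding eqS emeasure_eq_measure .
  qed
  show "?P (Pi\<^sub>E I A) = ?Q (Pi\<^sub>E I A)" if "\<And>i. i \<in> I \<Longrightarrow> A i \<in> sets borel" for A
  proof -
    have "?P (Pi\<^sub>E I A) = ennreal (LINT x|M. 1 * (\<Prod>k\<in>I. indicator (A k) (X k x)))"
      by (rule box[OF M(1)]) (use X that in auto)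
    also have "(LINT x|M. 1 * (\<Prod>k\<in>I. indicat_real (A k) (X k x))) =
        (LINT x|M'. 1 * (\<Prod>k\<in>I. indicat_real (A k) (X' k x)))"
      by (rule joint_char_weighted_boxes[OF I M X]) (use eq that in auto)
    also have "ennreal \<dots> = ?Q (Pi\<^sub>E I A)"
      by (rule box[OF M(2), symmetric]) (use X that in auto)
    finally show ?thesis .
  qed
  show "range (\<lambda>n::nat. Pi\<^sub>E I (\<lambda>_. UNIV)) \<subseteq> prod_algebra I (\<lambda>_. borel :: real measure)"
    using I by (auto intro!: prod_algebraI_finite)
  show "(\<Union>i::nat. Pi\<^sub>E I (\<lambda>_. UNIV)) = space (PiM I (\<lambda>_. borel :: real measure))"
    by (simp add: space_PiM)
  interpret P: prob_space ?P by (rule M.prob_space_distr) simp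
  show "?P (Pi\<^sub>E I (\<lambda>_. UNIV)) \<noteq> \<infinity>" by simp
qed auto

section \<open>Square-integrable functions\<close>

abbreviation inner_L2 :: "'b measure \<Rightarrow> ('b \<Rightarrow> real) \<Rightarrow> ('b \<Rightarrow> real) \<Rightarrow> real" where
  "inner_L2 N f g \<equiv> (LINT x|N. f x * g x)"

lemma L2_measurable: "f \<in> L2 N \<Longrightarrow> f \<in> borel_measurable N"
  by (simp add: L2_def)

lemma L2_integrable_mult:
  assumes "f \<in> L2 N" "g \<in> L2 N"
  shows "integrable N (\<lambda>x. f x * g x)"
proof (rule Bochner_Integration.integrable_bound)
  show "integrable N (\<lambda>x. (f x)\<^sup>2 + (g x)\<^sup>2)" using assms by (auto simp: L2_def)
  show "AE x in N. norm (f x * g x) \<le> norm ((f x)\<^sup>2 + (g x)\<^sup>2)"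
  proof (intro AE_I2)
    fix x
    have "\<bar>f x * g x\<bar> \<le> (f x)\<^sup>2 + (g x)\<^sup>2"
      using zero_le_power2[of "\<bar>f x\<bar> - \<bar>g x\<bar>"] mult_nonneg_nonneg[of "\<bar>f x\<bar>" "\<bar>g x\<bar>"]
      unfolding power2_diff abs_mult power2_abs by linarith
    then show "norm (f x * g x) \<le> norm ((f x)\<^sup>2 + (g x)\<^sup>2)" by simp
  qed
qed (use assms in \<open>auto simp: L2_def\<close>)

lemma L2_add: "f \<in> L2 N \<Longrightarrow> g \<in> L2 N \<Longrightarrow> (\<lambda>x. f x + g x) \<in> L2 N"
  using L2_integrable_mult[of f N g] by (auto simp: L2_def power2_sum mult.assoc)

lemma L2_scale: "f \<in> L2 N \<Longrightarrow> (\<lambda>x. c * f x) \<in> L2 N"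
  by (auto simp: L2_def power_mult_distrib)

lemma L2_zero: "(\<lambda>x. 0) \<in> L2 N"
  by (auto simp: L2_def)

lemma L2_sum: "(\<And>j. j \<in> J \<Longrightarrow> h j \<in> L2 N) \<Longrightarrow> (\<lambda>x. \<Sum>j\<in>J. h j x) \<in> L2 N"
  by (induction J rule: infinite_finite_induct) (auto intro: L2_add L2_zero)

lemma L2_lincomb: "(\<And>j. j \<in> J \<Longrightarrow> h j \<in> L2 N) \<Longrightarrow> (\<lambda>x. \<Sum>j\<in>J. c j * h j x) \<in> L2 N"
  by (intro L2_sum L2_scale)

lemma L2_diff: "f \<in> L2 N \<Longrightarrow> g \<in> L2 N \<Longrightarrow> (\<lambda>x. f x - g x) \<in> L2 N"
  using L2_add[of f N "\<lambda>x. -1 * g x"] L2_scale[of g N "-1"] by simp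

lemma L2_indicator:
  "A \<in> sets N \<Longrightarrow> emeasure N A < \<infinity> \<Longrightarrow> indicator A \<in> L2 N"
  by (auto simp: L2_def power2_eq_square simp flip: indicator_inter_arith)

lemma inner_L2_lincomb:
  assumes "\<And>i. i \<in> I \<Longrightarrow> h i \<in> L2 N" "\<And>j. j \<in> J \<Longrightarrow> g j \<in> L2 N"
  shows "inner_L2 N (\<lambda>x. \<Sum>i\<in>I. c i * h i x) (\<lambda>x. \<Sum>j\<in>J. d j * g j x) =
    (\<Sum>i\<in>I. \<Sum>j\<in>J. c i * d j * inner_L2 N (h i) (g j))"
proof -
  have "(LINT x|N. (\<Sum>i\<in>I. c i * h i x) * (\<Sum>j\<in>J. d j * g j x)) =
    (LINT x|N. (\<Sum>i\<in>I. \<Sum>j\<in>J. (c i * d j) * (h i x * g j x)))"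
    by (intro Bochner_Integration.integral_cong) (auto simp: sum_product mult_ac)
  also have "\<dots> = (\<Sum>i\<in>I. \<Sum>j\<in>J. (c i * d j) * (LINT x|N. h i x * g j x))"
  proof -
    have int: "integrable N (\<lambda>x. (c i * d j) * (h i x * g j x))" if "i \<in> I" "j \<in> J" for i j
      by (intro integrable_mult_right L2_integrable_mult assms that)
    have "(LINT x|N. (\<Sum>i\<in>I. \<Sum>j\<in>J. (c i * d j) * (h i x * g j x))) =
        (\<Sum>i\<in>I. LINT x|N. (\<Sum>j\<in>J. (c i * d j) * (h i x * g j x)))"
      by (rule Bochner_Integration.integral_sum) (rule Bochner_Integration.integrable_sum, rule int)
    also have "\<dots> = (\<Sum>i\<in>I. \<Sum>j\<in>J. LINT x|N. (c i * d j) * (h i x * g j x))"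
      by (rule sum.cong[OF refl], rule Bochner_Integration.integral_sum) (rule int)
    finally show ?thesis by simp
  qed
  finally show ?thesis .
qed

lemma inner_L2_self_zero_AE:
  "f \<in> L2 N \<Longrightarrow> inner_L2 N f f = 0 \<longleftrightarrow> (AE x in N. f x = 0)"
  using integral_nonneg_eq_0_iff_AE[of N "\<lambda>x. f x * f x"] L2_integrable_mult[of f N f] by auto

section \<open>Isonormal Gaussian processes\<close>

lemma tendsto_exp_quotient:
  fixes x :: complex
  assumes "e \<longlonglongrightarrow> 0" "\<And>n. e n \<noteq> (0::complex)"
  shows "(\<lambda>n. (exp (e n * x) - 1) / e n) \<longlonglongrightarrow> x"
proof -
  have "((\<lambda>z. exp (z * x)) has_field_derivative x) (at 0)"
    by (auto intro!: derivative_eq_intros)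
  then have "((\<lambda>h. (exp (h * x) - 1) / h) \<longlongrightarrow> x) (at 0)"
    by (simp add: DERIV_def)
  then show ?thesis using assms by (auto simp: tendsto_at_iff_sequentially o_def)
qed

text \<open>This is the derivative of the characteristic function at \<open>c\<close>. Differentiation under the integral is
justified by difference quotients that are dominated by \<open>\<bar>X\<bar>\<close>.\<close>

lemma (in prob_space) expectation_mult_iexp_gaussian:
  fixes X :: "'a \<Rightarrow> real" and v :: real
  assumes X: "integrable M X"
    and char: "\<And>s. (CLINT \<omega>|M. iexp (s * X \<omega>)) = complex_of_real (exp (- (s\<^sup>2 * v) / 2))"
  shows "(CLINT \<omega>|M. X \<omega> * iexp (c * X \<omega>)) = \<i> * complex_of_real (c * v * exp (- (c\<^sup>2 * v) / 2))"
proof -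
  have [measurable]: "X \<in> borel_measurable M" using X by auto
  define e where "e n = 1 / real (Suc n)" for n
  have e: "e n > 0" for n by (simp add: e_def)
  have e0: "e \<longlonglongrightarrow> 0" unfolding e_def using LIMSEQ_inverse_real_of_nat by (simp add: inverse_eq_divide)
  have ee0: "(\<lambda>n. complex_of_real (e n)) \<longlonglongrightarrow> 0" using tendsto_of_real[OF e0, where ?'a = complex] by simp
  have int: "integrable M (\<lambda>\<omega>. iexp (s * X \<omega>))" for s
    by (rule integrable_bounded_complex[where C = 1]) auto
  have quot: "(CLINT \<omega>|M. ((iexp (e n * X \<omega>) - 1) / e n) * iexp (c * X \<omega>)) =
     complex_of_real ((exp (- ((c + e n)\<^sup>2 * v) / 2) - exp (- (c\<^sup>2 * v) / 2)) / e n)" for n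
  proof -
    have "(CLINT \<omega>|M. ((iexp (e n * X \<omega>) - 1) / e n) * iexp (c * X \<omega>)) =
      (CLINT \<omega>|M. (iexp ((c + e n) * X \<omega>) - iexp (c * X \<omega>)) / e n)"
      by (intro Bochner_Integration.integral_cong)
        (auto simp: ring_distribs exp_add diff_divide_distrib mult_ac)
    also have "\<dots> = ((CLINT \<omega>|M. iexp ((c + e n) * X \<omega>)) - (CLINT \<omega>|M. iexp (c * X \<omega>))) / e n"
      using int[of "c + e n"] int[of c] by simp
    finally show ?thesis unfolding char by simp
  qed
  have "(\<lambda>n. (CLINT \<omega>|M. ((iexp (e n * X \<omega>) - 1) / e n) * iexp (c * X \<omega>))) \<longlonglongrightarrow>
    (CLINT \<omega>|M. (\<i> * X \<omega>) * iexp (c * X \<omega>))"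
  proof (rule integral_dominated_convergence[where w = "\<lambda>\<omega>. \<bar>X \<omega>\<bar>"])
    show "AE \<omega> in M. (\<lambda>n. ((iexp (e n * X \<omega>) - 1) / e n) * iexp (c * X \<omega>)) \<longlonglongrightarrow> (\<i> * X \<omega>) * iexp (c * X \<omega>)"
    proof (intro AE_I2 tendsto_mult tendsto_const)
      fix \<omega>
      show "(\<lambda>n. (iexp (e n * X \<omega>) - 1) / e n) \<longlonglongrightarrow> \<i> * X \<omega>"
        using tendsto_exp_quotient[OF ee0, of "\<i> * X \<omega>"] e by (simp add: mult_ac less_imp_neq[symmetric])
    qed
    show "AE \<omega> in M. norm (((iexp (e n * X \<omega>) - 1) / e n) * iexp (c * X \<omega>)) \<le> \<bar>X \<omega>\<bar>" for n
    proof (intro AE_I2)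
      fix \<omega>
      have "cmod (iexp (e n * X \<omega>) - 1) \<le> e n * \<bar>X \<omega>\<bar>"
        using iexp_approx1[of "e n * X \<omega>" 0] e[of n] by (simp add: abs_mult)
      then show "norm (((iexp (e n * X \<omega>) - 1) / e n) * iexp (c * X \<omega>)) \<le> \<bar>X \<omega>\<bar>"
        using e[of n] unfolding norm_mult norm_divide by (simp add: divide_le_eq mult.commute)
    qed
  qed (use X in auto)
  moreover have "(\<lambda>n. complex_of_real ((exp (- ((c + e n)\<^sup>2 * v) / 2) - exp (- (c\<^sup>2 * v) / 2)) / e n)) \<longlonglongrightarrow>
      complex_of_real (- c * v * exp (- (c\<^sup>2 * v) / 2))"
  proof (rule tendsto_of_real)
    have "((\<lambda>x. exp (- (x\<^sup>2 * v) / 2)) has_field_derivative (- c * v * exp (- (c\<^sup>2 * v) / 2))) (at c)"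
      by (auto intro!: derivative_eq_intros)
    then have "((\<lambda>h. (exp (- ((c + h)\<^sup>2 * v) / 2) - exp (- (c\<^sup>2 * v) / 2)) / h) \<longlongrightarrow>
        - c * v * exp (- (c\<^sup>2 * v) / 2)) (at 0)"
      by (simp add: DERIV_def)
    then show "(\<lambda>n. (exp (- ((c + e n)\<^sup>2 * v) / 2) - exp (- (c\<^sup>2 * v) / 2)) / e n) \<longlonglongrightarrow>
       - c * v * exp (- (c\<^sup>2 * v) / 2)"
      using e0 e by (auto simp: tendsto_at_iff_sequentially o_def less_imp_neq[symmetric])
  qed
  ultimately have "(CLINT \<omega>|M. (\<i> * X \<omega>) * iexp (c * X \<omega>)) = complex_of_real (- c * v * exp (- (c\<^sup>2 * v) / 2))"
    unfolding quot by (rule LIMSEQ_unique)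
  then have "\<i> * (CLINT \<omega>|M. X \<omega> * iexp (c * X \<omega>)) = complex_of_real (- c * v * exp (- (c\<^sup>2 * v) / 2))"
    by (simp add: mult.assoc)
  then have "\<i> * (\<i> * (CLINT \<omega>|M. X \<omega> * iexp (c * X \<omega>))) = \<i> * complex_of_real (- c * v * exp (- (c\<^sup>2 * v) / 2))"
    by simp
  then have "- (CLINT \<omega>|M. X \<omega> * iexp (c * X \<omega>)) = \<i> * complex_of_real (- c * v * exp (- (c\<^sup>2 * v) / 2))"
    by (simp only: mult.assoc[symmetric] i_squared) simp
  then show ?thesis by (simp add: equation_minus_iff mult_ac)
qed

lemma (in prob_space) centered_gaussian_moments:
  assumes X: "centered_gaussian M X"
  shows "integrable M (\<lambda>\<omega>. X \<omega> ^ k)" "(LINT \<omega>|M. X \<omega>) = 0"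
    "(CLINT \<omega>|M. iexp (s * X \<omega>)) = complex_of_real (exp (- (s\<^sup>2 * (LINT \<omega>|M. (X \<omega>)\<^sup>2)) / 2))"
proof -
  have [measurable]: "X \<in> borel_measurable M" using X by (simp add: centered_gaussian_def)
  have "integrable M (\<lambda>\<omega>. X \<omega> ^ k) \<and> (LINT \<omega>|M. X \<omega>) = 0 \<and>
     (CLINT \<omega>|M. iexp (s * X \<omega>)) = complex_of_real (exp (- (s\<^sup>2 * (LINT \<omega>|M. (X \<omega>)\<^sup>2)) / 2))"
    (is ?thesis)
  proof (cases "AE \<omega> in M. X \<omega> = 0")
    case True
    have 1: "integrable M (\<lambda>\<omega>. X \<omega> ^ k)"
      by (subst integrable_cong_AE[where g = "\<lambda>_. 0 ^ k"]) (use True in auto)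
    have 2: "(LINT \<omega>|M. X \<omega>) = (LINT \<omega>|M. 0)" by (rule integral_cong_AE) (use True in auto)
    have 3: "(LINT \<omega>|M. (X \<omega>)\<^sup>2) = (LINT \<omega>|M. 0)" by (rule integral_cong_AE) (use True in auto)
    have 4: "(CLINT \<omega>|M. iexp (s * X \<omega>)) = (CLINT \<omega>|M. 1)" by (rule integral_cong_AE) (use True in auto)
    show ?thesis using 1 2 3 4 by (simp add: prob_space)
  next
    case False
    then obtain \<sigma> where s: "\<sigma> > 0" and d: "distributed M lborel X (normal_density 0 \<sigma>)"
      using X by (auto simp: centered_gaussian_def)
    have "integrable M (\<lambda>\<omega>. X \<omega> ^ k) = integrable lborel (\<lambda>x. normal_density 0 \<sigma> x * x ^ k)"
      by (rule distributed_integrable[OF d, symmetric]) auto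
    then have 1: "integrable M (\<lambda>\<omega>. X \<omega> ^ k)" using integrable_normal_moment[OF s, of 0 k] by simp
    have 2: "(LINT \<omega>|M. X \<omega>) = 0" using normal_distributed_expectation[OF s d] .
    have 3: "(LINT \<omega>|M. (X \<omega>)\<^sup>2) = \<sigma>\<^sup>2" using normal_distributed_variance[OF s d] 2 by simp
    have d': "distributed M lborel (\<lambda>\<omega>. X \<omega> / \<sigma>) std_normal_density"
      using normal_standard_normal_convert[OF s, of X 0] d by simp
    then have "distr M lborel (\<lambda>\<omega>. X \<omega> / \<sigma>) = std_normal_distribution"
      by (simp add: distributed_def)
    then have "char std_normal_distribution (s * \<sigma>) = (CLINT x|distr M lborel (\<lambda>\<omega>. X \<omega> / \<sigma>). iexp (s * \<sigma> * x))"
      by (simp add: char_def)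
    also have "\<dots> = (CLINT \<omega>|M. iexp (s * X \<omega>))"
      using s by (subst integral_distr) (auto simp: mult_ac)
    finally have 4: "(CLINT \<omega>|M. iexp (s * X \<omega>)) = complex_of_real (exp (- (s\<^sup>2 * \<sigma>\<^sup>2) / 2))"
      unfolding char_std_normal_distribution by (simp add: power_mult_distrib)
    show ?thesis using 1 2 3 4 by simp
  qed
  then show "integrable M (\<lambda>\<omega>. X \<omega> ^ k)" "(LINT \<omega>|M. X \<omega>) = 0"
    "(CLINT \<omega>|M. iexp (s * X \<omega>)) = complex_of_real (exp (- (s\<^sup>2 * (LINT \<omega>|M. (X \<omega>)\<^sup>2)) / 2))" by auto
qed

text \<open>The joint law and the product of the marginal laws have the same characteristic function.\<close>

lemma (in prob_space) indep_vars_if_char_factorizes: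
  fixes X :: "'i \<Rightarrow> 'a \<Rightarrow> real"
  assumes I: "finite I" and X: "\<And>k. k \<in> I \<Longrightarrow> X k \<in> borel_measurable M"
    and eq: "\<And>t. (CLINT x|M. iexp (\<Sum>k\<in>I. t k * X k x)) = (\<Prod>k\<in>I. CLINT x|M. iexp (t k * X k x))"
  shows "indep_vars (\<lambda>_. borel) X I"
proof (cases "I = {}")
  case True
  then show ?thesis by (simp add: indep_vars_def indep_sets_def)
next
  case False
  \<comment> \<open>Outside of \<open>I\<close> any probability measure would do; a product of probability measures needs one for every index.\<close>
  define D where "D k = (if k \<in> I then distr M borel (X k) else return borel 0)" for k
  have D: "prob_space (D k)" for k
  proof (cases "k \<in> I")
    case True
    then show ?thesis unfolding D_def using prob_space_distr[OF X[OF True]] by simp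
  next
    case False
    then show ?thesis unfolding D_def using prob_space_return[of "0::real" borel] by simp
  qed
  interpret D: product_prob_space D by (rule product_prob_spaceI) (rule D)
  have P: "prob_space (PiM I D)" by (rule prob_space_PiM) (rule D)
  have sD [measurable_cong]: "sets (D k) = sets borel" for k by (simp add: D_def)
  have "distr M (PiM I (\<lambda>_. borel)) (\<lambda>x. \<lambda>k\<in>I. X k x) = distr (PiM I D) (PiM I (\<lambda>_. borel)) (\<lambda>x. \<lambda>k\<in>I. x k)"
  proof (rule joint_law_eqI_char[OF I prob_space_axioms P])
    fix t :: "'i \<Rightarrow> real"
    have "(CLINT x|PiM I D. iexp (\<Sum>k\<in>I. t k * x k)) = (CLINT x|PiM I D. (\<Prod>k\<in>I. iexp (t k * x k)))"
      using I by (simp add: sum_distrib_left exp_sum)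
    also have "\<dots> = (\<Prod>k\<in>I. CLINT y|D k. iexp (t k * y))"
    proof (rule D.product_integral_prod[OF I])
      fix k assume "k \<in> I"
      show "integrable (D k) (\<lambda>y. iexp (t k * y))"
        by (rule prob_space.integrable_bounded_complex[OF D, where C = 1]) auto
    qed
    also have "\<dots> = (\<Prod>k\<in>I. CLINT x|M. iexp (t k * X k x))"
      using X by (intro prod.cong refl) (auto simp: D_def integral_distr)
    finally show "(CLINT x|M. iexp (\<Sum>k\<in>I. t k * X k x)) = (CLINT x|PiM I D. iexp (\<Sum>k\<in>I. t k * x k))"
      using eq by simp
    show "(\<lambda>x. x k) \<in> borel_measurable (PiM I D)" if "k \<in> I" for k
      using measurable_component_singleton[OF that, of D] by (simp cong: measurable_cong_sets add: sD)
  qed (rule X)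
  also have "\<dots> = PiM I D"
  proof -
    have "distr (PiM I D) (PiM I (\<lambda>_. borel)) (\<lambda>x. \<lambda>k\<in>I. x k) = distr (PiM I D) (PiM I D) (\<lambda>x. x)"
    proof (rule distr_cong)
      show "sets (PiM I (\<lambda>_. borel)) = sets (PiM I D)" by (rule sets_PiM_cong) (simp_all add: sD)
      show "(\<lambda>k\<in>I. x k) = x" if "x \<in> space (PiM I D)" for x
        using that by (simp add: space_PiM PiE_restrict)
    qed simp
    then show ?thesis by simp
  qed
  also have "\<dots> = PiM I (\<lambda>k. distr M borel (X k))"
    by (intro PiM_cong) (auto simp: D_def)
  finally show ?thesis
    using indep_vars_iff_distr_eq_PiM'[OF False, where M' = "\<lambda>_. borel" and X = X] X by simp
qed

locale isonormal_process =
  fixes M :: "'a measure" and B :: "(real \<Rightarrow> real) \<Rightarrow> 'a \<Rightarrow> real"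
  assumes isonormal: "isonormal M B"

sublocale isonormal_process \<subseteq> prob_space M
  using isonormal by (simp add: isonormal_def)

context isonormal_process begin

text \<open>An isonormal process is Gaussian along finite sets of functions. For a family \<open>h\<close> with repetitions the
coefficients of equal functions are collected first.\<close>

lemma gaussian_lincomb:
  assumes J: "finite J" and h: "\<And>j. j \<in> J \<Longrightarrow> h j \<in> L2 lborel"
  shows "centered_gaussian M (\<lambda>\<omega>. \<Sum>j\<in>J. c j * B (h j) \<omega>)"
proof -
  define a where "a g = (\<Sum>j\<in>{j\<in>J. h j = g}. c j)" for g
  have "(\<Sum>j\<in>J. c j * B (h j) \<omega>) = (\<Sum>g\<in>h ` J. a g * B g \<omega>)" for \<omega>
    using J by (subst sum.image_gen[OF J, where g = h]) (auto simp: a_def sum_distrib_right intro!: sum.cong)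
  moreover have "centered_gaussian M (\<lambda>\<omega>. \<Sum>g\<in>h ` J. a g * B g \<omega>)"
  proof -
    have "finite (h ` J) \<and> h ` J \<subseteq> L2 lborel" using J h by auto
    then show ?thesis using isonormal by (simp add: isonormal_def)
  qed
  ultimately show ?thesis by simp
qed

lemma gaussian: "h \<in> L2 lborel \<Longrightarrow> centered_gaussian M (B h)"
  using gaussian_lincomb[of "{()}" "\<lambda>_. h" "\<lambda>_. 1"] by simp

lemma B_measurable [measurable]: "h \<in> L2 lborel \<Longrightarrow> B h \<in> borel_measurable M"
  using gaussian by (simp add: centered_gaussian_def)

lemma covariance: "h \<in> L2 lborel \<Longrightarrow> g \<in> L2 lborel \<Longrightarrow> (LINT \<omega>|M. B h \<omega> * B g \<omega>) = inner_L2 lborel h g"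
  using isonormal by (simp add: isonormal_def)

lemma B_L2: "h \<in> L2 lborel \<Longrightarrow> B h \<in> L2 M"
  using centered_gaussian_moments(1)[OF gaussian, of h 2] by (simp add: L2_def)

lemma B_power_integrable: "h \<in> L2 lborel \<Longrightarrow> integrable M (\<lambda>\<omega>. B h \<omega> ^ k)"
  using centered_gaussian_moments(1)[OF gaussian, of h k] .

lemma variance_lincomb:
  assumes J: "finite J" and h: "\<And>j. j \<in> J \<Longrightarrow> h j \<in> L2 lborel"
  shows "(LINT \<omega>|M. (\<Sum>j\<in>J. c j * B (h j) \<omega>)\<^sup>2) =
    inner_L2 lborel (\<lambda>x. \<Sum>j\<in>J. c j * h j x) (\<lambda>x. \<Sum>j\<in>J. c j * h j x)"
proof -
  have "(LINT \<omega>|M. (\<Sum>j\<in>J. c j * B (h j) \<omega>)\<^sup>2) =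
      (\<Sum>i\<in>J. \<Sum>j\<in>J. c i * c j * inner_L2 M (B (h i)) (B (h j)))"
    unfolding power2_eq_square using h by (intro inner_L2_lincomb) (auto intro: B_L2)
  also have "\<dots> = (\<Sum>i\<in>J. \<Sum>j\<in>J. c i * c j * inner_L2 lborel (h i) (h j))"
    using h by (intro sum.cong refl) (simp add: covariance)
  also have "\<dots> = inner_L2 lborel (\<lambda>x. \<Sum>j\<in>J. c j * h j x) (\<lambda>x. \<Sum>j\<in>J. c j * h j x)"
    using h by (intro inner_L2_lincomb[symmetric]) auto
  finally show ?thesis .
qed

lemma char_lincomb:
  assumes J: "finite J" and h: "\<And>j. j \<in> J \<Longrightarrow> h j \<in> L2 lborel"
  shows "(CLINT \<omega>|M. iexp (\<Sum>j\<in>J. c j * B (h j) \<omega>)) =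
    complex_of_real (exp (- inner_L2 lborel (\<lambda>x. \<Sum>j\<in>J. c j * h j x) (\<lambda>x. \<Sum>j\<in>J. c j * h j x) / 2))"
proof -
  have "centered_gaussian M (\<lambda>\<omega>. \<Sum>j\<in>J. c j * B (h j) \<omega>)"
    using J h by (rule gaussian_lincomb)
  from centered_gaussian_moments(3)[OF this, of 1] show ?thesis
    by (simp add: variance_lincomb[OF J h])
qed

lemma char_B: "h \<in> L2 lborel \<Longrightarrow>
  (CLINT \<omega>|M. iexp (s * B h \<omega>)) = complex_of_real (exp (- (s\<^sup>2 * inner_L2 lborel h h) / 2))"
  using centered_gaussian_moments(3)[OF gaussian, of h s] covariance[of h h]
  by (simp add: power2_eq_square)

text \<open>The second moment of the difference is the squared norm of \<open>g - (\<Sum>j\<in>J. c j * h j)\<close>, which is zero.\<close>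

lemma B_linear_AE:
  assumes J: "finite J" and h: "\<And>j. j \<in> J \<Longrightarrow> h j \<in> L2 lborel" and g: "g \<in> L2 lborel"
    and eq: "\<And>x. g x = (\<Sum>j\<in>J. c j * h j x)"
  shows "AE \<omega> in M. B g \<omega> = (\<Sum>j\<in>J. c j * B (h j) \<omega>)"
proof -
  let ?J = "insert None (Some ` J)"
  define h' where "h' z = (case z of None \<Rightarrow> g | Some j \<Rightarrow> h j)" for z
  define c' where "c' z = (case z of None \<Rightarrow> 1 | Some j \<Rightarrow> - c j)" for z
  have s: "(\<Sum>j\<in>?J. c' j * F (h' j)) = F g - (\<Sum>j\<in>J. c j * F (h j))" for F :: "(real \<Rightarrow> real) \<Rightarrow> real"
    using J by (subst sum.insert) (auto simp: sum.reindex sum_negf h'_def c'_def)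
  have "(LINT \<omega>|M. (\<Sum>j\<in>?J. c' j * B (h' j) \<omega>)\<^sup>2) =
    inner_L2 lborel (\<lambda>x. \<Sum>j\<in>?J. c' j * h' j x) (\<lambda>x. \<Sum>j\<in>?J. c' j * h' j x)"
    using J h g by (intro variance_lincomb) (auto simp: h'_def)
  also have "\<dots> = 0" using s[of "\<lambda>k. k x" for x] eq by simp
  finally have "(LINT \<omega>|M. (B g \<omega> - (\<Sum>j\<in>J. c j * B (h j) \<omega>)) * (B g \<omega> - (\<Sum>j\<in>J. c j * B (h j) \<omega>))) = 0"
    unfolding s[of "\<lambda>k. B k \<omega>" for \<omega>] by (simp add: power2_eq_square)
  moreover have "(\<lambda>\<omega>. B g \<omega> - (\<Sum>j\<in>J. c j * B (h j) \<omega>)) \<in> L2 M"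
    using h g by (intro L2_diff L2_lincomb B_L2) auto
  ultimately show ?thesis using inner_L2_self_zero_AE by fastforce
qed

text \<open>For jointly Gaussian variables the absence of correlation makes the characteristic function factorize.\<close>

lemma indep_vars_orthogonal:
  assumes I: "finite I" and h: "\<And>j. j \<in> I \<Longrightarrow> h j \<in> L2 lborel"
    and orth: "\<And>i j. i \<in> I \<Longrightarrow> j \<in> I \<Longrightarrow> i \<noteq> j \<Longrightarrow> inner_L2 lborel (h i) (h j) = 0"
  shows "indep_vars (\<lambda>_. borel) (\<lambda>i. B (h i)) I"
proof (rule indep_vars_if_char_factorizes[OF I])
  fix t :: "'b \<Rightarrow> real"
  have "inner_L2 lborel (\<lambda>x. \<Sum>j\<in>I. t j * h j x) (\<lambda>x. \<Sum>j\<in>I. t j * h j x) =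
     (\<Sum>i\<in>I. \<Sum>j\<in>I. t i * t j * inner_L2 lborel (h i) (h j))"
    using h by (intro inner_L2_lincomb) auto
  also have "\<dots> = (\<Sum>i\<in>I. \<Sum>j\<in>I. if j = i then (t i)\<^sup>2 * inner_L2 lborel (h i) (h i) else 0)"
    using orth by (intro sum.cong refl) (auto simp: power2_eq_square)
  also have "\<dots> = (\<Sum>i\<in>I. (t i)\<^sup>2 * inner_L2 lborel (h i) (h i))"
    using I by simp
  finally have *: "inner_L2 lborel (\<lambda>x. \<Sum>j\<in>I. t j * h j x) (\<lambda>x. \<Sum>j\<in>I. t j * h j x) =
    (\<Sum>i\<in>I. (t i)\<^sup>2 * inner_L2 lborel (h i) (h i))" .
  have "(CLINT x|M. iexp (\<Sum>k\<in>I. t k * B (h k) x)) =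
      complex_of_real (exp (\<Sum>i\<in>I. - ((t i)\<^sup>2 * inner_L2 lborel (h i) (h i)) / 2))"
    by (subst char_lincomb[OF I h]) (auto simp: * sum_negf sum_divide_distrib simp del: of_real_sum)
  also have "\<dots> = (\<Prod>k\<in>I. CLINT x|M. iexp (t k * B (h k) x))"
    unfolding exp_sum[OF I] of_real_prod using h by (intro prod.cong refl char_B[symmetric]) auto
  finally show "(CLINT x|M. iexp (\<Sum>k\<in>I. t k * B (h k) x)) = (\<Prod>k\<in>I. CLINT x|M. iexp (t k * B (h k) x))" .
qed (use h in auto)

end

section \<open>Convergence in mean square and product functions\<close>

lemma inner_L2_Cauchy_Schwarz:
  assumes f: "f \<in> L2 N" and g: "g \<in> L2 N"
  shows "(inner_L2 N f g)\<^sup>2 \<le> inner_L2 N f f * inner_L2 N g g"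
proof (cases "inner_L2 N g g = 0")
  case True
  then have "AE x in N. g x = 0" using inner_L2_self_zero_AE[OF g] by simp
  then have "inner_L2 N f g = 0" by (intro integral_eq_zero_AE) auto
  then show ?thesis using True by simp
next
  case False
  have gg: "inner_L2 N g g > 0" using False by (simp add: less_le)
  define c where "c = inner_L2 N f g / inner_L2 N g g"
  have "0 \<le> (LINT x|N. (f x - c * g x)\<^sup>2)" by simp
  also have "\<dots> = (LINT x|N. f x * f x - (2 * c) * (f x * g x) + c\<^sup>2 * (g x * g x))"
    by (intro Bochner_Integration.integral_cong) (auto simp: power2_eq_square algebra_simps)
  also have "\<dots> = inner_L2 N f f - 2 * c * inner_L2 N f g + c\<^sup>2 * inner_L2 N g g"
    using L2_integrable_mult[OF f f] L2_integrable_mult[OF f g] L2_integrable_mult[OF g g] by simp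
  also have "\<dots> = inner_L2 N f f - (inner_L2 N f g)\<^sup>2 / inner_L2 N g g"
    using gg by (simp add: c_def field_simps power2_eq_square)
  finally show ?thesis using gg by (simp add: field_simps)
qed

lemma inner_L2_diff_left:
  assumes "f \<in> L2 N" "f' \<in> L2 N" "g \<in> L2 N"
  shows "inner_L2 N (\<lambda>x. f x - f' x) g = inner_L2 N f g - inner_L2 N f' g"
  using L2_integrable_mult[OF assms(1,3)] L2_integrable_mult[OF assms(2,3)]
  by (simp add: left_diff_distrib)

lemma inner_L2_tendsto:
  assumes f: "\<And>k. F k \<in> L2 N" "f \<in> L2 N" and g: "g \<in> L2 N"
    and lim: "(\<lambda>k. LINT x|N. (F k x - f x)\<^sup>2) \<longlonglongrightarrow> 0"
  shows "(\<lambda>k. inner_L2 N (F k) g) \<longlonglongrightarrow> inner_L2 N f g"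
proof -
  have "(\<lambda>k. inner_L2 N (F k) g - inner_L2 N f g) \<longlonglongrightarrow> 0"
  proof (rule tendsto_rabs_zero_cancel, rule tendsto_sandwich[OF _ _ tendsto_const])
    show "\<forall>\<^sub>F k in sequentially. 0 \<le> \<bar>inner_L2 N (F k) g - inner_L2 N f g\<bar>" by simp
    show "\<forall>\<^sub>F k in sequentially. \<bar>inner_L2 N (F k) g - inner_L2 N f g\<bar> \<le>
       sqrt ((LINT x|N. (F k x - f x)\<^sup>2) * inner_L2 N g g)"
    proof (intro always_eventually allI)
      fix k
      have "(inner_L2 N (\<lambda>x. F k x - f x) g)\<^sup>2 \<le> inner_L2 N (\<lambda>x. F k x - f x) (\<lambda>x. F k x - f x) * inner_L2 N g g"
        using f g by (intro inner_L2_Cauchy_Schwarz L2_diff) auto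
      then have "(inner_L2 N (F k) g - inner_L2 N f g)\<^sup>2 \<le> (LINT x|N. (F k x - f x)\<^sup>2) * inner_L2 N g g"
        by (simp add: inner_L2_diff_left f g power2_eq_square)
      from real_sqrt_le_mono[OF this]
      show "\<bar>inner_L2 N (F k) g - inner_L2 N f g\<bar> \<le> sqrt ((LINT x|N. (F k x - f x)\<^sup>2) * inner_L2 N g g)"
        by simp
    qed
    show "(\<lambda>k. sqrt ((LINT x|N. (F k x - f x)\<^sup>2) * inner_L2 N g g)) \<longlonglongrightarrow> 0"
      using tendsto_real_sqrt[OF tendsto_mult_left_zero[OF lim]] by simp
  qed
  then show ?thesis by (simp add: LIM_zero_iff)
qed

lemma norm_L2_tendsto:
  assumes f: "\<And>k. F k \<in> L2 N" "f \<in> L2 N"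
    and lim: "(\<lambda>k. LINT x|N. (F k x - f x)\<^sup>2) \<longlonglongrightarrow> 0"
  shows "(\<lambda>k. LINT x|N. (F k x)\<^sup>2) \<longlonglongrightarrow> (LINT x|N. (f x)\<^sup>2)"
proof -
  have eq: "(LINT x|N. (F k x)\<^sup>2) = (LINT x|N. (F k x - f x)\<^sup>2) + 2 * inner_L2 N (F k) f - inner_L2 N f f" for k
  proof -
    have "(LINT x|N. (F k x - f x)\<^sup>2) = (LINT x|N. F k x * F k x - 2 * (F k x * f x) + f x * f x)"
      by (intro Bochner_Integration.integral_cong) (auto simp: power2_eq_square algebra_simps)
    also have "\<dots> = inner_L2 N (F k) (F k) - 2 * inner_L2 N (F k) f + inner_L2 N f f"
      using L2_integrable_mult[OF f(1) f(1), of k k] L2_integrable_mult[OF f(1) f(2), of k] L2_integrable_mult[OF f(2) f(2)]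
      by simp
    finally show ?thesis by (simp add: power2_eq_square)
  qed
  have "(\<lambda>k. (LINT x|N. (F k x - f x)\<^sup>2) + 2 * inner_L2 N (F k) f - inner_L2 N f f) \<longlonglongrightarrow>
     0 + 2 * inner_L2 N f f - inner_L2 N f f"
    by (intro tendsto_intros lim inner_L2_tendsto f)
  then show ?thesis unfolding eq by (simp add: power2_eq_square)
qed

lemma L2_nn_integral_tendsto:
  assumes "\<And>k. F k \<in> L2 N" "f \<in> L2 N"
    and "(\<lambda>k. \<integral>\<^sup>+x. ennreal ((F k x - f x)\<^sup>2) \<partial>N) \<longlonglongrightarrow> 0"
  shows "(\<lambda>k. LINT x|N. (F k x - f x)\<^sup>2) \<longlonglongrightarrow> 0"
proof -
  have "(\<integral>\<^sup>+x. ennreal ((F k x - f x)\<^sup>2) \<partial>N) = ennreal (LINT x|N. (F k x - f x)\<^sup>2)" for k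
    using L2_diff[OF assms(1)[of k] assms(2)] by (intro nn_integral_eq_integral) (auto simp: L2_def)
  then show ?thesis using assms(3) by (simp add: ennreal_tendsto_0_iff)
qed

lemma L2_product:
  fixes h :: "nat \<Rightarrow> real \<Rightarrow> real"
  assumes "\<And>j. j < q \<Longrightarrow> h j \<in> L2 lborel"
  shows "(\<lambda>x. \<Prod>j<q. h j (x j)) \<in> L2 (lborel_pow q)"
proof -
  interpret product_sigma_finite "\<lambda>_. lborel :: real measure" ..
  have "(\<lambda>x. \<Prod>j<q. h j (x j)) \<in> borel_measurable (lborel_pow q)"
    using assms by (intro borel_measurable_prod measurable_compose[OF measurable_component_singleton L2_measurable]) auto
  moreover have "integrable (lborel_pow q) (\<lambda>x. \<Prod>j\<in>{..<q}. (h j (x j))\<^sup>2)"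
    using assms by (intro product_integrable_prod) (auto simp: L2_def)
  ultimately show ?thesis by (simp add: L2_def prod_power_distrib)
qed

lemma inner_L2_product:
  fixes h g :: "nat \<Rightarrow> real \<Rightarrow> real"
  assumes "\<And>j. j < q \<Longrightarrow> h j \<in> L2 lborel" "\<And>j. j < q \<Longrightarrow> g j \<in> L2 lborel"
  shows "inner_L2 (lborel_pow q) (\<lambda>x. \<Prod>j<q. h j (x j)) (\<lambda>x. \<Prod>j<q. g j (x j)) =
    (\<Prod>j<q. inner_L2 lborel (h j) (g j))"
proof -
  interpret product_sigma_finite "\<lambda>_. lborel :: real measure" ..
  have "inner_L2 (lborel_pow q) (\<lambda>x. \<Prod>j<q. h j (x j)) (\<lambda>x. \<Prod>j<q. g j (x j)) =
    (LINT x|lborel_pow q. (\<Prod>j\<in>{..<q}. h j (x j) * g j (x j)))"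
    by (simp add: prod.distrib)
  also have "\<dots> = (\<Prod>j<q. inner_L2 lborel (h j) (g j))"
    using assms by (intro product_integral_prod) (auto intro: L2_integrable_mult)
  finally show ?thesis .
qed

lemma elementary_data_indicator_L2:
  assumes "elementary_data q n A a" "i \<in> {..<q} \<rightarrow>\<^sub>E {..<n}" "j < q"
  shows "indicator (A (i j)) \<in> L2 lborel"
  using assms by (intro L2_indicator) (auto simp: elementary_data_def PiE_iff)

lemma elementary_fun_L2:
  assumes "elementary_data q n A a"
  shows "elementary_fun q n A a \<in> L2 (lborel_pow q)"
  unfolding elementary_fun_def[abs_def]
  by (intro L2_lincomb L2_product elementary_data_indicator_L2[OF assms])

lemma inner_L2_elementary_fun:
  assumes d: "elementary_data q n A a" and h: "\<And>j. j < q \<Longrightarrow> h j \<in> L2 lborel"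
  shows "inner_L2 (lborel_pow q) (elementary_fun q n A a) (\<lambda>x. \<Prod>j<q. h j (x j)) =
    (\<Sum>i \<in> {..<q} \<rightarrow>\<^sub>E {..<n}. a i * (\<Prod>j<q. inner_L2 lborel (indicator (A (i j))) (h j)))"
proof -
  let ?I = "{..<q} \<rightarrow>\<^sub>E {..<n}"
  have "inner_L2 (lborel_pow q) (elementary_fun q n A a) (\<lambda>x. \<Prod>j<q. h j (x j)) =
    inner_L2 (lborel_pow q) (\<lambda>x. \<Sum>i\<in>?I. a i * (\<Prod>j<q. indicator (A (i j)) (x j)))
       (\<lambda>x. \<Sum>u\<in>{()}. 1 * (\<Prod>j<q. h j (x j)))"
    by (simp add: elementary_fun_def[abs_def])
  also have "\<dots> = (\<Sum>i\<in>?I. \<Sum>u\<in>{()}. a i * 1 *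
     inner_L2 (lborel_pow q) (\<lambda>x. \<Prod>j<q. indicator (A (i j)) (x j)) (\<lambda>x. \<Prod>j<q. h j (x j)))"
    using h by (intro inner_L2_lincomb L2_product elementary_data_indicator_L2[OF d])
  also have "\<dots> = (\<Sum>i\<in>?I. a i * (\<Prod>j<q. inner_L2 lborel (indicator (A (i j))) (h j)))"
    using h by (intro sum.cong refl) (subst inner_L2_product, auto intro: elementary_data_indicator_L2[OF d])
  finally show ?thesis .
qed

lemma inner_L2_indicator:
  "A \<in> sets N \<Longrightarrow> B \<in> sets N \<Longrightarrow> inner_L2 N (indicator A) (indicator B) = measure N (A \<inter> B)"
  using sets.sets_into_space[of A N] by (simp add: indicator_inter_arith[symmetric] Int_absorb2 inf.coboundedI1)

section \<open>Second moments and S-transforms of multiple integrals\<close>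

context isonormal_process begin

text \<open>Expand \<open>h\<close> along the orthogonal functions \<open>g j\<close> with a remainder \<open>r\<close> orthogonal to all of them. By
independence the expectation is a product of one-dimensional ones, each of the form
\<open>E (X exp (\<i> c X))\<close> for a Gaussian \<open>X\<close>.\<close>

lemma stransform_product:
  assumes g: "\<And>j. j < q \<Longrightarrow> g j \<in> L2 lborel" and h: "h \<in> L2 lborel"
    and orth: "\<And>i j. i < q \<Longrightarrow> j < q \<Longrightarrow> i \<noteq> j \<Longrightarrow> inner_L2 lborel (g i) (g j) = 0"
  shows "(CLINT \<omega>|M. (\<Prod>j<q. complex_of_real (B (g j) \<omega>)) * iexp (B h \<omega>)) =
     \<i> ^ q * complex_of_real ((\<Prod>j<q. inner_L2 lborel (g j) h) * exp (- inner_L2 lborel h h / 2))"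
proof -
  define v where "v j = inner_L2 lborel (g j) (g j)" for j
  \<comment> \<open>If \<open>v j = 0\<close>, then \<open>g j\<close> vanishes almost everywhere and the value \<open>0\<close> of the quotient is the right one.\<close>
  define c where "c j = inner_L2 lborel (g j) h / v j" for j
  have cv: "c j * v j = inner_L2 lborel (g j) h" if "j < q" for j
  proof (cases "v j = 0")
    case True
    then have "AE x in lborel. g j x = 0" using inner_L2_self_zero_AE[OF g[OF that]] by (simp add: v_def)
    then have "inner_L2 lborel (g j) h = 0" by (intro integral_eq_zero_AE) auto
    then show ?thesis using True by simp
  qed (simp add: c_def)
  define r where "r x = h x - (\<Sum>j<q. c j * g j x)" for x
  have r: "r \<in> L2 lborel" unfolding r_def[abs_def] using g h by (intro L2_diff L2_lincomb) auto
  \<comment> \<open>The index \<open>q\<close> carries the remainder.\<close>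
  define k where "k j = (if j < q then g j else r)" for j
  define d where "d j = (if j < q then c j else 1)" for j
  have k: "k j \<in> L2 lborel" for j using g r by (simp add: k_def)
  have gr: "inner_L2 lborel r (g i) = 0" if i: "i < q" for i
  proof -
    have "inner_L2 lborel r (g i) = inner_L2 lborel h (g i) - inner_L2 lborel (\<lambda>x. \<Sum>j<q. c j * g j x) (g i)"
      unfolding r_def using g h i by (intro inner_L2_diff_left L2_lincomb) auto
    also have "inner_L2 lborel (\<lambda>x. \<Sum>j<q. c j * g j x) (g i) =
        inner_L2 lborel (\<lambda>x. \<Sum>j<q. c j * g j x) (\<lambda>x. \<Sum>u\<in>{()}. 1 * g i x)" by simp
    also have "\<dots> = (\<Sum>j<q. \<Sum>u\<in>{()}. c j * 1 * inner_L2 lborel (g j) (g i))"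
      using g i by (intro inner_L2_lincomb) auto
    also have "\<dots> = (\<Sum>j<q. if j = i then c i * v i else 0)"
      using orth i by (intro sum.cong) (auto simp: v_def)
    also have "\<dots> = inner_L2 lborel h (g i)" using i cv[OF i] by (simp add: mult.commute)
    finally show ?thesis by simp
  qed
  have orth': "inner_L2 lborel (k i) (k j) = 0" if "i \<le> q" "j \<le> q" "i \<noteq> j" for i j
    using that gr orth by (auto simp: k_def mult.commute)
  have ind: "indep_vars (\<lambda>_. borel) (\<lambda>i. B (k i)) {..q}"
    using k orth' by (intro indep_vars_orthogonal) auto
  define u where "u j x = (if j < q then complex_of_real x * iexp (c j * x) else iexp x)" for j x
  have ind': "indep_vars (\<lambda>_. borel) (\<lambda>i \<omega>. u i (B (k i) \<omega>)) {..q}"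
    by (rule indep_vars_compose2[OF ind]) (simp add: u_def[abs_def])
  have hk: "h x = (\<Sum>j\<le>q. d j * k j x)" for x
    by (simp add: lessThan_Suc_atMost[symmetric] d_def k_def r_def)
  have AEh: "AE \<omega> in M. B h \<omega> = (\<Sum>j\<le>q. d j * B (k j) \<omega>)"
    using k h hk by (intro B_linear_AE) auto
  have var: "(CLINT \<omega>|M. iexp (s * B (k j) \<omega>)) = complex_of_real (exp (- (s\<^sup>2 * inner_L2 lborel (k j) (k j)) / 2))" for s j
    using char_B[OF k] .
  have int1: "integrable M (\<lambda>\<omega>. B (k j) \<omega>)" for j
    using B_power_integrable[OF k, of j 1] by simp
  have int: "integrable M (\<lambda>\<omega>. u j (B (k j) \<omega>))" for j
  proof (rule Bochner_Integration.integrable_bound)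
    show "integrable M (\<lambda>\<omega>. \<bar>B (k j) \<omega>\<bar> + 1)" using int1[of j] by simp
    show "AE \<omega> in M. norm (u j (B (k j) \<omega>)) \<le> norm (\<bar>B (k j) \<omega>\<bar> + 1)"
      by (auto simp: u_def norm_mult)
    show "(\<lambda>\<omega>. u j (B (k j) \<omega>)) \<in> borel_measurable M"
      using k by (simp add: u_def)
  qed
  have Eu: "(CLINT \<omega>|M. u j (B (k j) \<omega>)) = \<i> * complex_of_real (c j * v j * exp (- ((c j)\<^sup>2 * v j) / 2))" if "j < q" for j
    using expectation_mult_iexp_gaussian[OF int1 var, of j "c j"] that by (simp add: u_def v_def k_def)
  have Euq: "(CLINT \<omega>|M. u q (B (k q) \<omega>)) = complex_of_real (exp (- inner_L2 lborel r r / 2))"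
    using var[of 1 q] by (simp add: u_def k_def)
  have "(CLINT \<omega>|M. (\<Prod>j<q. complex_of_real (B (g j) \<omega>)) * iexp (B h \<omega>)) =
    (CLINT \<omega>|M. (\<Prod>j\<le>q. u j (B (k j) \<omega>)))"
  proof (rule integral_cong_AE)
    show "(\<lambda>\<omega>. (\<Prod>j<q. complex_of_real (B (g j) \<omega>)) * iexp (B h \<omega>)) \<in> borel_measurable M"
      using g h by (intro borel_measurable_times borel_measurable_prod) auto
    show "(\<lambda>\<omega>. (\<Prod>j\<le>q. u j (B (k j) \<omega>))) \<in> borel_measurable M"
      using int by (intro borel_measurable_prod) auto
    show "AE \<omega> in M. (\<Prod>j<q. complex_of_real (B (g j) \<omega>)) * iexp (B h \<omega>) = (\<Prod>j\<le>q. u j (B (k j) \<omega>))"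
    proof (rule AE_mp[OF AEh], intro AE_I2 impI)
      fix \<omega> assume *: "B h \<omega> = (\<Sum>j\<le>q. d j * B (k j) \<omega>)"
      have "iexp (B h \<omega>) = (\<Prod>j\<le>q. iexp (d j * B (k j) \<omega>))"
        unfolding * of_real_sum sum_distrib_left by (rule exp_sum) simp
      also have "\<dots> = (\<Prod>j<q. iexp (c j * B (g j) \<omega>)) * iexp (B r \<omega>)"
        by (simp add: lessThan_Suc_atMost[symmetric] d_def k_def)
      finally show "(\<Prod>j<q. complex_of_real (B (g j) \<omega>)) * iexp (B h \<omega>) = (\<Prod>j\<le>q. u j (B (k j) \<omega>))"
        by (simp add: lessThan_Suc_atMost[symmetric] u_def k_def prod.distrib)
    qed
  qed
  also have "\<dots> = (\<Prod>j\<le>q. CLINT \<omega>|M. u j (B (k j) \<omega>))"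
    using ind' int by (intro indep_vars_lebesgue_integral) auto
  also have "\<dots> = (\<Prod>j<q. \<i> * complex_of_real (c j * v j * exp (- ((c j)\<^sup>2 * v j) / 2))) *
     complex_of_real (exp (- inner_L2 lborel r r / 2))"
    by (simp add: lessThan_Suc_atMost[symmetric] Euq Eu del: of_real_mult)
  also have "\<dots> = \<i> ^ q * complex_of_real ((\<Prod>j<q. c j * v j) * (exp (\<Sum>j<q. - ((c j)\<^sup>2 * v j) / 2) *
      exp (- inner_L2 lborel r r / 2)))"
    by (simp add: prod.distrib exp_sum)
  also have "exp (\<Sum>j<q. - ((c j)\<^sup>2 * v j) / 2) * exp (- inner_L2 lborel r r / 2) = exp (- inner_L2 lborel h h / 2)"
  proof -
    have "inner_L2 lborel h h = inner_L2 lborel (\<lambda>x. \<Sum>j\<le>q. d j * k j x) (\<lambda>x. \<Sum>j\<le>q. d j * k j x)"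
      by (simp add: hk)
    also have "\<dots> = (\<Sum>i\<le>q. \<Sum>j\<le>q. d i * d j * inner_L2 lborel (k i) (k j))"
      using k by (intro inner_L2_lincomb)
    also have "\<dots> = (\<Sum>i\<le>q. \<Sum>j\<le>q. if j = i then (d i)\<^sup>2 * inner_L2 lborel (k i) (k i) else 0)"
      using orth' by (intro sum.cong refl) (auto simp: power2_eq_square)
    also have "\<dots> = (\<Sum>j<q. (c j)\<^sup>2 * v j) + inner_L2 lborel r r"
      by (simp add: lessThan_Suc_atMost[symmetric] d_def k_def v_def)
    finally show ?thesis
      by (simp add: exp_add[symmetric] sum_negf sum_divide_distrib[symmetric] diff_divide_distrib)
  qed
  also have "(\<Prod>j<q. c j * v j) = (\<Prod>j<q. inner_L2 lborel (g j) h)"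
    by (intro prod.cong) (auto simp: cv)
  finally show ?thesis .
qed

lemma product_orthogonal_L2:
  fixes g :: "nat \<Rightarrow> real \<Rightarrow> real"
  assumes g: "\<And>j. j < q \<Longrightarrow> g j \<in> L2 lborel"
    and orth: "\<And>i j. i < q \<Longrightarrow> j < q \<Longrightarrow> i \<noteq> j \<Longrightarrow> inner_L2 lborel (g i) (g j) = 0"
  shows "(\<lambda>\<omega>. \<Prod>j<q. B (g j) \<omega>) \<in> L2 M"
proof -
  have "indep_vars (\<lambda>_. borel) (\<lambda>j. B (g j)) {..<q}"
    using g orth by (intro indep_vars_orthogonal) auto
  then have "indep_vars (\<lambda>_. borel) (\<lambda>j \<omega>. (B (g j) \<omega>)\<^sup>2) {..<q}"
    by (rule indep_vars_compose2) simp
  then have "integrable M (\<lambda>\<omega>. \<Prod>j<q. (B (g j) \<omega>)\<^sup>2)"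
    using g by (intro indep_vars_integrable) (auto intro: B_power_integrable)
  moreover have "(\<lambda>\<omega>. \<Prod>j<q. B (g j) \<omega>) \<in> borel_measurable M"
    using g by (intro borel_measurable_prod) auto
  ultimately show ?thesis by (simp add: L2_def prod_power_distrib)
qed

context
  fixes q n :: nat and A :: "nat \<Rightarrow> real set" and a :: "(nat \<Rightarrow> nat) \<Rightarrow> real"
  assumes data: "elementary_data q n A a"
begin

text \<open>The off-diagonal multi-indices, the only ones with nonzero coefficients.\<close>

definition "inj_indices = {i \<in> {..<q} \<rightarrow>\<^sub>E {..<n}. inj_on i {..<q}}"

lemma finite_inj_indices: "finite inj_indices"
  unfolding inj_indices_def by (intro finite_subset[OF _ finite_PiE[of "{..<q}" "\<lambda>_. {..<n}"]]) auto

lemma sum_inj_indices: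
  "(\<Sum>i \<in> {..<q} \<rightarrow>\<^sub>E {..<n}. a i * F i) = (\<Sum>i \<in> inj_indices. a i * F i)"
  using data by (intro sum.mono_neutral_right)
    (auto simp: inj_indices_def elementary_data_def intro!: finite_PiE)

lemma indicator_A_L2: "m < n \<Longrightarrow> indicator (A m) \<in> L2 lborel"
  using data by (intro L2_indicator) (auto simp: elementary_data_def)

lemma inner_indicator_A:
  assumes "m < n" "l < n"
  shows "inner_L2 lborel (indicator (A m)) (indicator (A l)) = (if m = l then measure lborel (A m) else 0)"
proof -
  have "inner_L2 lborel (indicator (A m)) (indicator (A l)) = measure lborel (A m \<inter> A l)"
    using data assms by (intro inner_L2_indicator) (auto simp: elementary_data_def)
  also have "A m \<inter> A l = (if m = l then A m else {})"
    using data assms by (auto simp: elementary_data_def disjoint_family_on_def)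
  finally show ?thesis by auto
qed

lemma inj_indicesD:
  assumes "i \<in> inj_indices"
  shows "j < q \<Longrightarrow> i j < n" "inj_on i {..<q}"
  using assms by (auto simp: inj_indices_def PiE_iff)

lemma inj_indices_orthogonal:
  assumes "i \<in> inj_indices" "j < q" "l < q" "j \<noteq> l"
  shows "inner_L2 lborel (indicator (A (i j))) (indicator (A (i l))) = 0"
  using assms inj_indicesD[OF assms(1)] by (auto simp: inner_indicator_A inj_on_def)

lemma elementary_integral_eq:
  "elementary_integral B q n A a = (\<lambda>\<omega>. \<Sum>i\<in>inj_indices. a i * (\<Prod>j<q. B (indicator (A (i j))) \<omega>))"
  unfolding elementary_integral_def[abs_def] by (intro ext sum_inj_indices)

lemma elementary_product_L2:
  "i \<in> inj_indices \<Longrightarrow> (\<lambda>\<omega>. \<Prod>j<q. B (indicator (A (i j))) \<omega>) \<in> L2 M"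
  using inj_indicesD by (intro product_orthogonal_L2 indicator_A_L2 inj_indices_orthogonal) auto

lemma elementary_integral_L2: "elementary_integral B q n A a \<in> L2 M"
  unfolding elementary_integral_eq by (intro L2_lincomb elementary_product_L2)

lemma stransform_elementary:
  assumes h: "h \<in> L2 lborel"
  shows "(CLINT \<omega>|M. complex_of_real (elementary_integral B q n A a \<omega>) * iexp (B h \<omega>)) =
    \<i> ^ q * complex_of_real (inner_L2 (lborel_pow q) (elementary_fun q n A a) (\<lambda>x. \<Prod>j<q. h (x j)) *
      exp (- inner_L2 lborel h h / 2))"
proof -
  let ?P = "\<lambda>i \<omega>. (\<Prod>j<q. complex_of_real (B (indicator (A (i j))) \<omega>)) * iexp (B h \<omega>)"
  have int: "integrable M (?P i)" if i: "i \<in> inj_indices" for i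
  proof (rule Bochner_Integration.integrable_bound)
    have L: "(\<lambda>\<omega>. \<Prod>j<q. B (indicator (A (i j))) \<omega>) \<in> L2 M" by (rule elementary_product_L2[OF i])
    have "(\<lambda>\<omega>. 1) \<in> L2 M" by (simp add: L2_def)
    from L2_integrable_mult[OF L this] show "integrable M (\<lambda>\<omega>. \<Prod>j<q. B (indicator (A (i j))) \<omega>)" by simp
    show "?P i \<in> borel_measurable M"
      using h inj_indicesD[OF i]
      by (intro borel_measurable_times borel_measurable_prod)
        (auto intro!: indicator_A_L2 measurable_compose[OF B_measurable])
    show "AE \<omega> in M. norm (?P i \<omega>) \<le> norm (\<Prod>j<q. B (indicator (A (i j))) \<omega>)"
      by (auto simp: norm_mult prod_norm[symmetric] abs_prod)
  qed
  have "(CLINT \<omega>|M. complex_of_real (elementary_integral B q n A a \<omega>) * iexp (B h \<omega>)) =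
    (CLINT \<omega>|M. (\<Sum>i\<in>inj_indices. complex_of_real (a i) * ?P i \<omega>))"
    by (simp add: elementary_integral_eq sum_distrib_right mult.assoc)
  also have "\<dots> = (\<Sum>i\<in>inj_indices. complex_of_real (a i) * (CLINT \<omega>|M. ?P i \<omega>))"
    using int by (subst Bochner_Integration.integral_sum) auto
  also have "\<dots> = (\<Sum>i\<in>inj_indices. complex_of_real (a i) *
     (\<i> ^ q * complex_of_real ((\<Prod>j<q. inner_L2 lborel (indicator (A (i j))) h) * exp (- inner_L2 lborel h h / 2))))"
    using h inj_indicesD by (intro sum.cong refl arg_cong2[where f = "(*)"] stransform_product indicator_A_L2 inj_indices_orthogonal) auto
  also have "\<dots> = \<i> ^ q * complex_of_real ((\<Sum>i\<in>inj_indices. a i * (\<Prod>j<q. inner_L2 lborel (indicator (A (i j))) h)) *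
       exp (- inner_L2 lborel h h / 2))"
    by (simp add: sum_distrib_left sum_distrib_right mult_ac)
  also have "(\<Sum>i\<in>inj_indices. a i * (\<Prod>j<q. inner_L2 lborel (indicator (A (i j))) h)) =
    inner_L2 (lborel_pow q) (elementary_fun q n A a) (\<lambda>x. \<Prod>j<q. h (x j))"
    using h by (subst inner_L2_elementary_fun[OF data]) (auto simp: sum_inj_indices)
  finally show ?thesis .
qed

text \<open>Grouped by the underlying set, each product is \<open>\<Prod>m<n. w m (B (A m))\<close> with independent
factors \<open>1\<close>, \<open>B (A m)\<close> or \<open>(B (A m))\<^sup>2\<close>. A set that occurs exactly once contributes mean zero.\<close>

lemma inner_elementary_products:
  assumes i: "i \<in> inj_indices" and k: "k \<in> inj_indices"
  shows "inner_L2 M (\<lambda>\<omega>. \<Prod>j<q. B (indicator (A (i j))) \<omega>) (\<lambda>\<omega>. \<Prod>j<q. B (indicator (A (k j))) \<omega>) =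
    (if i ` {..<q} = k ` {..<q} then \<Prod>m\<in>i ` {..<q}. measure lborel (A m) else 0)"
proof -
  let ?Y = "\<lambda>m. B (indicator (A m))" and ?S = "i ` {..<q}" and ?T = "k ` {..<q}"
  define w where "w m y = (if m \<in> ?S then y else 1) * (if m \<in> ?T then y else 1)" for m and y :: real
  have ST: "?S \<subseteq> {..<n}" "?T \<subseteq> {..<n}" using inj_indicesD(1)[OF i] inj_indicesD(1)[OF k] by auto
  have P: "(\<Prod>j<q. F (l j)) = (\<Prod>m<n. if m \<in> l ` {..<q} then F m else 1)"
    if l: "l \<in> inj_indices" for l and F :: "nat \<Rightarrow> real"
  proof -
    have "(\<Prod>m<n. if m \<in> l ` {..<q} then F m else 1) = (\<Prod>m\<in>{..<n} \<inter> l ` {..<q}. F m)"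
      by (simp add: prod.inter_restrict)
    also have "{..<n} \<inter> l ` {..<q} = l ` {..<q}" using inj_indicesD(1)[OF l] by auto
    also have "(\<Prod>m\<in>l ` {..<q}. F m) = (\<Prod>j<q. F (l j))"
      using inj_indicesD(2)[OF l] by (simp add: prod.reindex)
    finally show ?thesis by simp
  qed
  have "indep_vars (\<lambda>_. borel) ?Y {..<n}"
    by (intro indep_vars_orthogonal) (auto intro: indicator_A_L2 simp: inner_indicator_A)
  then have ind: "indep_vars (\<lambda>_. borel) (\<lambda>m \<omega>. w m (?Y m \<omega>)) {..<n}"
    by (rule indep_vars_compose2) (auto simp: w_def)
  have w: "integrable M (\<lambda>\<omega>. w m (?Y m \<omega>))"
    "(LINT \<omega>|M. w m (?Y m \<omega>)) = (if m \<in> ?S \<inter> ?T then measure lborel (A m) else if m \<in> ?S \<union> ?T then 0 else 1)"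
    if m: "m < n" for m
  proof -
    note L = indicator_A_L2[OF m]
    have "integrable M (\<lambda>\<omega>. (?Y m \<omega>)\<^sup>2)" "integrable M (\<lambda>\<omega>. ?Y m \<omega> ^ 1)" by (intro B_power_integrable L)+
    then show "integrable M (\<lambda>\<omega>. w m (?Y m \<omega>))"
      by (cases "m \<in> ?S"; cases "m \<in> ?T") (simp_all add: w_def power2_eq_square)
    show "(LINT \<omega>|M. w m (?Y m \<omega>)) = (if m \<in> ?S \<inter> ?T then measure lborel (A m) else if m \<in> ?S \<union> ?T then 0 else 1)"
      using covariance[OF L L] inner_indicator_A[OF m m] centered_gaussian_moments(2)[OF gaussian[OF L]]
      by (auto simp: w_def prob_space)
  qed
  have "inner_L2 M (\<lambda>\<omega>. \<Prod>j<q. ?Y (i j) \<omega>) (\<lambda>\<omega>. \<Prod>j<q. ?Y (k j) \<omega>) = (LINT \<omega>|M. (\<Prod>m<n. w m (?Y m \<omega>)))"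
    unfolding P[OF i, of "\<lambda>m. ?Y m \<omega>" for \<omega>] P[OF k, of "\<lambda>m. ?Y m \<omega>" for \<omega>] prod.distrib[symmetric]
    by (simp add: w_def)
  also have "\<dots> = (\<Prod>m<n. LINT \<omega>|M. w m (?Y m \<omega>))"
    using ind w by (intro indep_vars_lebesgue_integral) auto
  also have "\<dots> = (\<Prod>m<n. if m \<in> ?S \<inter> ?T then measure lborel (A m) else if m \<in> ?S \<union> ?T then 0 else 1)"
    using w by (intro prod.cong) auto
  also have "\<dots> = (if ?S = ?T then \<Prod>m\<in>?S. measure lborel (A m) else 0)"
  proof (cases "?S = ?T")
    case True
    have "(\<Prod>m<n. if m \<in> ?S then measure lborel (A m) else 1) = (\<Prod>m\<in>{..<n} \<inter> ?S. measure lborel (A m))"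
      by (simp add: prod.inter_restrict)
    also have "{..<n} \<inter> ?S = ?S" using ST by auto
    finally show ?thesis unfolding True[symmetric] by (simp cong: if_cong)
  next
    case False
    then obtain m where m: "m \<in> ?S \<union> ?T" "m \<notin> ?S \<inter> ?T" by auto
    then have "m < n" using ST by auto
    then have "(\<Prod>m<n. if m \<in> ?S \<inter> ?T then measure lborel (A m) else if m \<in> ?S \<union> ?T then 0 else 1) = 0"
      using m by (intro prod_zero) (auto intro!: bexI[of _ m])
    then show ?thesis using False by simp
  qed
  finally show ?thesis .
qed

lemma elementary_fun_norm:
  "(LINT x|lborel_pow q. (elementary_fun q n A a x)\<^sup>2) = (\<Sum>i\<in>inj_indices. (a i)\<^sup>2 * (\<Prod>j<q. measure lborel (A (i j))))"
proof -
  let ?I = "{..<q} \<rightarrow>\<^sub>E {..<n}"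
  have fin: "finite ?I" by (intro finite_PiE) auto
  have "(LINT x|lborel_pow q. (elementary_fun q n A a x)\<^sup>2) =
    inner_L2 (lborel_pow q) (\<lambda>x. \<Sum>i\<in>?I. a i * (\<Prod>j<q. indicator (A (i j)) (x j))) (\<lambda>x. \<Sum>i\<in>?I. a i * (\<Prod>j<q. indicator (A (i j)) (x j)))"
    by (simp add: power2_eq_square elementary_fun_def)
  also have "\<dots> = (\<Sum>i\<in>?I. \<Sum>k\<in>?I. a i * a k * inner_L2 (lborel_pow q) (\<lambda>x. \<Prod>j<q. indicator (A (i j)) (x j)) (\<lambda>x. \<Prod>j<q. indicator (A (k j)) (x j)))"
    by (intro inner_L2_lincomb L2_product elementary_data_indicator_L2[OF data])
  also have "\<dots> = (\<Sum>i\<in>?I. \<Sum>k\<in>?I. if k = i then a i * (a i * (\<Prod>j<q. measure lborel (A (i j)))) else 0)"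
  proof (intro sum.cong refl)
    fix i k assume ik: "i \<in> ?I" "k \<in> ?I"
    have "inner_L2 (lborel_pow q) (\<lambda>x. \<Prod>j<q. indicator (A (i j)) (x j)) (\<lambda>x. \<Prod>j<q. indicator (A (k j)) (x j)) =
      (\<Prod>j<q. inner_L2 lborel (indicator (A (i j))) (indicator (A (k j))))"
      using ik by (intro inner_L2_product elementary_data_indicator_L2[OF data])
    also have "\<dots> = (\<Prod>j<q. if i j = k j then measure lborel (A (i j)) else 0)"
      using ik by (intro prod.cong refl inner_indicator_A) (auto simp: PiE_iff)
    also have "\<dots> = (if k = i then \<Prod>j<q. measure lborel (A (i j)) else 0)"
    proof (cases "k = i")
      case False
      then obtain j where "j < q" "i j \<noteq> k j" using PiE_ext[OF ik] by auto
      then show ?thesis using False by (auto intro!: prod_zero)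
    qed simp
    finally show "a i * a k * inner_L2 (lborel_pow q) (\<lambda>x. \<Prod>j<q. indicator (A (i j)) (x j)) (\<lambda>x. \<Prod>j<q. indicator (A (k j)) (x j)) =
      (if k = i then a i * (a i * (\<Prod>j<q. measure lborel (A (i j)))) else 0)" by simp
  qed
  also have "\<dots> = (\<Sum>i\<in>?I. a i * (a i * (\<Prod>j<q. measure lborel (A (i j)))))"
    using fin by simp
  finally show ?thesis by (simp add: sum_inj_indices power2_eq_square mult.assoc)
qed

text \<open>Two multi-indices are correlated only if they have the same range, and at most \<open>q ^ q\<close> indices share a
given range; the mixed terms are split by \<open>a b \<le> (a\<^sup>2 + b\<^sup>2) / 2\<close>. The sharp constant would be \<open>fact q\<close>, but
any constant serves to pass to limits and to show finiteness.\<close>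

lemma elementary_second_moment:
  "(LINT \<omega>|M. (elementary_integral B q n A a \<omega>)\<^sup>2) \<le> real (q ^ q) * (LINT x|lborel_pow q. (elementary_fun q n A a x)\<^sup>2)"
proof -
  define W where "W S = (\<Prod>m\<in>S. measure lborel (A m))" for S
  have W0: "W S \<ge> 0" for S by (simp add: W_def prod_nonneg)
  have Wi: "W (i ` {..<q}) = (\<Prod>j<q. measure lborel (A (i j)))" if "i \<in> inj_indices" for i
    using inj_indicesD(2)[OF that] by (simp add: W_def prod.reindex)
  let ?E = "\<lambda>i k. i ` {..<q} = k ` {..<q}"
  define b where "b i = (a i)\<^sup>2 * W (i ` {..<q})" for i
  have b0: "b i \<ge> 0" for i by (simp add: b_def W0)
  have "(LINT \<omega>|M. (elementary_integral B q n A a \<omega>)\<^sup>2) =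
    (\<Sum>i\<in>inj_indices. \<Sum>k\<in>inj_indices. a i * a k *
      inner_L2 M (\<lambda>\<omega>. \<Prod>j<q. B (indicator (A (i j))) \<omega>) (\<lambda>\<omega>. \<Prod>j<q. B (indicator (A (k j))) \<omega>))"
    unfolding elementary_integral_eq power2_eq_square
    by (intro inner_L2_lincomb elementary_product_L2)
  also have "\<dots> = (\<Sum>i\<in>inj_indices. \<Sum>k\<in>inj_indices. if ?E i k then a i * a k * W (i ` {..<q}) else 0)"
    by (intro sum.cong refl) (simp add: inner_elementary_products W_def)
  also have "\<dots> \<le> (\<Sum>i\<in>inj_indices. \<Sum>k\<in>inj_indices. (if ?E i k then b i / 2 else 0) + (if ?E k i then b k / 2 else 0))"
  proof (intro sum_mono)
    fix i k assume "i \<in> inj_indices" "k \<in> inj_indices"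
    have "a i * a k \<le> (a i)\<^sup>2 / 2 + (a k)\<^sup>2 / 2"
      using zero_le_power2[of "a i - a k"] by (simp add: power2_diff)
    from mult_right_mono[OF this W0[of "i ` {..<q}"]]
    show "(if ?E i k then a i * a k * W (i ` {..<q}) else 0) \<le> (if ?E i k then b i / 2 else 0) + (if ?E k i then b k / 2 else 0)"
      by (auto simp: b_def ring_distribs)
  qed
  also have "\<dots> = (\<Sum>i\<in>inj_indices. \<Sum>k\<in>inj_indices. if ?E i k then b i / 2 else 0) +
     (\<Sum>i\<in>inj_indices. \<Sum>k\<in>inj_indices. if ?E k i then b k / 2 else 0)"
    by (simp add: sum.distrib)
  also have "(\<Sum>i\<in>inj_indices. \<Sum>k\<in>inj_indices. if ?E k i then b k / 2 else 0) =
     (\<Sum>i\<in>inj_indices. \<Sum>k\<in>inj_indices. if ?E i k then b i / 2 else 0)"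
    by (rule sum.swap)
  also have "(\<Sum>i\<in>inj_indices. \<Sum>k\<in>inj_indices. if ?E i k then b i / 2 else 0) +
     (\<Sum>i\<in>inj_indices. \<Sum>k\<in>inj_indices. if ?E i k then b i / 2 else 0) =
     (\<Sum>i\<in>inj_indices. real (card {k\<in>inj_indices. ?E i k}) * b i)"
  proof -
    have c: "(\<Sum>k\<in>inj_indices. if ?E i k then b i / 2 else 0) = real (card {k\<in>inj_indices. ?E i k}) * (b i / 2)" for i
    proof -
      have "(\<Sum>k\<in>inj_indices. if ?E i k then b i / 2 else 0) = (\<Sum>k\<in>{k\<in>inj_indices. ?E i k}. b i / 2)"
        using finite_inj_indices by (rule sum.inter_filter[symmetric])
      then show ?thesis by simp
    qed
    show ?thesis unfolding c by (simp add: sum.distrib[symmetric] mult.commute)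
  qed
  also have "\<dots> \<le> (\<Sum>i\<in>inj_indices. real (q ^ q) * b i)"
  proof (intro sum_mono mult_right_mono b0)
    fix i assume i: "i \<in> inj_indices"
    have "{k\<in>inj_indices. ?E i k} \<subseteq> {..<q} \<rightarrow>\<^sub>E i ` {..<q}"
      by (auto simp: inj_indices_def PiE_iff extensional_def)
    then have "card {k\<in>inj_indices. ?E i k} \<le> card ({..<q} \<rightarrow>\<^sub>E i ` {..<q})"
      by (intro card_mono finite_PiE) auto
    also have "\<dots> = card (i ` {..<q}) ^ q" by (simp add: card_PiE)
    also have "\<dots> \<le> q ^ q" using card_image_le[of "{..<q}" i] by (intro power_mono) auto
    finally show "real (card {k\<in>inj_indices. ?E i k}) \<le> real (q ^ q)" by (simp only: of_nat_le_iff)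
  qed
  also have "\<dots> = real (q ^ q) * (LINT x|lborel_pow q. (elementary_fun q n A a x)\<^sup>2)"
    unfolding elementary_fun_norm sum_distrib_left by (intro sum.cong) (auto simp: b_def Wi)
  finally show ?thesis .
qed

end

lemma wiener_ito_approximation:
  assumes "wiener_ito M B q f X"
  obtains n A a where "\<And>k. elementary_data q (n k) (A k) (a k)"
    "(\<lambda>k. LINT x|lborel_pow q. (elementary_fun q (n k) (A k) (a k) x - f x)\<^sup>2) \<longlonglongrightarrow> 0"
    "(\<lambda>k. LINT \<omega>|M. (elementary_integral B q (n k) (A k) (a k) \<omega> - X \<omega>)\<^sup>2) \<longlonglongrightarrow> 0"
proof -
  from assms obtain n A a where *: "f \<in> L2 (lborel_pow q)" "X \<in> L2 M" "\<And>k. elementary_data q (n k) (A k) (a k)"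
    "(\<lambda>k. \<integral>\<^sup>+x. ennreal ((elementary_fun q (n k) (A k) (a k) x - f x)\<^sup>2) \<partial>lborel_pow q) \<longlonglongrightarrow> 0"
    "(\<lambda>k. \<integral>\<^sup>+\<omega>. ennreal ((elementary_integral B q (n k) (A k) (a k) \<omega> - X \<omega>)\<^sup>2) \<partial>M) \<longlonglongrightarrow> 0"
    by (auto simp: wiener_ito_def)
  show ?thesis
    by (rule that[OF *(3) L2_nn_integral_tendsto L2_nn_integral_tendsto])
      (use * elementary_fun_L2 elementary_integral_L2 in auto)
qed

lemma wiener_ito_second_moment:
  assumes "wiener_ito M B q f X"
  shows "(LINT \<omega>|M. (X \<omega>)\<^sup>2) \<le> real (q ^ q) * (LINT x|lborel_pow q. (f x)\<^sup>2)"
proof -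
  have L: "f \<in> L2 (lborel_pow q)" "X \<in> L2 M" using assms by (auto simp: wiener_ito_def)
  from wiener_ito_approximation[OF assms] obtain n A a where *: "\<And>k. elementary_data q (n k) (A k) (a k)"
    "(\<lambda>k. LINT x|lborel_pow q. (elementary_fun q (n k) (A k) (a k) x - f x)\<^sup>2) \<longlonglongrightarrow> 0"
    "(\<lambda>k. LINT \<omega>|M. (elementary_integral B q (n k) (A k) (a k) \<omega> - X \<omega>)\<^sup>2) \<longlonglongrightarrow> 0"
    by blast
  show ?thesis
  proof (rule LIMSEQ_le[OF norm_L2_tendsto[OF _ L(2) *(3)] tendsto_mult[OF tendsto_const norm_L2_tendsto[OF _ L(1) *(2)]]])
    show "\<exists>N. \<forall>k\<ge>N. (LINT \<omega>|M. (elementary_integral B q (n k) (A k) (a k) \<omega>)\<^sup>2) \<le>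
      real (q ^ q) * (LINT x|lborel_pow q. (elementary_fun q (n k) (A k) (a k) x)\<^sup>2)"
      using elementary_second_moment[OF *(1)] by blast
  qed (use * elementary_fun_L2 elementary_integral_L2 in auto)
qed

lemma bounded_L2:
  assumes "X \<in> borel_measurable M" "\<And>\<omega>. \<bar>X \<omega>\<bar> \<le> 1"
  shows "X \<in> L2 M"
proof -
  have "integrable M (\<lambda>\<omega>. (X \<omega>)\<^sup>2)"
    using assms by (intro integrable_bounded_real[where C = 1]) (auto simp: abs_square_le_1)
  then show ?thesis using assms by (simp add: L2_def)
qed

text \<open>The identity for elementary integrals survives mean square limits because cosine and sine of \<open>B h\<close> are
square integrable.\<close>

lemma stransform_wiener_ito:
  assumes "wiener_ito M B q f X" and h: "h \<in> L2 lborel"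
  shows "(CLINT \<omega>|M. complex_of_real (X \<omega>) * iexp (B h \<omega>)) =
    \<i> ^ q * complex_of_real (inner_L2 (lborel_pow q) f (\<lambda>x. \<Prod>j<q. h (x j)) * exp (- inner_L2 lborel h h / 2))"
proof -
  have L: "f \<in> L2 (lborel_pow q)" "X \<in> L2 M" using assms by (auto simp: wiener_ito_def)
  from wiener_ito_approximation[OF assms(1)] obtain n A a where *: "\<And>k. elementary_data q (n k) (A k) (a k)"
    "(\<lambda>k. LINT x|lborel_pow q. (elementary_fun q (n k) (A k) (a k) x - f x)\<^sup>2) \<longlonglongrightarrow> 0"
    "(\<lambda>k. LINT \<omega>|M. (elementary_integral B q (n k) (A k) (a k) \<omega> - X \<omega>)\<^sup>2) \<longlonglongrightarrow> 0"
    by blast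
  note LE = elementary_fun_L2[OF *(1)] elementary_integral_L2[OF *(1)]
  have trig: "(\<lambda>\<omega>. cos (B h \<omega>)) \<in> L2 M" "(\<lambda>\<omega>. sin (B h \<omega>)) \<in> L2 M"
    using h by (auto intro!: bounded_L2)
  have split: "(CLINT \<omega>|M. complex_of_real (Y \<omega>) * iexp (B h \<omega>)) =
     complex_of_real (inner_L2 M Y (\<lambda>\<omega>. cos (B h \<omega>))) + \<i> * complex_of_real (inner_L2 M Y (\<lambda>\<omega>. sin (B h \<omega>)))"
    if Y: "Y \<in> L2 M" for Y
  proof -
    have "(CLINT \<omega>|M. complex_of_real (Y \<omega>) * iexp (B h \<omega>)) =
      (CLINT \<omega>|M. complex_of_real (Y \<omega> * cos (B h \<omega>)) + \<i> * complex_of_real (Y \<omega> * sin (B h \<omega>)))"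
      by (intro Bochner_Integration.integral_cong)
        (auto simp: exp_Euler cos_of_real sin_of_real ring_distribs)
    also have "\<dots> = (CLINT \<omega>|M. complex_of_real (Y \<omega> * cos (B h \<omega>))) + (CLINT \<omega>|M. \<i> * complex_of_real (Y \<omega> * sin (B h \<omega>)))"
      by (intro Bochner_Integration.integral_add integrable_mult_right integrable_of_real L2_integrable_mult Y trig)
    finally show ?thesis by (simp del: of_real_mult)
  qed
  have "(\<lambda>k. CLINT \<omega>|M. complex_of_real (elementary_integral B q (n k) (A k) (a k) \<omega>) * iexp (B h \<omega>)) \<longlonglongrightarrow>
     (CLINT \<omega>|M. complex_of_real (X \<omega>) * iexp (B h \<omega>))"
    unfolding split[OF L(2)] split[OF LE(2)]
    by (intro tendsto_intros inner_L2_tendsto LE L trig *)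
  moreover have "(\<lambda>k. CLINT \<omega>|M. complex_of_real (elementary_integral B q (n k) (A k) (a k) \<omega>) * iexp (B h \<omega>)) \<longlonglongrightarrow>
    \<i> ^ q * complex_of_real (inner_L2 (lborel_pow q) f (\<lambda>x. \<Prod>j<q. h (x j)) * exp (- inner_L2 lborel h h / 2))"
    unfolding stransform_elementary[OF *(1) h]
    by (intro tendsto_intros inner_L2_tendsto LE L L2_product h *)
  ultimately show ?thesis by (rule LIMSEQ_unique)
qed

end

section \<open>Uniqueness of symmetric kernels\<close>

interpretation lborel_product: product_sigma_finite "\<lambda>_::nat. lborel :: real measure" ..

lemma sigma_finite_lborel_pow: "sigma_finite_measure (lborel_pow q)"
  by (rule lborel_product.sigma_finite) simp

lemma pair_sigma_finite_append: "pair_sigma_finite (lborel_pow q) (lborel :: real measure)"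
  by (intro pair_sigma_finite.intro sigma_finite_lborel_pow sigma_finite_lborel)

lemma measurable_append [measurable]:
  "(\<lambda>(y, r). y(q := r)) \<in> measurable (lborel_pow q \<Otimes>\<^sub>M lborel) (lborel_pow (Suc q))"
  unfolding lessThan_Suc by (rule measurable_add_dim)

lemma distr_append:
  "distr (lborel_pow q \<Otimes>\<^sub>M lborel) (lborel_pow (Suc q)) (\<lambda>(y, r). y(q := r)) = lborel_pow (Suc q)"
  (is "?D = _")
proof (rule measure_eqI)
  interpret pair_sigma_finite "lborel_pow q" "lborel :: real measure" by (rule pair_sigma_finite_append)
  fix A assume "A \<in> sets ?D"
  then have A [measurable]: "A \<in> sets (lborel_pow (Suc q))" by simp
  have "emeasure ?D A = (\<integral>\<^sup>+x. indicator A x \<partial>?D)" by simp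
  also have "\<dots> = (\<integral>\<^sup>+z. indicator A (case z of (y, r) \<Rightarrow> y(q := r)) \<partial>(lborel_pow q \<Otimes>\<^sub>M lborel))"
    by (subst nn_integral_distr) auto
  also have "\<dots> = (\<integral>\<^sup>+y. \<integral>\<^sup>+r. indicator A (y(q := r)) \<partial>lborel \<partial>lborel_pow q)"
    by (subst sigma_finite_measure.nn_integral_fst[OF sigma_finite_lborel, symmetric]) auto
  also have "\<dots> = (\<integral>\<^sup>+x. indicator A x \<partial>lborel_pow (Suc q))"
    using A unfolding lessThan_Suc by (subst lborel_product.product_nn_integral_insert) auto
  finally show "emeasure ?D A = emeasure (lborel_pow (Suc q)) A" by simp
qed simp

lemma
  fixes f :: "(nat \<Rightarrow> real) \<Rightarrow> real"
  assumes f: "integrable (lborel_pow (Suc q)) f"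
  shows AE_integrable_section: "AE r in lborel. integrable (lborel_pow q) (\<lambda>y. f (y(q := r)))"
    and integrable_section_integral: "integrable lborel (\<lambda>r. LINT y|lborel_pow q. f (y(q := r)))"
    and integral_section: "(LINT r|lborel. LINT y|lborel_pow q. f (y(q := r))) = (LINT x|lborel_pow (Suc q). f x)"
proof -
  interpret pair_sigma_finite "lborel_pow q" "lborel :: real measure" by (rule pair_sigma_finite_append)
  have fm [measurable]: "f \<in> borel_measurable (lborel_pow (Suc q))" using f by auto
  have "integrable (distr (lborel_pow q \<Otimes>\<^sub>M lborel) (lborel_pow (Suc q)) (\<lambda>(y, r). y(q := r))) f"
    unfolding distr_append by (rule f)
  then have int: "integrable (lborel_pow q \<Otimes>\<^sub>M lborel) (\<lambda>(y, r). f (y(q := r)))"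
    by (subst (asm) integrable_distr_eq) (auto simp: case_prod_unfold)
  show "AE r in lborel. integrable (lborel_pow q) (\<lambda>y. f (y(q := r)))"
    by (rule AE_integrable_snd[OF int])
  show "integrable lborel (\<lambda>r. LINT y|lborel_pow q. f (y(q := r)))"
    by (rule integrable_snd[OF int])
  have "(LINT x|lborel_pow (Suc q). f x) =
      (LINT x|distr (lborel_pow q \<Otimes>\<^sub>M lborel) (lborel_pow (Suc q)) (\<lambda>(y, r). y(q := r)). f x)"
    unfolding distr_append ..
  also have "\<dots> = (LINT z|(lborel_pow q \<Otimes>\<^sub>M lborel). (case z of (y, r) \<Rightarrow> f (y(q := r))))"
    by (subst integral_distr) (auto simp: case_prod_unfold)
  also have "\<dots> = (LINT r|lborel. LINT y|lborel_pow q. f (y(q := r)))"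
    by (rule integral_snd[OF int, symmetric])
  finally show "(LINT r|lborel. LINT y|lborel_pow q. f (y(q := r))) = (LINT x|lborel_pow (Suc q). f x)" ..
qed

lemma measurable_permute_coordinates [measurable]:
  assumes "\<pi> permutes {..<q}"
  shows "(\<lambda>x. x \<circ> \<pi>) \<in> measurable (lborel_pow q) (lborel_pow q)"
proof (rule measurable_PiM_single')
  show "(\<lambda>x. (x \<circ> \<pi>) i) \<in> measurable (lborel_pow q) lborel" if "i \<in> {..<q}" for i
    using permutes_in_image[OF assms, of i] that by simp
  show "(\<lambda>x. x \<circ> \<pi>) \<in> space (lborel_pow q) \<rightarrow> {..<q} \<rightarrow>\<^sub>E space lborel"
    using permutes_not_in[OF assms] by (auto simp: space_PiM PiE_iff extensional_def)
qed

lemma distr_permute_coordinates: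
  assumes \<pi>: "\<pi> permutes {..<q}"
  shows "distr (lborel_pow q) (lborel_pow q) (\<lambda>x. x \<circ> \<pi>) = lborel_pow q"
proof (rule lborel_product.PiM_eqI)
  fix A :: "nat \<Rightarrow> real set" assume A: "\<And>i. i \<in> {..<q} \<Longrightarrow> A i \<in> sets lborel"
  have iv: "inv \<pi> permutes {..<q}" by (rule permutes_inv[OF \<pi>])
  have "(\<lambda>x. x \<circ> \<pi>) -` (Pi\<^sub>E {..<q} A) \<inter> space (lborel_pow q) = Pi\<^sub>E {..<q} (\<lambda>i. A (inv \<pi> i))"
  proof (intro set_eqI iffI)
    fix x assume x: "x \<in> (\<lambda>x. x \<circ> \<pi>) -` (Pi\<^sub>E {..<q} A) \<inter> space (lborel_pow q)"
    have "x i \<in> A (inv \<pi> i)" if "i < q" for i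
    proof -
      have "inv \<pi> i < q" using permutes_in_image[OF iv, of i] that by simp
      then have "(x \<circ> \<pi>) (inv \<pi> i) \<in> A (inv \<pi> i)" using x by (auto simp: PiE_iff)
      then show ?thesis using permutes_inverses(1)[OF \<pi>] by simp
    qed
    then show "x \<in> Pi\<^sub>E {..<q} (\<lambda>i. A (inv \<pi> i))" using x by (auto simp: space_PiM PiE_iff)
  next
    fix x assume x: "x \<in> Pi\<^sub>E {..<q} (\<lambda>i. A (inv \<pi> i))"
    have "x (\<pi> i) \<in> A i" if "i < q" for i
    proof -
      have "\<pi> i < q" using permutes_in_image[OF \<pi>, of i] that by simp
      then have "x (\<pi> i) \<in> A (inv \<pi> (\<pi> i))" using x by (auto simp: PiE_iff)
      then show ?thesis using permutes_inverses(2)[OF \<pi>] by simp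
    qed
    then show "x \<in> (\<lambda>x. x \<circ> \<pi>) -` (Pi\<^sub>E {..<q} A) \<inter> space (lborel_pow q)"
      using x permutes_not_in[OF \<pi>] by (auto simp: space_PiM PiE_iff extensional_def)
  qed
  then have "emeasure (distr (lborel_pow q) (lborel_pow q) (\<lambda>x. x \<circ> \<pi>)) (Pi\<^sub>E {..<q} A) =
     emeasure (lborel_pow q) (Pi\<^sub>E {..<q} (\<lambda>i. A (inv \<pi> i)))"
    using A measurable_permute_coordinates[OF \<pi>] by (subst emeasure_distr) (auto intro!: sets_PiM_I_finite)
  also have "\<dots> = (\<Prod>i<q. emeasure lborel (A (inv \<pi> i)))"
    using A permutes_in_image[OF iv] by (subst lborel_product.emeasure_PiM) auto
  also have "\<dots> = (\<Prod>i<q. emeasure lborel (A i))"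
    using prod.permute[OF iv, of "\<lambda>i. emeasure lborel (A i)"] by (simp add: o_def)
  finally show "emeasure (distr (lborel_pow q) (lborel_pow q) (\<lambda>x. x \<circ> \<pi>)) (Pi\<^sub>E {..<q} A) = (\<Prod>i\<in>{..<q}. emeasure lborel (A i))" .
qed auto

lemma inner_symmetric_kernel_permute:
  fixes g :: "nat \<Rightarrow> real \<Rightarrow> real"
  assumes f: "symmetric_kernel q f" "f \<in> L2 (lborel_pow q)" and \<pi>: "\<pi> permutes {..<q}"
    and g: "\<And>j. j < q \<Longrightarrow> g j \<in> L2 lborel"
  shows "inner_L2 (lborel_pow q) f (\<lambda>x. \<Prod>j<q. g (\<pi> j) (x j)) = inner_L2 (lborel_pow q) f (\<lambda>x. \<Prod>j<q. g j (x j))"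
proof -
  have g': "g (\<pi> j) \<in> L2 lborel" if "j < q" for j using g permutes_in_image[OF \<pi>, of j] that by simp
  have fm [measurable]: "f \<in> borel_measurable (lborel_pow q)" using f(2) by (rule L2_measurable)
  have Pm: "(\<lambda>x. \<Prod>j<q. g (\<pi> j) (x j)) \<in> borel_measurable (lborel_pow q)"
    by (intro L2_measurable L2_product g')
  have "inner_L2 (lborel_pow q) f (\<lambda>x. \<Prod>j<q. g (\<pi> j) (x j)) =
     inner_L2 (distr (lborel_pow q) (lborel_pow q) (\<lambda>x. x \<circ> \<pi>)) f (\<lambda>x. \<Prod>j<q. g (\<pi> j) (x j))"
    unfolding distr_permute_coordinates[OF \<pi>] ..
  also have "\<dots> = (LINT x|lborel_pow q. f (x \<circ> \<pi>) * (\<Prod>j<q. g (\<pi> j) (x (\<pi> j))))"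
    using measurable_permute_coordinates[OF \<pi>] Pm by (subst integral_distr) auto
  also have "\<dots> = (LINT x|lborel_pow q. f (x \<circ> \<pi>) * (\<Prod>j<q. g j (x j)))"
  proof -
    have "(\<Prod>j<q. g (\<pi> j) (x (\<pi> j))) = (\<Prod>j<q. g j (x j))" for x
      using prod.permute[OF \<pi>, of "\<lambda>j. g j (x j)"] by (simp add: o_def)
    then show ?thesis by simp
  qed
  also have "\<dots> = inner_L2 (lborel_pow q) f (\<lambda>x. \<Prod>j<q. g j (x j))"
  proof (rule integral_cong_AE)
    have [measurable]: "(\<lambda>x. \<Prod>j<q. g j (x j)) \<in> borel_measurable (lborel_pow q)"
      by (intro L2_measurable L2_product g)
    show "(\<lambda>x. f x * (\<Prod>j<q. g j (x j))) \<in> borel_measurable (lborel_pow q)" by measurable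
    have "(\<lambda>x. f (x \<circ> \<pi>)) \<in> borel_measurable (lborel_pow q)"
      using measurable_compose[OF measurable_permute_coordinates[OF \<pi>] fm] .
    then show "(\<lambda>x. f (x \<circ> \<pi>) * (\<Prod>j<q. g j (x j))) \<in> borel_measurable (lborel_pow q)" by measurable
    show "AE x in lborel_pow q. f (x \<circ> \<pi>) * (\<Prod>j<q. g j (x j)) = f x * (\<Prod>j<q. g j (x j))"
      using f(1) \<pi> by (auto simp: symmetric_kernel_def)
  qed
  finally show ?thesis .
qed

lemma prod_lessThan_3: "(\<Prod>j<3. F j) = F 0 * F 1 * (F (2::nat) :: 'c :: comm_monoid_mult)"
  by (simp add: eval_nat_numeral lessThan_Suc mult_ac)

lemma prod_lessThan_2: "(\<Prod>j<2. F j) = F 0 * (F (1::nat) :: 'c :: comm_monoid_mult)"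
  by (simp add: eval_nat_numeral lessThan_Suc mult_ac)

text \<open>A symmetric trilinear form that vanishes on the diagonal vanishes.\<close>

lemma symmetric_kernel_polarization:
  fixes g :: "nat \<Rightarrow> real \<Rightarrow> real"
  assumes d: "symmetric_kernel 3 d" "d \<in> L2 (lborel_pow 3)"
    and zero: "\<And>h. h \<in> L2 lborel \<Longrightarrow> inner_L2 (lborel_pow 3) d (\<lambda>x. \<Prod>j<3. h (x j)) = 0"
    and g: "\<And>j. j < 3 \<Longrightarrow> g j \<in> L2 lborel"
  shows "inner_L2 (lborel_pow 3) d (\<lambda>x. \<Prod>j<3. g j (x j)) = 0"
proof -
  define T where "T h k l = (LINT x|lborel_pow 3. d x * (h (x 0) * k (x 1) * l (x 2)))" for h k l
  define u v w where "u = g 0" and "v = g 1" and "w = g 2"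
  have L: "u \<in> L2 lborel" "v \<in> L2 lborel" "w \<in> L2 lborel" using g by (auto simp: u_def v_def w_def)
  have int: "integrable (lborel_pow 3) (\<lambda>x. d x * (h (x 0) * k (x 1) * l (x 2)))"
    if "h \<in> L2 lborel" "k \<in> L2 lborel" "l \<in> L2 lborel" for h k l
    using that L2_integrable_mult[OF d(2) L2_product[of 3 "\<lambda>j. if j = 0 then h else if j = 1 then k else l"]]
    by (simp add: prod_lessThan_3)
  have add: "T (\<lambda>y. h y + h' y) k l = T h k l + T h' k l"
     "T k (\<lambda>y. h y + h' y) l = T k h l + T k h' l"
     "T k l (\<lambda>y. h y + h' y) = T k l h + T k l h'"
    if "h \<in> L2 lborel" "h' \<in> L2 lborel" "k \<in> L2 lborel" "l \<in> L2 lborel" for h h' k l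
    unfolding T_def using that by (simp_all only: distrib_left distrib_right Bochner_Integration.integral_add int)
  have cube: "T h h h = 0" if "h \<in> L2 lborel" for h
    using zero[OF that] by (simp add: prod_lessThan_3 T_def)
  have perm: "T (g (\<pi> 0)) (g (\<pi> 1)) (g (\<pi> 2)) = T u v w" if "\<pi> permutes {..<3}" for \<pi>
    using inner_symmetric_kernel_permute[OF d that g] by (simp add: prod_lessThan_3 T_def u_def v_def w_def)
  have tr: "Transposition.transpose a b permutes {..<3}" if "a < 3" "b < 3" for a b :: nat
    using that by (intro permutes_swap_id) auto
  have p: "T u w v = T u v w" "T v u w = T u v w" "T w v u = T u v w" "T v w u = T u v w" "T w u v = T u v w"
    using perm[OF tr[of 1 2]] perm[OF tr[of 0 1]] perm[OF tr[of 0 2]]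
      perm[OF permutes_compose[OF tr[of 1 2] tr[of 0 1]]] perm[OF permutes_compose[OF tr[of 0 1] tr[of 1 2]]]
    by (simp_all add: Transposition.transpose_def u_def v_def w_def)
  \<comment> \<open>Inclusion-exclusion over the subsets of \<open>{u, v, w}\<close> isolates the multilinear part of the cubic form.\<close>
  have "T (\<lambda>y. u y + v y + w y) (\<lambda>y. u y + v y + w y) (\<lambda>y. u y + v y + w y)
     - T (\<lambda>y. u y + v y) (\<lambda>y. u y + v y) (\<lambda>y. u y + v y)
     - T (\<lambda>y. u y + w y) (\<lambda>y. u y + w y) (\<lambda>y. u y + w y)
     - T (\<lambda>y. v y + w y) (\<lambda>y. v y + w y) (\<lambda>y. v y + w y) + T u u u + T v v v + T w w w
     = T u v w + T u w v + T v u w + T w v u + T v w u + T w u v"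
    by (simp add: add L L2_add)
  moreover have "T (\<lambda>y. u y + v y + w y) (\<lambda>y. u y + v y + w y) (\<lambda>y. u y + v y + w y) = 0"
    "T (\<lambda>y. u y + v y) (\<lambda>y. u y + v y) (\<lambda>y. u y + v y) = 0"
    "T (\<lambda>y. u y + w y) (\<lambda>y. u y + w y) (\<lambda>y. u y + w y) = 0"
    "T (\<lambda>y. v y + w y) (\<lambda>y. v y + w y) (\<lambda>y. v y + w y) = 0"
    "T u u u = 0" "T v v v = 0" "T w w w = 0"
    by (intro cube L2_add L)+
  ultimately have "T u v w = 0" unfolding p by simp
  then show ?thesis by (simp add: prod_lessThan_3 T_def u_def v_def w_def)
qed

lemma symmetric_kernel_diff:
  assumes "symmetric_kernel q f" "symmetric_kernel q g"
  shows "symmetric_kernel q (\<lambda>x. f x - g x)"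
  unfolding symmetric_kernel_def
proof (intro allI impI)
  fix \<pi> assume "\<pi> permutes {..<q}"
  then have "AE x in lborel_pow q. f (x \<circ> \<pi>) = f x" "AE x in lborel_pow q. g (x \<circ> \<pi>) = g x"
    using assms by (auto simp: symmetric_kernel_def)
  then show "AE x in lborel_pow q. f (x \<circ> \<pi>) - g (x \<circ> \<pi>) = f x - g x" by eventually_elim simp
qed

lemma AE_zero_if_set_integrals_zero:
  fixes \<phi> :: "real \<Rightarrow> real"
  assumes int: "integrable lborel (\<lambda>r. \<phi> r * indicator S r)" and [measurable]: "\<phi> \<in> borel_measurable lborel" "S \<in> sets lborel"
    and zero: "\<And>D. D \<in> sets lborel \<Longrightarrow> D \<subseteq> S \<Longrightarrow> (LINT r|lborel. \<phi> r * indicator D r) = 0"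
  shows "AE r in lborel. r \<in> S \<longrightarrow> \<phi> r = 0"
proof -
  have *: "AE r in lborel. r \<in> S \<longrightarrow> \<not> s * \<phi> r > 0" if s: "s = 1 \<or> s = -1" for s :: real
  proof -
    define D where "D = {r \<in> S. s * \<phi> r > 0}"
    have "{r \<in> space lborel. s * \<phi> r > 0} \<in> sets lborel" by measurable
    moreover have "D = S \<inter> {r \<in> space lborel. s * \<phi> r > 0}" by (auto simp: D_def)
    ultimately have D: "D \<in> sets lborel" "D \<subseteq> S" by (auto intro: sets.Int)
    note [measurable] = D(1)
    have "(\<lambda>r. s * (\<phi> r * indicator D r)) = (\<lambda>r. s * ((\<phi> r * indicator S r) * indicator D r))"
      using D(2) by (intro ext) (auto simp: indicator_def)
    then have i: "integrable lborel (\<lambda>r. s * (\<phi> r * indicator D r))"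
      using integrable_mult_indicator[OF D(1) int] by (auto simp: mult_ac)
    have "(LINT r|lborel. s * (\<phi> r * indicator D r)) = 0"
      using zero[OF D] by simp
    then have "AE r in lborel. s * (\<phi> r * indicator D r) = 0"
      using i by (subst (asm) integral_nonneg_eq_0_iff_AE) (auto simp: D_def indicator_def)
    then show ?thesis by eventually_elim (auto simp: D_def indicator_def)
  qed
  from *[of 1] *[of "-1"] show ?thesis by (auto simp: not_less)
qed

context isonormal_process begin

text \<open>The S-transform of \<open>X\<close> determines the integrals of a kernel against the cubes \<open>h(x\<^sub>0) h(x\<^sub>1) h(x\<^sub>2)\<close>,
and polarization extends this to all product functions.\<close>

lemma wiener_ito_kernel_unique_weak:
  fixes g :: "nat \<Rightarrow> real \<Rightarrow> real"
  assumes f: "wiener_ito M B 3 f X" "symmetric_kernel 3 f" and f': "wiener_ito M B 3 f' X" "symmetric_kernel 3 f'"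
    and g: "\<And>j. j < 3 \<Longrightarrow> g j \<in> L2 lborel"
  shows "inner_L2 (lborel_pow 3) (\<lambda>x. f x - f' x) (\<lambda>x. \<Prod>j<3. g j (x j)) = 0"
proof (rule symmetric_kernel_polarization)
  have L: "f \<in> L2 (lborel_pow 3)" "f' \<in> L2 (lborel_pow 3)" using f f' by (auto simp: wiener_ito_def)
  show "symmetric_kernel 3 (\<lambda>x. f x - f' x)" by (rule symmetric_kernel_diff) fact+
  show "(\<lambda>x. f x - f' x) \<in> L2 (lborel_pow 3)" by (rule L2_diff) fact+
  fix h :: "real \<Rightarrow> real" assume h: "h \<in> L2 lborel"
  have "complex_of_real (inner_L2 (lborel_pow 3) f (\<lambda>x. \<Prod>j<3. h (x j)) * exp (- inner_L2 lborel h h / 2)) =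
     complex_of_real (inner_L2 (lborel_pow 3) f' (\<lambda>x. \<Prod>j<3. h (x j)) * exp (- inner_L2 lborel h h / 2))"
    using stransform_wiener_ito[OF f(1) h] stransform_wiener_ito[OF f'(1) h] by simp
  then have "inner_L2 (lborel_pow 3) f (\<lambda>x. \<Prod>j<3. h (x j)) = inner_L2 (lborel_pow 3) f' (\<lambda>x. \<Prod>j<3. h (x j))"
    unfolding of_real_eq_iff by simp
  then show "inner_L2 (lborel_pow 3) (\<lambda>x. f x - f' x) (\<lambda>x. \<Prod>j<3. h (x j)) = 0"
    using h L by (subst inner_L2_diff_left) (auto intro: L2_product)
qed (use g in auto)

text \<open>With indicators of measurable sets \<open>D \<subseteq> S\<close> in the last variable, the preceding lemma says that the
difference of the two sides, as a function of \<open>r\<close>, has integral zero over every such \<open>D\<close>. The exceptional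
null set depends on \<open>g\<close>, so that only countably many \<open>g\<close> can be treated for the same \<open>r\<close>.\<close>

lemma wiener_ito_section_unique:
  assumes f: "wiener_ito M B 3 f X" "symmetric_kernel 3 f" and f': "wiener_ito M B 3 f' X" "symmetric_kernel 3 f'"
    and g: "g 0 \<in> L2 lborel" "g (1::nat) \<in> L2 lborel" and S: "S \<in> sets lborel" "emeasure lborel S < \<infinity>"
  shows "AE r in lborel. r \<in> S \<longrightarrow>
     inner_L2 (lborel_pow 2) (\<lambda>y. f (y(2 := r))) (\<lambda>y. \<Prod>j<2. g j (y j)) =
     inner_L2 (lborel_pow 2) (\<lambda>y. f' (y(2 := r))) (\<lambda>y. \<Prod>j<2. g j (y j))"
proof -
  have L: "f \<in> L2 (lborel_pow 3)" "f' \<in> L2 (lborel_pow 3)" using f f' by (auto simp: wiener_ito_def)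
  define G where "G D j = (if j < (2::nat) then g j else indicator D)" for D j
  have G: "G D j \<in> L2 lborel" if "D \<in> sets lborel" "D \<subseteq> S" for D j
  proof -
    have "emeasure lborel D < \<infinity>" using emeasure_mono[OF that(2), of lborel] S by (auto intro: le_less_trans)
    then have "indicator D \<in> L2 lborel" using that by (intro L2_indicator)
    then show ?thesis using g by (auto simp: G_def less_2_cases_iff)
  qed
  have int: "integrable (lborel_pow (Suc 2)) (\<lambda>x. k x * (\<Prod>j<3. G D j (x j)))"
    if "k \<in> L2 (lborel_pow 3)" "D \<in> sets lborel" "D \<subseteq> S" for k D
    using L2_integrable_mult[OF that(1) L2_product[of 3 "G D"]] G[OF that(2,3)] by (simp add: eval_nat_numeral)
  define P where "P y = (\<Prod>j<2. g j (y j))" for y :: "nat \<Rightarrow> real"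
  have sections: "(\<Prod>j<3. G D j ((y(2 := r)) j)) = P y * indicator D r" for D y r
    by (simp add: prod_lessThan_3 P_def prod_lessThan_2 G_def)
  define \<phi> where "\<phi> r = (LINT y|lborel_pow 2. (f (y(2 := r)) - f' (y(2 := r))) * P y)" for r
  have d: "(\<lambda>x. f x - f' x) \<in> L2 (lborel_pow 3)" using L by (rule L2_diff)
  have pull: "(LINT y|lborel_pow 2. (f (y(2 := r)) - f' (y(2 := r))) * (P y * indicator D r)) = \<phi> r * indicator D r" for D r
    by (simp add: \<phi>_def mult.assoc[symmetric])
  have 1: "integrable lborel (\<lambda>r. \<phi> r * indicator S r)"
    using integrable_section_integral[OF int[OF d S(1) order_refl]] by (simp add: sections pull del: fun_upd_apply)
  have 2: "(LINT r|lborel. \<phi> r * indicator D r) = 0" if D: "D \<in> sets lborel" "D \<subseteq> S" for D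
  proof -
    have "(LINT r|lborel. \<phi> r * indicator D r) = (LINT x|lborel_pow (Suc 2). (f x - f' x) * (\<Prod>j<3. G D j (x j)))"
      using integral_section[OF int[OF d D]] by (simp add: sections pull del: fun_upd_apply)
    also have "\<dots> = 0"
      using wiener_ito_kernel_unique_weak[OF f f', of "G D"] G[OF D] by (simp add: eval_nat_numeral)
    finally show ?thesis .
  qed
  have [measurable]: "f \<in> borel_measurable (lborel_pow (Suc 2))" "f' \<in> borel_measurable (lborel_pow (Suc 2))"
    using L L2_measurable by (auto simp: eval_nat_numeral)
  have [measurable]: "P \<in> borel_measurable (lborel_pow 2)"
    using g unfolding P_def by (intro L2_measurable L2_product) (auto simp: less_2_cases_iff)
  have m: "\<phi> \<in> borel_measurable lborel"
  proof -
    interpret sigma_finite_measure "lborel_pow 2" by (rule sigma_finite_lborel_pow)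
    have "(\<lambda>p. f (case (snd p, fst p) of (y, r) \<Rightarrow> y(2 := r)) - f' (case (snd p, fst p) of (y, r) \<Rightarrow> y(2 := r)))
       \<in> borel_measurable (lborel \<Otimes>\<^sub>M lborel_pow 2)" by measurable
    then show ?thesis
      unfolding \<phi>_def by (intro borel_measurable_lebesgue_integral) (simp add: case_prod_unfold)
  qed
  have 3: "AE r in lborel. r \<in> S \<longrightarrow> \<phi> r = 0"
    by (rule AE_zero_if_set_integrals_zero[OF 1 m S(1) 2])
  have 4: "AE r in lborel. integrable (lborel_pow 2) (\<lambda>y. f (y(2 := r)) * (P y * indicator S r))"
      "AE r in lborel. integrable (lborel_pow 2) (\<lambda>y. f' (y(2 := r)) * (P y * indicator S r))"
    using AE_integrable_section[OF int[OF L(1) S(1) order_refl]] AE_integrable_section[OF int[OF L(2) S(1) order_refl]]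
    by (simp_all add: sections del: fun_upd_apply)
  from 3 4 show ?thesis
    unfolding P_def[symmetric] by eventually_elim (auto simp: \<phi>_def left_diff_distrib)
qed

end

section \<open>Decoupling of quadratic Gaussian phases\<close>

text \<open>Taking the modulus of the inner integral removes \<open>\<alpha>\<close>. By the Cauchy-Schwarz inequality in \<open>x\<close> the square is
bounded by a double integral over two copies \<open>y\<close>, \<open>y'\<close> of the second variable; integrating over \<open>x\<close> first,
the phase \<open>\<beta> y - \<beta> y'\<close> is constant and disappears in the modulus.\<close>

lemma decoupling:
  fixes \<alpha> :: "'a \<Rightarrow> real" and \<beta> :: "'b \<Rightarrow> real" and L :: "'a \<Rightarrow> 'b \<Rightarrow> real"
  assumes N: "prob_space N1" "prob_space N2"
    and [measurable]: "\<alpha> \<in> borel_measurable N1" "\<beta> \<in> borel_measurable N2"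
      "(\<lambda>(x, y). L x y) \<in> borel_measurable (N1 \<Otimes>\<^sub>M N2)"
  shows "(cmod (CLINT x|N1. CLINT y|N2. iexp (\<alpha> x + \<beta> y + L x y)))\<^sup>2 \<le>
    (LINT p|(N2 \<Otimes>\<^sub>M N2). cmod (CLINT x|N1. iexp (L x (fst p) - L x (snd p))))"
proof -
  interpret N1: prob_space N1 by fact
  interpret N2: prob_space N2 by fact
  interpret N22: pair_prob_space N2 N2 ..
  interpret N122: pair_prob_space N1 "N2 \<Otimes>\<^sub>M N2" ..
  have L1: "(\<lambda>p. L (f p) (g p)) \<in> borel_measurable N" if "f \<in> measurable N N1" "g \<in> measurable N N2"
    for f g and N :: "'c measure"
    using measurable_compose[OF measurable_Pair[OF that], of "\<lambda>(x, y). L x y"] by simp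
  have L2: "(\<lambda>p. L (f p) (g p)) \<in> borel_measurable N" if "f \<in> measurable N N1" "g \<in> measurable N N2"
    for f g and N :: "('a \<times> 'b) measure"
    using measurable_compose[OF measurable_Pair[OF that], of "\<lambda>(x, y). L x y"] by simp
  define G where "G x = (CLINT y|N2. iexp (\<beta> y + L x y))" for x
  have Gm [measurable]: "G \<in> borel_measurable N1"
    unfolding G_def by (intro N2.borel_measurable_lebesgue_integral) measurable
  have Lx: "(\<lambda>y. L x y) \<in> borel_measurable N2" if "x \<in> space N1" for x
    using measurable_Pair2[OF assms(5) that] by simp
  have Ly: "(\<lambda>x. L x y) \<in> borel_measurable N1" if "y \<in> space N2" for y
    using measurable_Pair1[OF assms(5) that] by simp
  have intG: "integrable N2 (\<lambda>y. iexp (\<beta> y + L x y))" if "x \<in> space N1" for x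
    using Lx[OF that] by (intro N2.integrable_bounded_complex[where C = 1]) auto
  have Gb: "cmod (G x) \<le> 1" for x
  proof -
    have "cmod (G x) \<le> (LINT y|N2. cmod (iexp (\<beta> y + L x y)))"
      unfolding G_def by (rule integral_norm_bound)
    then show ?thesis by (simp add: N2.prob_space)
  qed
  have "(CLINT x|N1. CLINT y|N2. iexp (\<alpha> x + \<beta> y + L x y)) = (CLINT x|N1. iexp (\<alpha> x) * G x)"
    by (intro Bochner_Integration.integral_cong)
      (simp_all add: G_def exp_add distrib_left mult.assoc)
  then have "cmod (CLINT x|N1. CLINT y|N2. iexp (\<alpha> x + \<beta> y + L x y)) \<le> (LINT x|N1. cmod (iexp (\<alpha> x) * G x))"
    by (simp add: integral_norm_bound)
  also have "\<dots> = inner_L2 N1 (\<lambda>x. cmod (G x)) (\<lambda>x. 1)" by (simp add: norm_mult)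
  finally have "(cmod (CLINT x|N1. CLINT y|N2. iexp (\<alpha> x + \<beta> y + L x y)))\<^sup>2 \<le> (inner_L2 N1 (\<lambda>x. cmod (G x)) (\<lambda>x. 1))\<^sup>2"
    by (intro power_mono) auto
  also have "\<dots> \<le> inner_L2 N1 (\<lambda>x. cmod (G x)) (\<lambda>x. cmod (G x)) * inner_L2 N1 (\<lambda>x. 1) (\<lambda>x. 1)"
  proof (rule inner_L2_Cauchy_Schwarz)
    have "integrable N1 (\<lambda>x. (cmod (G x))\<^sup>2)"
      using Gb by (intro N1.integrable_bounded_real[where C = 1]) (auto simp: abs_square_le_1)
    then show "(\<lambda>x. cmod (G x)) \<in> L2 N1" by (simp add: L2_def)
  qed (simp add: L2_def)
  also have "\<dots> = cmod (CLINT x|N1. complex_of_real (cmod (G x) * cmod (G x)))"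
    by (simp add: N1.prob_space abs_of_nonneg integral_nonneg_AE del: of_real_mult)
  also have "(CLINT x|N1. complex_of_real (cmod (G x) * cmod (G x))) =
    (CLINT x|N1. CLINT p|(N2 \<Otimes>\<^sub>M N2). iexp (\<beta> (fst p) - \<beta> (snd p) + (L x (fst p) - L x (snd p))))"
  proof (intro Bochner_Integration.integral_cong refl)
    fix x assume x: "x \<in> space N1"
    note [measurable] = Lx[OF x]
    have "complex_of_real (cmod (G x) * cmod (G x)) = G x * cnj (G x)"
      by (simp add: complex_norm_square[symmetric] power2_eq_square)
    also have "\<dots> = (CLINT y|N2. iexp (\<beta> y + L x y)) * (CLINT y|N2. cnj (iexp (\<beta> y + L x y)))"
      by (simp add: G_def)
    also have "\<dots> = (CLINT y|N2. CLINT y'|N2. iexp (\<beta> y + L x y) * cnj (iexp (\<beta> y' + L x y')))"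
      by (simp only: integral_mult_left_zero integral_mult_right_zero)
    also have "\<dots> = (CLINT y|N2. CLINT y'|N2. iexp (\<beta> y - \<beta> y' + (L x y - L x y')))"
    proof -
      have "iexp a * cnj (iexp b) = iexp (a - b)" for a b
        by (simp add: exp_cnj exp_add[symmetric] right_diff_distrib)
      then show ?thesis by (simp only: add_diff_add)
    qed
    also have "\<dots> = (CLINT p|(N2 \<Otimes>\<^sub>M N2). iexp (\<beta> (fst p) - \<beta> (snd p) + (L x (fst p) - L x (snd p))))"
      by (subst N22.integral_fst'[symmetric])
        (auto intro!: N22.integrable_bounded_complex[where C = 1])
    finally show "complex_of_real (cmod (G x) * cmod (G x)) = \<dots>" .
  qed
  also have "\<dots> = (CLINT p|(N2 \<Otimes>\<^sub>M N2). CLINT x|N1. iexp (\<beta> (fst p) - \<beta> (snd p) + (L x (fst p) - L x (snd p))))"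
  proof (rule N122.Fubini_integral[symmetric], rule N122.integrable_bounded_complex[where C = 1])
    show "(\<lambda>(x, p). iexp (\<beta> (fst p) - \<beta> (snd p) + (L x (fst p) - L x (snd p)))) \<in> borel_measurable (N1 \<Otimes>\<^sub>M (N2 \<Otimes>\<^sub>M N2))"
      by measurable
  qed auto
  also have "cmod \<dots> \<le> (LINT p|(N2 \<Otimes>\<^sub>M N2). cmod (CLINT x|N1. iexp (\<beta> (fst p) - \<beta> (snd p) + (L x (fst p) - L x (snd p)))))"
    by (rule integral_norm_bound)
  also have "\<dots> = (LINT p|(N2 \<Otimes>\<^sub>M N2). cmod (CLINT x|N1. iexp (L x (fst p) - L x (snd p))))"
  proof (intro Bochner_Integration.integral_cong refl)
    fix p
    have "(CLINT x|N1. iexp (\<beta> (fst p) - \<beta> (snd p) + (L x (fst p) - L x (snd p)))) =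
      (CLINT x|N1. iexp (\<beta> (fst p) - \<beta> (snd p)) * iexp (L x (fst p) - L x (snd p)))"
      by (simp add: exp_add[symmetric] distrib_left)
    also have "\<dots> = iexp (\<beta> (fst p) - \<beta> (snd p)) * (CLINT x|N1. iexp (L x (fst p) - L x (snd p)))"
      by simp
    finally show "cmod (CLINT x|N1. iexp (\<beta> (fst p) - \<beta> (snd p) + (L x (fst p) - L x (snd p)))) =
      cmod (CLINT x|N1. iexp (L x (fst p) - L x (snd p)))" by (simp add: norm_mult)
  qed
  finally show ?thesis .
qed

abbreviation std_normal_pow :: "'i set \<Rightarrow> ('i \<Rightarrow> real) measure" where
  "std_normal_pow K \<equiv> PiM K (\<lambda>_. std_normal_distribution)"

interpretation std_normal: real_distribution std_normal_distribution
  by (rule real_dist_normal_dist)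

interpretation std_normal_product: product_sigma_finite "\<lambda>_. std_normal_distribution"
  by (intro product_sigma_finite.intro std_normal.sigma_finite_measure_axioms)

lemma prob_space_std_normal_pow: "prob_space (std_normal_pow K)"
  by (rule prob_space_PiM) (rule std_normal.prob_space_axioms)

lemma char_std_normal_pow:
  assumes "finite K"
  shows "(CLINT x|std_normal_pow K. iexp (\<Sum>k\<in>K. t k * x k)) = complex_of_real (exp (- (\<Sum>k\<in>K. (t k)\<^sup>2) / 2))"
proof -
  have "(CLINT x|std_normal_pow K. iexp (\<Sum>k\<in>K. t k * x k)) = (CLINT x|std_normal_pow K. (\<Prod>k\<in>K. iexp (t k * x k)))"
    using assms by (simp add: sum_distrib_left exp_sum)
  also have "\<dots> = (\<Prod>k\<in>K. CLINT y|std_normal_distribution. iexp (t k * y))"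
    using assms by (intro std_normal_product.product_integral_prod)
      (auto intro!: std_normal.integrable_bounded_complex[where C = 1])
  also have "\<dots> = (\<Prod>k\<in>K. complex_of_real (exp (- (t k)\<^sup>2 / 2)))"
    using fun_cong[OF char_std_normal_distribution] by (simp add: char_def)
  also have "\<dots> = complex_of_real (exp (\<Sum>k\<in>K. - (t k)\<^sup>2 / 2))"
    using assms by (simp add: exp_sum)
  finally show ?thesis by (simp add: sum_negf sum_divide_distrib)
qed

lemma sum_Plus: "finite A \<Longrightarrow> finite B \<Longrightarrow> (\<Sum>i\<in>A <+> B. f i) = (\<Sum>a\<in>A. f (Inl a)) + (\<Sum>b\<in>B. f (Inr b))"
  by (simp add: sum.Plus)

context isonormal_process begin

text \<open>The coordinates along orthonormal functions are standard normal and independent of the process on the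
orthogonal complement. Stated as an equality of joint laws, this permits integration over the
coordinates first, for a fixed value of the remainder.\<close>

lemma orthonormal_split_law:
  fixes E :: "'k \<Rightarrow> real \<Rightarrow> real" and R :: "'j \<Rightarrow> real \<Rightarrow> real"
  assumes K: "finite K" and J: "finite J"
    and E: "\<And>k. k \<in> K \<Longrightarrow> E k \<in> L2 lborel" and R: "\<And>j. j \<in> J \<Longrightarrow> R j \<in> L2 lborel"
    and ortho: "\<And>k l. k \<in> K \<Longrightarrow> l \<in> K \<Longrightarrow> inner_L2 lborel (E k) (E l) = (if k = l then 1 else 0)"
    and perp: "\<And>k j. k \<in> K \<Longrightarrow> j \<in> J \<Longrightarrow> inner_L2 lborel (E k) (R j) = 0"
  shows "distr M (PiM (K <+> J) (\<lambda>_. borel)) (\<lambda>\<omega>. \<lambda>i\<in>K <+> J. case i of Inl k \<Rightarrow> B (E k) \<omega> | Inr j \<Rightarrow> B (R j) \<omega>) =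
    distr (std_normal_pow K \<Otimes>\<^sub>M M) (PiM (K <+> J) (\<lambda>_. borel))
      (\<lambda>p. \<lambda>i\<in>K <+> J. case i of Inl k \<Rightarrow> fst p k | Inr j \<Rightarrow> B (R j) (snd p))"
proof -
  interpret G: prob_space "std_normal_pow K" by (rule prob_space_std_normal_pow)
  interpret P: pair_prob_space "std_normal_pow K" M ..
  define V where "V i = (case i of Inl k \<Rightarrow> E k | Inr j \<Rightarrow> R j)" for i
  have V: "V i \<in> L2 lborel" if "i \<in> K <+> J" for i using that E R by (auto simp: V_def)
  have fin: "finite (K <+> J)" using K J by simp
  have Bm: "(\<lambda>p. B (R j) (snd p)) \<in> borel_measurable (std_normal_pow K \<Otimes>\<^sub>M M)" if "j \<in> J" for j
    using measurable_compose[OF measurable_snd B_measurable[OF R[OF that]]] .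
  show ?thesis
  proof (rule joint_law_eqI_char[OF fin prob_space_axioms P.prob_space_axioms])
    show "(\<lambda>\<omega>. case i of Inl k \<Rightarrow> B (E k) \<omega> | Inr j \<Rightarrow> B (R j) \<omega>) \<in> borel_measurable M" if "i \<in> K <+> J" for i
      using that E R by auto
    show "(\<lambda>p. case i of Inl k \<Rightarrow> fst p k | Inr j \<Rightarrow> B (R j) (snd p)) \<in> borel_measurable (std_normal_pow K \<Otimes>\<^sub>M M)"
      if "i \<in> K <+> J" for i
      using that Bm by auto
    fix t :: "'k + 'j \<Rightarrow> real"
    have norm: "inner_L2 lborel (\<lambda>x. \<Sum>i\<in>K <+> J. t i * V i x) (\<lambda>x. \<Sum>i\<in>K <+> J. t i * V i x) =
      (\<Sum>k\<in>K. (t (Inl k))\<^sup>2) + inner_L2 lborel (\<lambda>x. \<Sum>j\<in>J. t (Inr j) * R j x) (\<lambda>x. \<Sum>j\<in>J. t (Inr j) * R j x)"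
    proof -
      have "inner_L2 lborel (\<lambda>x. \<Sum>i\<in>K <+> J. t i * V i x) (\<lambda>x. \<Sum>i\<in>K <+> J. t i * V i x) =
        (\<Sum>i\<in>K <+> J. \<Sum>j\<in>K <+> J. t i * t j * inner_L2 lborel (V i) (V j))"
        by (intro inner_L2_lincomb V)
      also have "\<dots> = (\<Sum>k\<in>K. \<Sum>l\<in>K. t (Inl k) * t (Inl l) * inner_L2 lborel (E k) (E l)) +
          (\<Sum>i\<in>J. \<Sum>j\<in>J. t (Inr i) * t (Inr j) * inner_L2 lborel (R i) (R j))"
        using K J perp by (simp add: sum_Plus V_def mult.commute[of "R _ _" "E _ _"])
      also have "(\<Sum>k\<in>K. \<Sum>l\<in>K. t (Inl k) * t (Inl l) * inner_L2 lborel (E k) (E l)) =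
         (\<Sum>k\<in>K. \<Sum>l\<in>K. if l = k then (t (Inl k))\<^sup>2 else 0)"
        by (intro sum.cong refl) (auto simp: ortho power2_eq_square)
      also have "\<dots> = (\<Sum>k\<in>K. (t (Inl k))\<^sup>2)" using K by simp
      also have "(\<Sum>i\<in>J. \<Sum>j\<in>J. t (Inr i) * t (Inr j) * inner_L2 lborel (R i) (R j)) =
        inner_L2 lborel (\<lambda>x. \<Sum>j\<in>J. t (Inr j) * R j x) (\<lambda>x. \<Sum>j\<in>J. t (Inr j) * R j x)"
        by (intro inner_L2_lincomb[symmetric] R)
      finally show ?thesis .
    qed
    have "(CLINT \<omega>|M. iexp (\<Sum>i\<in>K <+> J. t i * (case i of Inl k \<Rightarrow> B (E k) \<omega> | Inr j \<Rightarrow> B (R j) \<omega>))) =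
      (CLINT \<omega>|M. iexp (\<Sum>i\<in>K <+> J. t i * B (V i) \<omega>))"
      by (simp add: V_def sum_Plus K J)
    also have "\<dots> = complex_of_real (exp (- ((\<Sum>k\<in>K. (t (Inl k))\<^sup>2) +
        inner_L2 lborel (\<lambda>x. \<Sum>j\<in>J. t (Inr j) * R j x) (\<lambda>x. \<Sum>j\<in>J. t (Inr j) * R j x)) / 2))"
      unfolding norm[symmetric] by (rule char_lincomb[OF fin V])
    also have "\<dots> = (CLINT x|std_normal_pow K. iexp (\<Sum>k\<in>K. t (Inl k) * x k)) *
        (CLINT \<omega>|M. iexp (\<Sum>j\<in>J. t (Inr j) * B (R j) \<omega>))"
    proof -
      have "(CLINT \<omega>|M. iexp (\<Sum>j\<in>J. t (Inr j) * B (R j) \<omega>)) =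
        complex_of_real (exp (- inner_L2 lborel (\<lambda>x. \<Sum>j\<in>J. t (Inr j) * R j x) (\<lambda>x. \<Sum>j\<in>J. t (Inr j) * R j x) / 2))"
        by (rule char_lincomb[OF J R])
      then show ?thesis
        unfolding char_std_normal_pow[OF K] by (simp add: of_real_mult[symmetric] exp_add[symmetric] diff_divide_distrib del: of_real_mult)
    qed
    also have "\<dots> = (CLINT x|std_normal_pow K. CLINT \<omega>|M. iexp (\<Sum>k\<in>K. t (Inl k) * x k) * iexp (\<Sum>j\<in>J. t (Inr j) * B (R j) \<omega>))"
      by simp
    also have "\<dots> = (CLINT p|(std_normal_pow K \<Otimes>\<^sub>M M). iexp (\<Sum>k\<in>K. t (Inl k) * fst p k) * iexp (\<Sum>j\<in>J. t (Inr j) * B (R j) (snd p)))"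
    proof (subst P.integral_fst'[symmetric])
      show "integrable (std_normal_pow K \<Otimes>\<^sub>M M) (\<lambda>p. iexp (\<Sum>k\<in>K. t (Inl k) * fst p k) * iexp (\<Sum>j\<in>J. t (Inr j) * B (R j) (snd p)))"
      proof (rule P.integrable_bounded_complex[where C = 1])
        have "(\<lambda>p. \<Sum>k\<in>K. t (Inl k) * fst p k) \<in> borel_measurable (std_normal_pow K \<Otimes>\<^sub>M M)"
          by measurable
        moreover have "(\<lambda>p. \<Sum>j\<in>J. t (Inr j) * B (R j) (snd p)) \<in> borel_measurable (std_normal_pow K \<Otimes>\<^sub>M M)"
          using Bm by (intro borel_measurable_sum borel_measurable_times) auto
        ultimately show "(\<lambda>p. iexp (\<Sum>k\<in>K. t (Inl k) * fst p k) * iexp (\<Sum>j\<in>J. t (Inr j) * B (R j) (snd p))) \<in> borel_measurable (std_normal_pow K \<Otimes>\<^sub>M M)"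
          by measurable
      qed (simp add: norm_mult)
    qed simp
    also have "\<dots> = (CLINT p|(std_normal_pow K \<Otimes>\<^sub>M M). iexp (\<Sum>i\<in>K <+> J. t i * (case i of Inl k \<Rightarrow> fst p k | Inr j \<Rightarrow> B (R j) (snd p))))"
      by (simp add: sum_Plus K J exp_add[symmetric] distrib_left del: of_real_sum)
    finally show "(CLINT \<omega>|M. iexp (\<Sum>i\<in>K <+> J. t i * (case i of Inl k \<Rightarrow> B (E k) \<omega> | Inr j \<Rightarrow> B (R j) \<omega>))) =
      (CLINT p|(std_normal_pow K \<Otimes>\<^sub>M M). iexp (\<Sum>i\<in>K <+> J. t i * (case i of Inl k \<Rightarrow> fst p k | Inr j \<Rightarrow> B (R j) (snd p))))" .
  qed
qed

end

text \<open>The expectation of \<open>exp (- \<bar>H (y - y')\<bar>\<^sup>2 / 2)\<close> for independent standard Gaussian vectors \<open>y\<close>, \<open>y'\<close>. This is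
the bound of the lemma on decoupling for the bilinear form \<open>L x y = \<langle>x, H y\<rangle>\<close>, since integrating
\<open>exp (\<i> \<langle>x, H z\<rangle>)\<close> over a standard Gaussian \<open>x\<close> yields \<open>exp (- \<bar>H z\<bar>\<^sup>2 / 2)\<close>.\<close>

definition decoupled :: "'k set \<Rightarrow> 'k set \<Rightarrow> ('k \<Rightarrow> 'k \<Rightarrow> real) \<Rightarrow> real" where
  "decoupled K1 K2 H = (LINT p|(std_normal_pow K2 \<Otimes>\<^sub>M std_normal_pow K2).
     exp (- (\<Sum>k\<in>K1. (\<Sum>l\<in>K2. H k l * (fst p l - snd p l))\<^sup>2) / 2))"

lemma prob_space_std_normal_pair: "prob_space (std_normal_pow K \<Otimes>\<^sub>M std_normal_pow K)"
proof -
  interpret G: prob_space "std_normal_pow K" by (rule prob_space_std_normal_pow)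
  interpret pair_prob_space "std_normal_pow K" "std_normal_pow K" ..
  show ?thesis by (rule prob_space_axioms)
qed

lemma decoupled_integrand_measurable:
  "(\<lambda>p. exp (- (\<Sum>k\<in>K1. (\<Sum>l\<in>K2. H k l * (fst p l - snd p l))\<^sup>2) / 2)) \<in>
     borel_measurable (std_normal_pow K2 \<Otimes>\<^sub>M std_normal_pow K2)"
  by measurable

lemma decoupled_tendsto:
  assumes "finite K1" "finite K2" and "\<And>k l. k \<in> K1 \<Longrightarrow> l \<in> K2 \<Longrightarrow> (\<lambda>n. Hn n k l) \<longlonglongrightarrow> H k l"
  shows "(\<lambda>n::nat. decoupled K1 K2 (Hn n)) \<longlonglongrightarrow> decoupled K1 K2 H"
  unfolding decoupled_def
proof (rule integral_dominated_convergence[where w = "\<lambda>_. 1"])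
  interpret prob_space "std_normal_pow K2 \<Otimes>\<^sub>M std_normal_pow K2" by (rule prob_space_std_normal_pair)
  show "integrable (std_normal_pow K2 \<Otimes>\<^sub>M std_normal_pow K2) (\<lambda>_. 1 :: real)" by simp
  show "AE p in std_normal_pow K2 \<Otimes>\<^sub>M std_normal_pow K2.
      (\<lambda>n. exp (- (\<Sum>k\<in>K1. (\<Sum>l\<in>K2. Hn n k l * (fst p l - snd p l))\<^sup>2) / 2)) \<longlonglongrightarrow>
      exp (- (\<Sum>k\<in>K1. (\<Sum>l\<in>K2. H k l * (fst p l - snd p l))\<^sup>2) / 2)"
    using assms by (intro AE_I2 tendsto_intros) auto
qed (auto intro!: decoupled_integrand_measurable simp: sum_nonneg)

lemma cmod_integral_square_le:
  assumes "prob_space N" and \<phi>: "\<phi> \<in> borel_measurable N" "\<And>x. x \<in> space N \<Longrightarrow> (cmod (\<phi> x))\<^sup>2 \<le> D"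
  shows "(cmod (CLINT x|N. \<phi> x))\<^sup>2 \<le> D"
proof -
  interpret prob_space N by fact
  have D: "0 \<le> D" using \<phi>(2) not_empty by (metis ex_in_conv order.trans zero_le_power2)
  have b: "cmod (\<phi> x) \<le> sqrt D" if "x \<in> space N" for x
    using real_sqrt_le_mono[OF \<phi>(2)[OF that]] by simp
  have "cmod (CLINT x|N. \<phi> x) \<le> (LINT x|N. cmod (\<phi> x))" by (rule integral_norm_bound)
  also have "\<dots> \<le> (LINT x|N. sqrt D)"
    using b \<phi>(1) D by (intro integral_mono integrable_bounded_real[where C = "sqrt D"]) auto
  also have "\<dots> = sqrt D" by (simp add: prob_space)
  finally have "(cmod (CLINT x|N. \<phi> x))\<^sup>2 \<le> (sqrt D)\<^sup>2" by (intro power_mono) auto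
  then show ?thesis using D by simp
qed

context isonormal_process begin

lemma orthonormal_projection:
  assumes K: "finite K" and E: "\<And>k. k \<in> K \<Longrightarrow> E k \<in> L2 lborel"
    and ortho: "\<And>k l. k \<in> K \<Longrightarrow> l \<in> K \<Longrightarrow> inner_L2 lborel (E k) (E l) = (if k = l then 1 else 0)"
    and g: "g \<in> L2 lborel"
  defines "r \<equiv> \<lambda>x. g x - (\<Sum>k\<in>K. inner_L2 lborel g (E k) * E k x)"
  shows "r \<in> L2 lborel" "\<And>k. k \<in> K \<Longrightarrow> inner_L2 lborel (E k) r = 0"
    "AE \<omega> in M. B g \<omega> = (\<Sum>k\<in>K. inner_L2 lborel g (E k) * B (E k) \<omega>) + B r \<omega>"
proof -
  let ?c = "\<lambda>k. inner_L2 lborel g (E k)"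
  show r: "r \<in> L2 lborel" unfolding r_def by (intro L2_diff L2_lincomb E g)
  show "inner_L2 lborel (E k) r = 0" if k: "k \<in> K" for k
  proof -
    have "inner_L2 lborel r (E k) = inner_L2 lborel g (E k) - inner_L2 lborel (\<lambda>x. \<Sum>l\<in>K. ?c l * E l x) (E k)"
      unfolding r_def by (intro inner_L2_diff_left g L2_lincomb E k)
    also have "inner_L2 lborel (\<lambda>x. \<Sum>l\<in>K. ?c l * E l x) (E k) =
        inner_L2 lborel (\<lambda>x. \<Sum>l\<in>K. ?c l * E l x) (\<lambda>x. \<Sum>u\<in>{()}. 1 * E k x)" by simp
    also have "\<dots> = (\<Sum>l\<in>K. \<Sum>u\<in>{()}. ?c l * 1 * inner_L2 lborel (E l) (E k))"
      by (intro inner_L2_lincomb E k)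
    also have "\<dots> = (\<Sum>l\<in>K. if l = k then ?c k else 0)"
      using k by (intro sum.cong) (auto simp: ortho)
    also have "\<dots> = ?c k" using K k by simp
    finally show ?thesis by (simp add: mult.commute)
  qed
  let ?h = "case_option r E" and ?d = "case_option 1 ?c"
  have "AE \<omega> in M. B g \<omega> = (\<Sum>z\<in>insert None (Some ` K). ?d z * B (?h z) \<omega>)"
  proof (rule B_linear_AE)
    show "g x = (\<Sum>z\<in>insert None (Some ` K). ?d z * ?h z x)" for x
      using K by (subst sum.insert) (auto simp: sum.reindex r_def)
  qed (use K E r g in auto)
  then show "AE \<omega> in M. B g \<omega> = (\<Sum>k\<in>K. ?c k * B (E k) \<omega>) + B r \<omega>"
    using K by (subst (asm) sum.insert) (auto simp: sum.reindex add.commute)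
qed

text \<open>For a fixed value \<open>w\<close> of the remainder, the phase is a quadratic polynomial in the coordinates \<open>x\<close> and
\<open>y\<close> of the two groups. The terms without \<open>y\<close> form \<open>\<alpha>\<close>, those without \<open>x\<close> form \<open>\<beta>\<close>, and the mixed part is
the bilinear form of \<open>H\<close>. It does not involve \<open>w\<close>, so that the bound is uniform in \<open>w\<close>.\<close>

lemma char_quadratic_bound:
  fixes E :: "'k \<Rightarrow> real \<Rightarrow> real" and h h' :: "'j \<Rightarrow> real \<Rightarrow> real" and b :: "'j \<Rightarrow> real"
  assumes K: "finite K1" "finite K2" "K1 \<inter> K2 = {}" and J: "finite J"
    and E: "\<And>k. k \<in> K1 \<union> K2 \<Longrightarrow> E k \<in> L2 lborel"
    and ortho: "\<And>k l. k \<in> K1 \<union> K2 \<Longrightarrow> l \<in> K1 \<union> K2 \<Longrightarrow> inner_L2 lborel (E k) (E l) = (if k = l then 1 else 0)"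
    and h: "\<And>j. j \<in> J \<Longrightarrow> h j \<in> L2 lborel" "\<And>j. j \<in> J \<Longrightarrow> h' j \<in> L2 lborel"
  defines "H \<equiv> \<lambda>k l. \<Sum>j\<in>J. b j * (inner_L2 lborel (h j) (E k) * inner_L2 lborel (h' j) (E l) +
      inner_L2 lborel (h j) (E l) * inner_L2 lborel (h' j) (E k))"
  shows "(cmod (CLINT \<omega>|M. iexp (\<Sum>j\<in>J. b j * (B (h j) \<omega> * B (h' j) \<omega>))))\<^sup>2 \<le> decoupled K1 K2 H"
proof -
  let ?K = "K1 \<union> K2" and ?J = "J <+> J" and ?G = "std_normal_pow (K1 \<union> K2)"
  define g where "g = case_sum h h'"
  define c where "c i k = inner_L2 lborel (g i) (E k)" for i k
  define R where "R i = (\<lambda>x. g i x - (\<Sum>k\<in>?K. c i k * E k x))" for i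
  have finK: "finite ?K" and finJ: "finite ?J" using K J by auto
  have gL: "g i \<in> L2 lborel" if "i \<in> ?J" for i using that h by (auto simp: g_def)
  have proj: "R i \<in> L2 lborel" "k \<in> ?K \<Longrightarrow> inner_L2 lborel (E k) (R i) = 0"
      "AE \<omega> in M. B (g i) \<omega> = (\<Sum>k\<in>?K. c i k * B (E k) \<omega>) + B (R i) \<omega>" if "i \<in> ?J" for i k
    unfolding R_def c_def using orthonormal_projection[OF finK E ortho gL[OF that]] by auto
  define S where "S z w = (\<Sum>j\<in>J. b j * (((\<Sum>k\<in>?K. c (Inl j) k * z k) + w (Inl j)) * ((\<Sum>k\<in>?K. c (Inr j) k * z k) + w (Inr j))))"
    for z :: "'k \<Rightarrow> real" and w :: "'j + 'j \<Rightarrow> real"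
  define \<Psi> where "\<Psi> z = iexp (S (\<lambda>k. z (Inl k)) (\<lambda>i. z (Inr i)))" for z :: "'k + ('j + 'j) \<Rightarrow> real"
  have \<Psi>m: "\<Psi> \<in> borel_measurable (PiM (?K <+> ?J) (\<lambda>_. borel))"
  proof -
    have 1: "(\<lambda>z. z (Inl k)) \<in> borel_measurable (PiM (?K <+> ?J) (\<lambda>_. borel :: real measure))" if "k \<in> ?K" for k
      using that by (intro measurable_component_singleton[of "Inl k" "?K <+> ?J" "\<lambda>_. borel :: real measure"]) auto
    have 2: "(\<lambda>z. z (Inr i)) \<in> borel_measurable (PiM (?K <+> ?J) (\<lambda>_. borel :: real measure))" if "i \<in> ?J" for i
      using that by (intro measurable_component_singleton[of "Inr i" "?K <+> ?J" "\<lambda>_. borel :: real measure"]) auto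
    have 3: "(\<lambda>z. S (\<lambda>k. z (Inl k)) (\<lambda>i. z (Inr i))) \<in> borel_measurable (PiM (?K <+> ?J) (\<lambda>_. borel :: real measure))"
      unfolding S_def
      by (intro borel_measurable_sum borel_measurable_times borel_measurable_add borel_measurable_const 1 2) auto
    show ?thesis unfolding \<Psi>_def using 3 by measurable
  qed
  let ?V = "\<lambda>\<omega>. \<lambda>i\<in>?K <+> ?J. case i of Inl k \<Rightarrow> B (E k) \<omega> | Inr j \<Rightarrow> B (R j) \<omega>"
  let ?W = "\<lambda>p. \<lambda>i\<in>?K <+> ?J. case i of Inl k \<Rightarrow> fst p k | Inr j \<Rightarrow> B (R j) (snd p)"
  interpret G: prob_space ?G by (rule prob_space_std_normal_pow)
  interpret P: pair_prob_space ?G M ..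
  have Bm: "(\<lambda>p. B (R j) (snd p)) \<in> borel_measurable (?G \<Otimes>\<^sub>M M)" if "j \<in> ?J" for j
    using measurable_compose[OF measurable_snd B_measurable[OF proj(1)[OF that]]] by auto
  have Vm: "?V \<in> measurable M (PiM (?K <+> ?J) (\<lambda>_. borel))"
  proof (intro measurable_restrict)
    fix i assume "i \<in> ?K <+> ?J"
    then show "(\<lambda>\<omega>. case i of Inl k \<Rightarrow> B (E k) \<omega> | Inr j \<Rightarrow> B (R j) \<omega>) \<in> borel_measurable M"
      by (cases i) (auto intro!: B_measurable E proj(1))
  qed
  have Wm: "?W \<in> measurable (?G \<Otimes>\<^sub>M M) (PiM (?K <+> ?J) (\<lambda>_. borel))"
  proof (intro measurable_restrict)
    fix i assume "i \<in> ?K <+> ?J"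
    then show "(\<lambda>p. case i of Inl k \<Rightarrow> fst p k | Inr j \<Rightarrow> B (R j) (snd p)) \<in> borel_measurable (?G \<Otimes>\<^sub>M M)"
      by (cases i) (auto intro!: Bm)
  qed
  have S_cong: "S z w = S z' w'" if "\<And>k. k \<in> ?K \<Longrightarrow> z k = z' k" "\<And>i. i \<in> ?J \<Longrightarrow> w i = w' i" for z z' w w'
    unfolding S_def using that by (intro sum.cong refl arg_cong2[where f = "(*)"] arg_cong2[where f = "(+)"]) auto
  have Sint: "integrable (?G \<Otimes>\<^sub>M M) (\<lambda>(z, \<omega>). iexp (S z (\<lambda>i. B (R i) \<omega>)))"
  proof -
    have "(\<lambda>p. \<Psi> (?W p)) \<in> borel_measurable (?G \<Otimes>\<^sub>M M)" by (rule measurable_compose[OF Wm \<Psi>m])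
    moreover have "\<Psi> (?W p) = iexp (S (fst p) (\<lambda>i. B (R i) (snd p)))" for p
      unfolding \<Psi>_def by (intro arg_cong[where f = iexp] S_cong) auto
    ultimately show ?thesis
      by (intro P.integrable_bounded_complex[where C = 1]) (auto simp: case_prod_unfold)
  qed
  have "(CLINT \<omega>|M. iexp (\<Sum>j\<in>J. b j * (B (h j) \<omega> * B (h' j) \<omega>))) = (CLINT \<omega>|M. \<Psi> (?V \<omega>))"
  proof (rule integral_cong_AE)
    show "(\<lambda>\<omega>. iexp (\<Sum>j\<in>J. b j * (B (h j) \<omega> * B (h' j) \<omega>))) \<in> borel_measurable M"
      using h by measurable
    show "(\<lambda>\<omega>. \<Psi> (?V \<omega>)) \<in> borel_measurable M" by (rule measurable_compose[OF Vm \<Psi>m])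
    have "AE \<omega> in M. \<forall>i\<in>?J. B (g i) \<omega> = (\<Sum>k\<in>?K. c i k * B (E k) \<omega>) + B (R i) \<omega>"
      by (intro AE_finite_allI finJ proj(3)) auto
    then show "AE \<omega> in M. iexp (\<Sum>j\<in>J. b j * (B (h j) \<omega> * B (h' j) \<omega>)) = \<Psi> (?V \<omega>)"
    proof eventually_elim
      case (elim \<omega>)
      have "\<Psi> (?V \<omega>) = iexp (S (\<lambda>k. B (E k) \<omega>) (\<lambda>i. B (R i) \<omega>))"
        unfolding \<Psi>_def by (intro arg_cong[where f = iexp] S_cong) auto
      also have "S (\<lambda>k. B (E k) \<omega>) (\<lambda>i. B (R i) \<omega>) = (\<Sum>j\<in>J. b j * (B (h j) \<omega> * B (h' j) \<omega>))"
        unfolding S_def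
      proof (intro sum.cong refl arg_cong2[where f = "(*)"])
        fix j assume j: "j \<in> J"
        show "(\<Sum>k\<in>?K. c (Inl j) k * B (E k) \<omega>) + B (R (Inl j)) \<omega> = B (h j) \<omega>"
          "(\<Sum>k\<in>?K. c (Inr j) k * B (E k) \<omega>) + B (R (Inr j)) \<omega> = B (h' j) \<omega>"
          using elim[rule_format, OF InlI[OF j]] elim[rule_format, OF InrI[OF j]] by (auto simp: g_def)
      qed
      finally show ?case by (rule sym)
    qed
  qed
  also have "\<dots> = (CLINT z|distr M (PiM (?K <+> ?J) (\<lambda>_. borel)) ?V. \<Psi> z)"
    by (rule integral_distr[OF Vm \<Psi>m, symmetric])
  also have "distr M (PiM (?K <+> ?J) (\<lambda>_. borel)) ?V = distr (?G \<Otimes>\<^sub>M M) (PiM (?K <+> ?J) (\<lambda>_. borel)) ?W"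
    by (rule orthonormal_split_law[OF finK finJ E proj(1) ortho proj(2)])
  also have "(CLINT z|distr (?G \<Otimes>\<^sub>M M) (PiM (?K <+> ?J) (\<lambda>_. borel)) ?W. \<Psi> z) = (CLINT p|(?G \<Otimes>\<^sub>M M). \<Psi> (?W p))"
    by (rule integral_distr[OF Wm \<Psi>m])
  also have "\<dots> = (CLINT p|(?G \<Otimes>\<^sub>M M). case p of (z, \<omega>) \<Rightarrow> iexp (S z (\<lambda>i. B (R i) \<omega>)))"
  proof -
    have "\<Psi> (?W p) = iexp (S (fst p) (\<lambda>i. B (R i) (snd p)))" for p
      unfolding \<Psi>_def by (intro arg_cong[where f = iexp] S_cong) auto
    then show ?thesis by (simp add: case_prod_unfold)
  qed
  also have "(CLINT p|(?G \<Otimes>\<^sub>M M). case p of (z, \<omega>) \<Rightarrow> iexp (S z (\<lambda>i. B (R i) \<omega>))) =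
     (CLINT \<omega>|M. CLINT z|?G. iexp (S z (\<lambda>i. B (R i) \<omega>)))"
    by (rule P.integral_snd[OF Sint, symmetric])
  finally have X: "(CLINT \<omega>|M. iexp (\<Sum>j\<in>J. b j * (B (h j) \<omega> * B (h' j) \<omega>))) =
     (CLINT \<omega>|M. CLINT z|?G. iexp (S z (\<lambda>i. B (R i) \<omega>)))" .
  show ?thesis
    unfolding X
  proof (rule cmod_integral_square_le[OF prob_space_axioms])
    show "(\<lambda>\<omega>. CLINT z|?G. iexp (S z (\<lambda>i. B (R i) \<omega>))) \<in> borel_measurable M"
      using P.integrable_snd[OF Sint] by auto
    fix \<omega>
    define w where "w = (\<lambda>i. B (R i) \<omega>)"
    define p where "p i x = (\<Sum>k\<in>K1. c i k * x k)" for i and x :: "'k \<Rightarrow> real"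
    define q where "q i y = (\<Sum>k\<in>K2. c i k * y k)" for i and y :: "'k \<Rightarrow> real"
    define \<alpha> where "\<alpha> x = (\<Sum>j\<in>J. b j * (p (Inl j) x * p (Inr j) x + p (Inl j) x * w (Inr j) + w (Inl j) * p (Inr j) x))" for x
    define \<beta> where "\<beta> y = (\<Sum>j\<in>J. b j * ((q (Inl j) y + w (Inl j)) * (q (Inr j) y + w (Inr j))))" for y
    define L where "L x y = (\<Sum>k\<in>K1. (\<Sum>l\<in>K2. H k l * y l) * x k)" for x y :: "'k \<Rightarrow> real"
    let ?G1 = "std_normal_pow K1" and ?G2 = "std_normal_pow K2"
    have L_eq: "L x y = (\<Sum>j\<in>J. b j * (p (Inl j) x * q (Inr j) y + q (Inl j) y * p (Inr j) x))" for x y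
    proof -
      have "L x y = (\<Sum>k\<in>K1. \<Sum>l\<in>K2. \<Sum>j\<in>J. b j * (c (Inl j) k * c (Inr j) l + c (Inl j) l * c (Inr j) k) * y l * x k)"
        by (simp add: L_def H_def c_def g_def sum_distrib_right)
      also have "\<dots> = (\<Sum>k\<in>K1. \<Sum>j\<in>J. \<Sum>l\<in>K2. b j * (c (Inl j) k * c (Inr j) l + c (Inl j) l * c (Inr j) k) * y l * x k)"
        by (intro sum.cong refl sum.swap)
      also have "\<dots> = (\<Sum>j\<in>J. \<Sum>k\<in>K1. \<Sum>l\<in>K2. b j * (c (Inl j) k * c (Inr j) l + c (Inl j) l * c (Inr j) k) * y l * x k)"
        by (rule sum.swap)
      also have "\<dots> = (\<Sum>j\<in>J. b j * (p (Inl j) x * q (Inr j) y + q (Inl j) y * p (Inr j) x))"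
      proof (intro sum.cong refl)
        fix j
        have "p (Inl j) x * q (Inr j) y + q (Inl j) y * p (Inr j) x = p (Inl j) x * q (Inr j) y + p (Inr j) x * q (Inl j) y"
          by simp
        also have "\<dots> = (\<Sum>k\<in>K1. \<Sum>l\<in>K2. (c (Inl j) k * x k) * (c (Inr j) l * y l) + (c (Inr j) k * x k) * (c (Inl j) l * y l))"
          by (simp add: p_def q_def sum_product sum.distrib)
        finally show "(\<Sum>k\<in>K1. \<Sum>l\<in>K2. b j * (c (Inl j) k * c (Inr j) l + c (Inl j) l * c (Inr j) k) * y l * x k) =
           b j * (p (Inl j) x * q (Inr j) y + q (Inl j) y * p (Inr j) x)"
          by (simp add: sum_distrib_left algebra_simps)
      qed
      finally show ?thesis .
    qed
    have S_split: "S (merge K1 K2 (x, y)) w = \<alpha> x + \<beta> y + L x y" for x y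
    proof -
      have pq: "(\<Sum>k\<in>?K. c i k * merge K1 K2 (x, y) k) = p i x + q i y" for i
      proof -
        have "(\<Sum>k\<in>?K. c i k * merge K1 K2 (x, y) k) =
          (\<Sum>k\<in>K1. c i k * merge K1 K2 (x, y) k) + (\<Sum>k\<in>K2. c i k * merge K1 K2 (x, y) k)"
          using K by (intro sum.union_disjoint) auto
        also have "\<dots> = p i x + q i y"
          unfolding p_def q_def using K by (intro arg_cong2[where f = "(+)"] sum.cong) (auto simp: merge_def)
        finally show ?thesis .
      qed
      show ?thesis
        unfolding S_def \<alpha>_def \<beta>_def L_eq pq sum.distrib[symmetric]
        by (intro sum.cong refl) (simp add: algebra_simps)
    qed
    have m1: "(\<lambda>x. p i x) \<in> borel_measurable ?G1" and m2: "(\<lambda>y. q i y) \<in> borel_measurable ?G2" for i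
      unfolding p_def q_def by measurable
    have m3: "\<alpha> \<in> borel_measurable ?G1" "\<beta> \<in> borel_measurable ?G2"
      unfolding \<alpha>_def[abs_def] \<beta>_def[abs_def] using m1 m2 by measurable
    have m4: "(\<lambda>(x, y). L x y) \<in> borel_measurable (?G1 \<Otimes>\<^sub>M ?G2)"
      unfolding L_def case_prod_unfold by measurable
    have Sm: "(\<lambda>z. S z w) \<in> borel_measurable ?G" unfolding S_def by measurable
    have "(CLINT z|?G. iexp (S z w)) = (CLINT x|?G1. CLINT y|?G2. iexp (S (merge K1 K2 (x, y)) w))"
      using Sm K by (intro std_normal_product.product_integral_fold G.integrable_bounded_complex[where C = 1]) auto
    also have "\<dots> = (CLINT x|?G1. CLINT y|?G2. iexp (\<alpha> x + \<beta> y + L x y))"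
      unfolding S_split ..
    finally have eq: "(CLINT z|?G. iexp (S z w)) = (CLINT x|?G1. CLINT y|?G2. iexp (\<alpha> x + \<beta> y + L x y))" .
    have "(cmod (CLINT x|?G1. CLINT y|?G2. iexp (\<alpha> x + \<beta> y + L x y)))\<^sup>2 \<le>
      (LINT p|(?G2 \<Otimes>\<^sub>M ?G2). cmod (CLINT x|?G1. iexp (L x (fst p) - L x (snd p))))"
      by (rule decoupling[OF prob_space_std_normal_pow prob_space_std_normal_pow m3 m4])
    also have "\<dots> = decoupled K1 K2 H"
      unfolding decoupled_def
    proof (intro Bochner_Integration.integral_cong refl)
      fix p :: "('k \<Rightarrow> real) \<times> ('k \<Rightarrow> real)"
      have "L x (fst p) - L x (snd p) = (\<Sum>k\<in>K1. (\<Sum>l\<in>K2. H k l * (fst p l - snd p l)) * x k)" for x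
        by (simp add: L_def sum_subtractf[symmetric] left_diff_distrib[symmetric] right_diff_distrib)
      then show "cmod (CLINT x|?G1. iexp (L x (fst p) - L x (snd p))) =
         exp (- (\<Sum>k\<in>K1. (\<Sum>l\<in>K2. H k l * (fst p l - snd p l))\<^sup>2) / 2)"
        using char_std_normal_pow[OF K(1)] by (simp del: of_real_sum of_real_mult)
    qed
    finally show "(cmod (CLINT z|?G. iexp (S z (\<lambda>i. B (R i) \<omega>))))\<^sup>2 \<le> decoupled K1 K2 H"
      using eq by (simp add: w_def)
  qed
qed

end

section \<open>Characteristic functions in the second chaos\<close>

lemma gaussian_average_exp_square:
  assumes c: "c > 0"
  shows "(LINT y|std_normal_distribution. exp (- c * (y - a)\<^sup>2)) \<le> 1 / sqrt (2 * c)"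
proof -
  define s where "s = 1 / sqrt (2 * c)"
  have s: "s > 0" "s\<^sup>2 = 1 / (2 * c)" using c by (auto simp: s_def power_divide)
  have e: "exp (- c * (y - a)\<^sup>2) = sqrt (2 * pi) * s * normal_density a s y" for y
  proof -
    have "sqrt (2 * pi * s\<^sup>2) = sqrt (2 * pi) * s" using s(1) by (simp add: real_sqrt_mult)
    moreover have "(y - a)\<^sup>2 / (2 * s\<^sup>2) = c * (y - a)\<^sup>2" using c unfolding s(2) by simp
    ultimately show ?thesis using s(1) by (simp add: normal_density_def)
  qed
  have "(LINT y|std_normal_distribution. exp (- c * (y - a)\<^sup>2)) = (LINT y|lborel. std_normal_density y * exp (- c * (y - a)\<^sup>2))"
    by (subst integral_density) auto
  also have "\<dots> \<le> (LINT y|lborel. 1 / sqrt (2 * pi) * exp (- c * (y - a)\<^sup>2))"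
  proof (rule integral_mono)
    show i: "integrable lborel (\<lambda>y. 1 / sqrt (2 * pi) * exp (- c * (y - a)\<^sup>2))"
      unfolding e using s by (intro integrable_mult_right integrable_normal_density)
    have b: "std_normal_density y \<le> 1 / sqrt (2 * pi)" for y
      by (simp add: std_normal_density_def divide_right_mono)
    show m: "std_normal_density y * exp (- c * (y - a)\<^sup>2) \<le> 1 / sqrt (2 * pi) * exp (- c * (y - a)\<^sup>2)" for y
      using b[of y] by (intro mult_right_mono) auto
    show "integrable lborel (\<lambda>y. std_normal_density y * exp (- c * (y - a)\<^sup>2))"
      by (rule Bochner_Integration.integrable_bound[OF i]) (use m in \<open>auto intro!: AE_I2\<close>)
  qed
  also have "\<dots> = s" unfolding e using s by simp
  finally show ?thesis by (simp add: s_def)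
qed

text \<open>Let \<open>z = y - y'\<close> and let \<open>l0\<close> be a coordinate of maximal modulus. In the row whose diagonal entry belongs to
\<open>l0\<close> the other terms amount to at most half of the diagonal one, hence \<open>\<bar>H z\<bar> \<ge> \<delta> \<bar>z l0\<bar> / 2\<close> and
\<open>\<bar>H z\<bar>\<^sup>2\<close> is at least \<open>\<delta>\<^sup>2 / (4 card K2)\<close> times \<open>\<bar>z\<bar>\<^sup>2\<close>. What remains is a product of one-dimensional Gaussian
averages, bounded uniformly in \<open>y'\<close>.\<close>

lemma decoupled_diagonally_dominant:
  assumes K: "finite K1" "finite K2" "bij_betw \<sigma> K1 K2" "K1 \<noteq> {}" and \<delta>: "\<delta> > 0"
    and diag: "\<And>k. k \<in> K1 \<Longrightarrow> \<delta> \<le> \<bar>H k (\<sigma> k)\<bar>"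
    and off: "\<And>k. k \<in> K1 \<Longrightarrow> (\<Sum>l\<in>K2 - {\<sigma> k}. \<bar>H k l\<bar>) \<le> \<bar>H k (\<sigma> k)\<bar> / 2"
  shows "decoupled K1 K2 H \<le> (2 * sqrt (card K2) / \<delta>) ^ card K2"
proof -
  have card: "card K2 > 0" using K bij_betw_same_card[OF K(3)] by (metis card_gt_0_iff)
  have lower: "\<delta>\<^sup>2 / (4 * card K2) * (\<Sum>l\<in>K2. (z l)\<^sup>2) \<le> (\<Sum>k\<in>K1. (\<Sum>l\<in>K2. H k l * z l)\<^sup>2)" for z
  proof -
    have K2ne: "K2 \<noteq> {}" using card by auto
    obtain l0 where l0: "l0 \<in> K2" "\<And>l. l \<in> K2 \<Longrightarrow> \<bar>z l\<bar> \<le> \<bar>z l0\<bar>"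
    proof -
      have "Max ((\<lambda>l. \<bar>z l\<bar>) ` K2) \<in> (\<lambda>l. \<bar>z l\<bar>) ` K2" using K K2ne by (intro Max_in) auto
      then obtain l0 where "l0 \<in> K2" "Max ((\<lambda>l. \<bar>z l\<bar>) ` K2) = \<bar>z l0\<bar>" by auto
      then show ?thesis using that[of l0] K by (metis (no_types, lifting) Max_ge finite_imageI imageI)
    qed
    obtain k0 where k0: "k0 \<in> K1" "\<sigma> k0 = l0" using l0 K(3) by (auto simp: bij_betw_def)
    have "\<bar>\<Sum>l\<in>K2 - {l0}. H k0 l * z l\<bar> \<le> (\<Sum>l\<in>K2 - {l0}. \<bar>H k0 l\<bar> * \<bar>z l0\<bar>)"
      using l0 by (intro order.trans[OF sum_abs] sum_mono) (auto simp: abs_mult intro!: mult_left_mono)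
    also have "\<dots> = (\<Sum>l\<in>K2 - {l0}. \<bar>H k0 l\<bar>) * \<bar>z l0\<bar>" by (simp add: sum_distrib_right)
    also have "\<dots> \<le> \<bar>H k0 l0\<bar> / 2 * \<bar>z l0\<bar>"
      using off[OF k0(1)] k0(2) by (intro mult_right_mono) auto
    finally have 1: "\<bar>\<Sum>l\<in>K2 - {l0}. H k0 l * z l\<bar> \<le> \<bar>H k0 l0\<bar> / 2 * \<bar>z l0\<bar>" .
    have "(\<Sum>l\<in>K2. H k0 l * z l) = H k0 l0 * z l0 + (\<Sum>l\<in>K2 - {l0}. H k0 l * z l)"
      using K l0 by (simp add: sum.remove)
    then have "\<bar>\<Sum>l\<in>K2. H k0 l * z l\<bar> \<ge> \<bar>H k0 l0 * z l0\<bar> - \<bar>\<Sum>l\<in>K2 - {l0}. H k0 l * z l\<bar>"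
      by linarith
    with 1 have "\<bar>\<Sum>l\<in>K2. H k0 l * z l\<bar> \<ge> \<bar>H k0 l0\<bar> * \<bar>z l0\<bar> / 2"
      by (simp add: abs_mult)
    moreover have "\<bar>H k0 l0\<bar> * \<bar>z l0\<bar> \<ge> \<delta> * \<bar>z l0\<bar>"
      using diag[OF k0(1)] k0(2) by (intro mult_right_mono) auto
    ultimately have "\<bar>\<Sum>l\<in>K2. H k0 l * z l\<bar> \<ge> \<delta> * \<bar>z l0\<bar> / 2" by linarith
    then have "(\<delta> * \<bar>z l0\<bar> / 2)\<^sup>2 \<le> (\<bar>\<Sum>l\<in>K2. H k0 l * z l\<bar>)\<^sup>2"
      using \<delta> by (intro power_mono) auto
    then have 2: "\<delta>\<^sup>2 / 4 * (z l0)\<^sup>2 \<le> (\<Sum>l\<in>K2. H k0 l * z l)\<^sup>2"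
      by (simp add: power_mult_distrib power_divide)
    have "(\<Sum>l\<in>K2. (z l)\<^sup>2) \<le> (\<Sum>l\<in>K2. (z l0)\<^sup>2)"
      using l0 by (intro sum_mono) (simp add: abs_le_square_iff)
    then have "(\<Sum>l\<in>K2. (z l)\<^sup>2) \<le> card K2 * (z l0)\<^sup>2" by simp
    then have "\<delta>\<^sup>2 / (4 * card K2) * (\<Sum>l\<in>K2. (z l)\<^sup>2) \<le> \<delta>\<^sup>2 / (4 * card K2) * (card K2 * (z l0)\<^sup>2)"
      by (intro mult_left_mono) auto
    also have "\<dots> = \<delta>\<^sup>2 / 4 * (z l0)\<^sup>2" using card by simp
    also note 2
    also have "(\<Sum>l\<in>K2. H k0 l * z l)\<^sup>2 \<le> (\<Sum>k\<in>K1. (\<Sum>l\<in>K2. H k l * z l)\<^sup>2)"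
      using k0 K by (intro member_le_sum) auto
    finally show ?thesis .
  qed
  define c where "c = \<delta>\<^sup>2 / (8 * card K2)"
  have c: "c > 0" using \<delta> card by (simp add: c_def)
  let ?G = "std_normal_pow K2"
  interpret G: prob_space ?G by (rule prob_space_std_normal_pow)
  interpret P: pair_prob_space ?G ?G ..
  have intf: "integrable (?G \<Otimes>\<^sub>M ?G) (\<lambda>(x, y). exp (- (\<Sum>l\<in>K2. c * (x l - y l)\<^sup>2)))"
  proof (rule P.integrable_bounded_real[where C = 1])
    show "(\<lambda>(x, y). exp (- (\<Sum>l\<in>K2. c * (x l - y l)\<^sup>2))) \<in> borel_measurable (?G \<Otimes>\<^sub>M ?G)"
      unfolding case_prod_unfold by measurable
  qed (use c in \<open>auto simp: sum_nonneg\<close>)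
  have "decoupled K1 K2 H \<le> (LINT p|(?G \<Otimes>\<^sub>M ?G). (case p of (x, y) \<Rightarrow> exp (- (\<Sum>l\<in>K2. c * (x l - y l)\<^sup>2))))"
    unfolding decoupled_def
  proof (rule integral_mono[OF _ intf])
    show "integrable (?G \<Otimes>\<^sub>M ?G) (\<lambda>p. exp (- (\<Sum>k\<in>K1. (\<Sum>l\<in>K2. H k l * (fst p l - snd p l))\<^sup>2) / 2))"
      by (rule P.integrable_bounded_real[where C = 1]) (auto intro!: decoupled_integrand_measurable simp: sum_nonneg)
    fix p :: "('a \<Rightarrow> real) \<times> ('a \<Rightarrow> real)"
    have "(\<Sum>l\<in>K2. c * (fst p l - snd p l)\<^sup>2) = \<delta>\<^sup>2 / (4 * card K2) * (\<Sum>l\<in>K2. (fst p l - snd p l)\<^sup>2) / 2"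
      unfolding c_def sum_distrib_left[symmetric] by simp
    also have "\<dots> \<le> (\<Sum>k\<in>K1. (\<Sum>l\<in>K2. H k l * (fst p l - snd p l))\<^sup>2) / 2"
      using lower[of "\<lambda>l. fst p l - snd p l"] by simp
    finally show "exp (- (\<Sum>k\<in>K1. (\<Sum>l\<in>K2. H k l * (fst p l - snd p l))\<^sup>2) / 2) \<le>
       (case p of (x, y) \<Rightarrow> exp (- (\<Sum>l\<in>K2. c * (x l - y l)\<^sup>2)))"
      by (simp add: case_prod_unfold)
  qed
  also have "\<dots> = (LINT y|?G. LINT x|?G. exp (- (\<Sum>l\<in>K2. c * (x l - y l)\<^sup>2)))"
    by (rule P.integral_snd[OF intf, symmetric])
  also have "\<dots> \<le> (LINT y|?G. (1 / sqrt (2 * c)) ^ card K2)"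
  proof (rule integral_mono)
    show "integrable ?G (\<lambda>y. LINT x|?G. exp (- (\<Sum>l\<in>K2. c * (x l - y l)\<^sup>2)))"
      by (rule P.integrable_snd[OF intf])
    fix y
    have "(LINT x|?G. exp (- (\<Sum>l\<in>K2. c * (x l - y l)\<^sup>2))) = (LINT x|?G. (\<Prod>l\<in>K2. exp (- c * (x l - y l)\<^sup>2)))"
      using K by (simp add: exp_sum[symmetric] sum_negf)
    also have "\<dots> = (\<Prod>l\<in>K2. LINT u|std_normal_distribution. exp (- c * (u - y l)\<^sup>2))"
      using K c by (intro std_normal_product.product_integral_prod) (auto intro!: std_normal.integrable_bounded_real[where C = 1])
    also have "\<dots> \<le> (\<Prod>l\<in>K2. 1 / sqrt (2 * c))"
      by (intro prod_mono conjI gaussian_average_exp_square c integral_nonneg_AE) auto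
    finally show "(LINT x|?G. exp (- (\<Sum>l\<in>K2. c * (x l - y l)\<^sup>2))) \<le> (1 / sqrt (2 * c)) ^ card K2"
      by simp
  qed auto
  also have "\<dots> = (1 / sqrt (2 * c)) ^ card K2" by (simp add: G.prob_space)
  also have "1 / sqrt (2 * c) = 2 * sqrt (card K2) / \<delta>"
  proof -
    have "sqrt (2 * c) = \<delta> / (2 * sqrt (card K2))"
      using \<delta> by (simp add: c_def real_sqrt_divide real_sqrt_mult[symmetric] power2_eq_square real_sqrt_mult)
    then show ?thesis by simp
  qed
  finally show ?thesis .
qed

context isonormal_process begin

lemma expectation_abs_le: "X \<in> L2 M \<Longrightarrow> (LINT \<omega>|M. \<bar>X \<omega>\<bar>) \<le> sqrt (LINT \<omega>|M. (X \<omega>)\<^sup>2)"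
proof -
  assume X: "X \<in> L2 M"
  have "(inner_L2 M (\<lambda>\<omega>. \<bar>X \<omega>\<bar>) (\<lambda>_. 1))\<^sup>2 \<le> inner_L2 M (\<lambda>\<omega>. \<bar>X \<omega>\<bar>) (\<lambda>\<omega>. \<bar>X \<omega>\<bar>) * inner_L2 M (\<lambda>_. 1) (\<lambda>_. 1)"
    using X by (intro inner_L2_Cauchy_Schwarz) (auto simp: L2_def)
  then have "(LINT \<omega>|M. \<bar>X \<omega>\<bar>)\<^sup>2 \<le> (LINT \<omega>|M. (X \<omega>)\<^sup>2)"
    by (simp add: prob_space power2_eq_square abs_mult_self_eq)
  then show "(LINT \<omega>|M. \<bar>X \<omega>\<bar>) \<le> sqrt (LINT \<omega>|M. (X \<omega>)\<^sup>2)"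
    by (rule real_le_rsqrt)
qed

lemma L2_imp_integrable: "X \<in> L2 M \<Longrightarrow> integrable M X"
  using L2_integrable_mult[of X M "\<lambda>_. 1"] by (simp add: L2_def)

lemma char_tendsto_if_L2_tendsto:
  fixes Y :: "nat \<Rightarrow> 'j \<Rightarrow> 'a \<Rightarrow> real"
  assumes J: "finite J" and L: "\<And>n j. j \<in> J \<Longrightarrow> Y n j \<in> L2 M" "\<And>j. j \<in> J \<Longrightarrow> X j \<in> L2 M"
    and lim: "\<And>j. j \<in> J \<Longrightarrow> (\<lambda>n. LINT \<omega>|M. (Y n j \<omega> - X j \<omega>)\<^sup>2) \<longlonglongrightarrow> 0"
  shows "(\<lambda>n. CLINT \<omega>|M. iexp (\<Sum>j\<in>J. t j * Y n j \<omega>)) \<longlonglongrightarrow> (CLINT \<omega>|M. iexp (\<Sum>j\<in>J. t j * X j \<omega>))"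
proof -
  have Lip: "cmod (iexp a - iexp b) \<le> \<bar>a - b\<bar>" for a b
  proof -
    have "iexp a - iexp b = iexp b * (iexp (a - b) - 1)"
      by (simp add: right_diff_distrib exp_add[symmetric])
    then show ?thesis using iexp_approx1[of "a - b" 0] by (simp add: norm_mult)
  qed
  have XM [measurable]: "(\<lambda>\<omega>. \<Sum>j\<in>J. t j * X j \<omega>) \<in> borel_measurable M"
    using L2_measurable[OF L2_lincomb[OF L(2), where c = t]] by auto
  have YM [measurable]: "(\<lambda>\<omega>. \<Sum>j\<in>J. t j * Y n j \<omega>) \<in> borel_measurable M" for n
    using L2_measurable[OF L2_lincomb[OF L(1), where c = t]] by auto
  have int0: "integrable M (\<lambda>\<omega>. iexp (Z \<omega>))" if "Z \<in> borel_measurable M" for Z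
    using that by (intro integrable_bounded_complex[where C = 1]) auto
  note int = int0[OF XM] int0[OF YM]
  have d: "(\<lambda>\<omega>. Y n j \<omega> - X j \<omega>) \<in> L2 M" if "j \<in> J" for n j by (rule L2_diff[OF L(1)[OF that] L(2)[OF that]])
  have "(\<lambda>n. (CLINT \<omega>|M. iexp (\<Sum>j\<in>J. t j * Y n j \<omega>)) - (CLINT \<omega>|M. iexp (\<Sum>j\<in>J. t j * X j \<omega>))) \<longlonglongrightarrow> 0"
  proof (rule tendsto_norm_zero_cancel, rule tendsto_sandwich[OF _ _ tendsto_const])
    show "\<forall>\<^sub>F n in sequentially. norm ((CLINT \<omega>|M. iexp (\<Sum>j\<in>J. t j * Y n j \<omega>)) - (CLINT \<omega>|M. iexp (\<Sum>j\<in>J. t j * X j \<omega>)))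
      \<le> (\<Sum>j\<in>J. \<bar>t j\<bar> * sqrt (LINT \<omega>|M. (Y n j \<omega> - X j \<omega>)\<^sup>2))"
    proof (intro always_eventually allI)
      fix n
      have i: "integrable M (\<lambda>\<omega>. \<Sum>j\<in>J. \<bar>t j\<bar> * \<bar>Y n j \<omega> - X j \<omega>\<bar>)"
        by (intro Bochner_Integration.integrable_sum integrable_mult_right integrable_abs L2_imp_integrable d)
      have "norm ((CLINT \<omega>|M. iexp (\<Sum>j\<in>J. t j * Y n j \<omega>)) - (CLINT \<omega>|M. iexp (\<Sum>j\<in>J. t j * X j \<omega>))) =
        norm (CLINT \<omega>|M. iexp (\<Sum>j\<in>J. t j * Y n j \<omega>) - iexp (\<Sum>j\<in>J. t j * X j \<omega>))"
        by (subst Bochner_Integration.integral_diff[OF int(2) int(1)]) simp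
      also have "\<dots> \<le> (LINT \<omega>|M. cmod (iexp (\<Sum>j\<in>J. t j * Y n j \<omega>) - iexp (\<Sum>j\<in>J. t j * X j \<omega>)))"
        by (rule integral_norm_bound)
      also have "\<dots> \<le> (LINT \<omega>|M. (\<Sum>j\<in>J. \<bar>t j\<bar> * \<bar>Y n j \<omega> - X j \<omega>\<bar>))"
      proof (rule integral_mono[OF _ i])
        show "integrable M (\<lambda>\<omega>. cmod (iexp (\<Sum>j\<in>J. t j * Y n j \<omega>) - iexp (\<Sum>j\<in>J. t j * X j \<omega>)))"
          by (intro integrable_norm Bochner_Integration.integrable_diff int)
        fix \<omega>
        have "cmod (iexp (\<Sum>j\<in>J. t j * Y n j \<omega>) - iexp (\<Sum>j\<in>J. t j * X j \<omega>)) \<le> \<bar>\<Sum>j\<in>J. t j * (Y n j \<omega> - X j \<omega>)\<bar>"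
          using Lip[of "\<Sum>j\<in>J. t j * Y n j \<omega>" "\<Sum>j\<in>J. t j * X j \<omega>"]
          by (simp add: sum_subtractf[symmetric] right_diff_distrib del: of_real_sum)
        also have "\<dots> \<le> (\<Sum>j\<in>J. \<bar>t j * (Y n j \<omega> - X j \<omega>)\<bar>)" by (rule sum_abs)
        finally show "cmod (iexp (\<Sum>j\<in>J. t j * Y n j \<omega>) - iexp (\<Sum>j\<in>J. t j * X j \<omega>)) \<le> (\<Sum>j\<in>J. \<bar>t j\<bar> * \<bar>Y n j \<omega> - X j \<omega>\<bar>)"
          by (simp add: abs_mult)
      qed
      also have "\<dots> = (\<Sum>j\<in>J. \<bar>t j\<bar> * (LINT \<omega>|M. \<bar>Y n j \<omega> - X j \<omega>\<bar>))"
        by (subst Bochner_Integration.integral_sum) (simp_all add: integrable_abs L2_imp_integrable d)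
      also have "\<dots> \<le> (\<Sum>j\<in>J. \<bar>t j\<bar> * sqrt (LINT \<omega>|M. (Y n j \<omega> - X j \<omega>)\<^sup>2))"
        by (intro sum_mono mult_left_mono expectation_abs_le d) auto
      finally show "norm ((CLINT \<omega>|M. iexp (\<Sum>j\<in>J. t j * Y n j \<omega>)) - (CLINT \<omega>|M. iexp (\<Sum>j\<in>J. t j * X j \<omega>)))
        \<le> (\<Sum>j\<in>J. \<bar>t j\<bar> * sqrt (LINT \<omega>|M. (Y n j \<omega> - X j \<omega>)\<^sup>2))" .
    qed
    have "(\<lambda>n. \<Sum>j\<in>J. \<bar>t j\<bar> * sqrt (LINT \<omega>|M. (Y n j \<omega> - X j \<omega>)\<^sup>2)) \<longlonglongrightarrow> (\<Sum>j\<in>J. \<bar>t j\<bar> * sqrt 0)"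
      by (intro tendsto_intros lim)
    then show "(\<lambda>n. \<Sum>j\<in>J. \<bar>t j\<bar> * sqrt (LINT \<omega>|M. (Y n j \<omega> - X j \<omega>)\<^sup>2)) \<longlonglongrightarrow> 0" by simp
  qed simp
  then show ?thesis by (simp add: LIM_zero_iff)
qed

text \<open>The integral of an elementary kernel is a quadratic polynomial in the process, and both sides of the
inequality are continuous with respect to mean square convergence of the kernels and the integrals.\<close>

lemma char_second_chaos_bound:
  fixes E :: "'k \<Rightarrow> real \<Rightarrow> real" and t :: "'j \<Rightarrow> real"
  assumes K: "finite K1" "finite K2" "K1 \<inter> K2 = {}" and J: "finite J"
    and E: "\<And>k. k \<in> K1 \<union> K2 \<Longrightarrow> E k \<in> L2 lborel"
    and ortho: "\<And>k l. k \<in> K1 \<union> K2 \<Longrightarrow> l \<in> K1 \<union> K2 \<Longrightarrow> inner_L2 lborel (E k) (E l) = (if k = l then 1 else 0)"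
    and X: "\<And>j. j \<in> J \<Longrightarrow> wiener_ito M B 2 (f j) (X j)"
  shows "(cmod (CLINT \<omega>|M. iexp (\<Sum>j\<in>J. t j * X j \<omega>)))\<^sup>2 \<le> decoupled K1 K2
    (\<lambda>k l. \<Sum>j\<in>J. t j * (inner_L2 (lborel_pow 2) (f j) (\<lambda>x. E k (x 0) * E l (x 1)) +
       inner_L2 (lborel_pow 2) (f j) (\<lambda>x. E l (x 0) * E k (x 1))))"
proof -
  \<comment> \<open>The approximating data of each \<open>j\<close> are packed into triples so that they can be chosen for all \<open>j\<close> at once.\<close>
  have "\<forall>j\<in>J. \<exists>D. (\<forall>m. elementary_data 2 (fst (D m)) (fst (snd (D m))) (snd (snd (D m)))) \<and>
    (\<lambda>m. LINT x|lborel_pow 2. (elementary_fun 2 (fst (D m)) (fst (snd (D m))) (snd (snd (D m))) x - f j x)\<^sup>2) \<longlonglongrightarrow> 0 \<and>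
    (\<lambda>m. LINT \<omega>|M. (elementary_integral B 2 (fst (D m)) (fst (snd (D m))) (snd (snd (D m))) \<omega> - X j \<omega>)\<^sup>2) \<longlonglongrightarrow> 0"
    (is "\<forall>j\<in>J. \<exists>D. ?Q j D")
  proof
    fix j assume j: "j \<in> J"
    from wiener_ito_approximation[OF X[OF j]] obtain n A a where
      "\<And>k. elementary_data 2 (n k) (A k) (a k)"
      "(\<lambda>k. LINT x|lborel_pow 2. (elementary_fun 2 (n k) (A k) (a k) x - f j x)\<^sup>2) \<longlonglongrightarrow> 0"
      "(\<lambda>k. LINT \<omega>|M. (elementary_integral B 2 (n k) (A k) (a k) \<omega> - X j \<omega>)\<^sup>2) \<longlonglongrightarrow> 0" by blast
    then show "\<exists>D. ?Q j D" by (intro exI[of _ "\<lambda>m. (n m, A m, a m)"]) simp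
  qed
  from bchoice[OF this] obtain D where Q: "\<forall>j\<in>J. ?Q j (D j)" ..
  have D: "\<And>j m. j \<in> J \<Longrightarrow> elementary_data 2 (fst (D j m)) (fst (snd (D j m))) (snd (snd (D j m)))"
    "\<And>j. j \<in> J \<Longrightarrow> (\<lambda>m. LINT x|lborel_pow 2. (elementary_fun 2 (fst (D j m)) (fst (snd (D j m))) (snd (snd (D j m))) x - f j x)\<^sup>2) \<longlonglongrightarrow> 0"
    "\<And>j. j \<in> J \<Longrightarrow> (\<lambda>m. LINT \<omega>|M. (elementary_integral B 2 (fst (D j m)) (fst (snd (D j m))) (snd (snd (D j m))) \<omega> - X j \<omega>)\<^sup>2) \<longlonglongrightarrow> 0"
    using Q by auto
  define n where "n j m = fst (D j m)" for j m
  define A where "A j m = fst (snd (D j m))" for j m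
  define a where "a j m = snd (snd (D j m))" for j m
  note D = D[folded n_def A_def a_def]
  have fL: "f j \<in> L2 (lborel_pow 2)" and XL: "X j \<in> L2 M" if "j \<in> J" for j
    using X[OF that] by (auto simp: wiener_ito_def)
  define I where "I m = Sigma J (\<lambda>j. {..<2::nat} \<rightarrow>\<^sub>E {..<n j m})" for m
  have finI: "finite (I m)" for m unfolding I_def by (intro finite_SigmaI J finite_PiE) auto
  define Hm where "Hm m k l = (\<Sum>p\<in>I m. (t (fst p) * a (fst p) m (snd p)) *
     (inner_L2 lborel (indicator (A (fst p) m (snd p 0))) (E k) * inner_L2 lborel (indicator (A (fst p) m (snd p 1))) (E l) +
      inner_L2 lborel (indicator (A (fst p) m (snd p 0))) (E l) * inner_L2 lborel (indicator (A (fst p) m (snd p 1))) (E k)))" for m k l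
  let ?H = "\<lambda>k l. \<Sum>j\<in>J. t j * (inner_L2 (lborel_pow 2) (f j) (\<lambda>x. E k (x 0) * E l (x 1)) +
       inner_L2 (lborel_pow 2) (f j) (\<lambda>x. E l (x 0) * E k (x 1)))"
  have ind: "indicator (A j m (i 0)) \<in> L2 lborel" "indicator (A j m (i 1)) \<in> L2 lborel"
    if "j \<in> J" "i \<in> {..<2::nat} \<rightarrow>\<^sub>E {..<n j m}" for j m i
    using elementary_data_indicator_L2[OF D(1)[OF that(1)] that(2)] by auto
  have bound: "(cmod (CLINT \<omega>|M. iexp (\<Sum>j\<in>J. t j * elementary_integral B 2 (n j m) (A j m) (a j m) \<omega>)))\<^sup>2 \<le> decoupled K1 K2 (Hm m)" for m
  proof -
    define b where "b p = t (fst p) * a (fst p) m (snd p)" for p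
    define h :: "'j \<times> (nat \<Rightarrow> nat) \<Rightarrow> real \<Rightarrow> real" where "h p = indicator (A (fst p) m (snd p 0))" for p
    define h' :: "'j \<times> (nat \<Rightarrow> nat) \<Rightarrow> real \<Rightarrow> real" where "h' p = indicator (A (fst p) m (snd p 1))" for p
    have L: "h p \<in> L2 lborel" "h' p \<in> L2 lborel" if "p \<in> I m" for p
    proof -
      have p: "fst p \<in> J" "snd p \<in> {..<2::nat} \<rightarrow>\<^sub>E {..<n (fst p) m}"
        using that unfolding I_def by (cases p; simp only: mem_Sigma_iff fst_conv snd_conv)+
      show "h p \<in> L2 lborel" unfolding h_def by (rule ind(1)[OF p])
      show "h' p \<in> L2 lborel" unfolding h'_def by (rule ind(2)[OF p])
    qed
    have eq: "(\<Sum>j\<in>J. t j * elementary_integral B 2 (n j m) (A j m) (a j m) \<omega>) = (\<Sum>p\<in>I m. b p * (B (h p) \<omega> * B (h' p) \<omega>))" for \<omega>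
    proof -
      have "(\<Sum>j\<in>J. t j * elementary_integral B 2 (n j m) (A j m) (a j m) \<omega>) =
        (\<Sum>j\<in>J. \<Sum>i\<in>{..<2::nat} \<rightarrow>\<^sub>E {..<n j m}. b (j, i) * (B (h (j, i)) \<omega> * B (h' (j, i)) \<omega>))"
        by (simp add: elementary_integral_def prod_lessThan_2 sum_distrib_left mult.assoc b_def h_def h'_def)
      also have "\<dots> = (\<Sum>(j, i)\<in>I m. b (j, i) * (B (h (j, i)) \<omega> * B (h' (j, i)) \<omega>))"
        unfolding I_def using J by (intro sum.Sigma) (auto intro!: finite_PiE)
      finally show ?thesis by simp
    qed
    have Hm_b: "Hm m = (\<lambda>k l. \<Sum>p\<in>I m. b p * (inner_L2 lborel (h p) (E k) * inner_L2 lborel (h' p) (E l) +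
            inner_L2 lborel (h p) (E l) * inner_L2 lborel (h' p) (E k)))"
      by (intro ext) (simp only: Hm_def b_def h_def h'_def)
    show ?thesis
      unfolding eq Hm_b by (rule char_quadratic_bound[OF K finI E ortho L])
  qed
  have Hm_eq: "Hm m k l = (\<Sum>j\<in>J. t j * (inner_L2 (lborel_pow 2) (elementary_fun 2 (n j m) (A j m) (a j m)) (\<lambda>x. E k (x 0) * E l (x 1)) +
       inner_L2 (lborel_pow 2) (elementary_fun 2 (n j m) (A j m) (a j m)) (\<lambda>x. E l (x 0) * E k (x 1))))"
    if "k \<in> K1 \<union> K2" "l \<in> K1 \<union> K2" for m k l
  proof -
    have el: "inner_L2 (lborel_pow 2) (elementary_fun 2 (n j m) (A j m) (a j m)) (\<lambda>x. E k (x 0) * E l (x 1)) =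
      (\<Sum>i\<in>{..<2::nat} \<rightarrow>\<^sub>E {..<n j m}. a j m i * (inner_L2 lborel (indicator (A j m (i 0))) (E k) * inner_L2 lborel (indicator (A j m (i 1))) (E l)))"
      if "k \<in> K1 \<union> K2" "l \<in> K1 \<union> K2" "j \<in> J" for k l j
      using inner_L2_elementary_fun[OF D(1)[OF that(3)], of "\<lambda>i. if i = 0 then E k else E l"] E that
      by (simp add: prod_lessThan_2)
    have "Hm m k l = (\<Sum>j\<in>J. \<Sum>i\<in>{..<2::nat} \<rightarrow>\<^sub>E {..<n j m}. (t j * a j m i) *
     (inner_L2 lborel (indicator (A j m (i 0))) (E k) * inner_L2 lborel (indicator (A j m (i 1))) (E l) +
      inner_L2 lborel (indicator (A j m (i 0))) (E l) * inner_L2 lborel (indicator (A j m (i 1))) (E k)))"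
      unfolding Hm_def I_def using J by (subst sum.Sigma) (auto intro!: finite_PiE simp: case_prod_unfold)
    also have "\<dots> = (\<Sum>j\<in>J. t j * (inner_L2 (lborel_pow 2) (elementary_fun 2 (n j m) (A j m) (a j m)) (\<lambda>x. E k (x 0) * E l (x 1)) +
       inner_L2 (lborel_pow 2) (elementary_fun 2 (n j m) (A j m) (a j m)) (\<lambda>x. E l (x 0) * E k (x 1))))"
    proof (intro sum.cong refl)
      fix j assume j: "j \<in> J"
      show "(\<Sum>i\<in>{..<2::nat} \<rightarrow>\<^sub>E {..<n j m}. (t j * a j m i) *
       (inner_L2 lborel (indicator (A j m (i 0))) (E k) * inner_L2 lborel (indicator (A j m (i 1))) (E l) +
        inner_L2 lborel (indicator (A j m (i 0))) (E l) * inner_L2 lborel (indicator (A j m (i 1))) (E k))) =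
        t j * (inner_L2 (lborel_pow 2) (elementary_fun 2 (n j m) (A j m) (a j m)) (\<lambda>x. E k (x 0) * E l (x 1)) +
         inner_L2 (lborel_pow 2) (elementary_fun 2 (n j m) (A j m) (a j m)) (\<lambda>x. E l (x 0) * E k (x 1)))"
        unfolding el[OF that j] el[OF that(2,1) j]
        by (simp only: sum.distrib[symmetric] sum_distrib_left distrib_left mult.assoc)
    qed
    finally show ?thesis .
  qed
  have tensor: "(\<lambda>x. E k (x 0) * E l (x 1)) \<in> L2 (lborel_pow 2)" if "k \<in> K1 \<union> K2" "l \<in> K1 \<union> K2" for k l
    using L2_product[of 2 "\<lambda>i. if i = 0 then E k else E l"] E that by (simp add: prod_lessThan_2)
  have "(\<lambda>m. decoupled K1 K2 (Hm m)) \<longlonglongrightarrow> decoupled K1 K2 ?H"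
  proof (rule decoupled_tendsto[OF K(1,2)])
    fix k l assume "k \<in> K1" "l \<in> K2"
    then have kl: "k \<in> K1 \<union> K2" "l \<in> K1 \<union> K2" by auto
    show "(\<lambda>m. Hm m k l) \<longlonglongrightarrow> ?H k l"
      unfolding Hm_eq[OF kl]
      by (intro tendsto_intros inner_L2_tendsto elementary_fun_L2 D fL tensor kl)
  qed
  moreover have "(\<lambda>m. (cmod (CLINT \<omega>|M. iexp (\<Sum>j\<in>J. t j * elementary_integral B 2 (n j m) (A j m) (a j m) \<omega>)))\<^sup>2) \<longlonglongrightarrow>
     (cmod (CLINT \<omega>|M. iexp (\<Sum>j\<in>J. t j * X j \<omega>)))\<^sup>2"
    by (intro tendsto_power tendsto_norm char_tendsto_if_L2_tendsto[where Y = "\<lambda>m j. elementary_integral B 2 (n j m) (A j m) (a j m)"]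
        J elementary_integral_L2 D XL)
  ultimately show ?thesis using bound by (intro LIMSEQ_le) auto
qed

end

section \<open>From characteristic functions to small balls\<close>

lemma std_normal_average_Cauchy:
  assumes r: "r > 0"
  shows "(LINT y|std_normal_distribution. 2 / (1 + (r * y)\<^sup>2)) \<le> sqrt (2 * pi) / r"
proof -
  have half: "has_bochner_integral lborel (\<lambda>x. indicator {0..} x *\<^sub>R (1 / (1 + (r * x)\<^sup>2))) (pi / (2 * r))"
  proof (rule has_bochner_integral_nn_integral)
    have eq: "(\<integral>\<^sup>+x. ennreal (1 / (1 + (r * x)\<^sup>2)) * indicator {0..} x \<partial>lborel) = ennreal (pi / (2 * r) - arctan (r * 0) / r)"
    proof (rule nn_integral_FTC_atLeast)
      show "((\<lambda>x. arctan (r * x) / r) has_real_derivative 1 / (1 + (r * x)\<^sup>2)) (at x)" for x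
        using r by (auto intro!: derivative_eq_intros simp: inverse_eq_divide power_mult_distrib)
      have "((\<lambda>x. arctan (r * x) / r) \<longlongrightarrow> (pi / 2) / r) at_top"
        using r by (intro tendsto_intros filterlim_compose[OF tendsto_arctan_at_top] filterlim_tendsto_pos_mult_at_top[OF tendsto_const] filterlim_ident) auto
      then show "((\<lambda>x. arctan (r * x) / r) \<longlongrightarrow> pi / (2 * r)) at_top" by simp
    qed auto
    show "(\<integral>\<^sup>+x. ennreal (indicator {0..} x *\<^sub>R (1 / (1 + (r * x)\<^sup>2))) \<partial>lborel) = ennreal (pi / (2 * r))"
    proof -
      have "(\<integral>\<^sup>+x. ennreal (indicator {0..} x *\<^sub>R (1 / (1 + (r * x)\<^sup>2))) \<partial>lborel) =
          (\<integral>\<^sup>+x. ennreal (1 / (1 + (r * x)\<^sup>2)) * indicator {0..} x \<partial>lborel)"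
        by (intro nn_integral_cong) (simp add: indicator_def)
      then show ?thesis using eq by simp
    qed
  qed (use r in auto)
  have full: "has_bochner_integral lborel (\<lambda>x. 1 / (1 + (r * x)\<^sup>2)) (2 *\<^sub>R (pi / (2 * r)))"
    by (rule has_bochner_integral_even_function[OF half]) simp
  have i: "integrable lborel (\<lambda>y. (2 / sqrt (2 * pi)) * (1 / (1 + (r * y)\<^sup>2)))"
    using full by (intro integrable_mult_right) (auto simp: has_bochner_integral_iff)
  have "(LINT y|std_normal_distribution. 2 / (1 + (r * y)\<^sup>2)) = (LINT y|lborel. std_normal_density y * (2 / (1 + (r * y)\<^sup>2)))"
    by (subst integral_density) auto
  also have "\<dots> \<le> (LINT y|lborel. (2 / sqrt (2 * pi)) * (1 / (1 + (r * y)\<^sup>2)))"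
  proof (rule integral_mono[OF _ i])
    have b: "std_normal_density y \<le> 1 / sqrt (2 * pi)" for y
      by (simp add: std_normal_density_def divide_right_mono)
    show m: "std_normal_density y * (2 / (1 + (r * y)\<^sup>2)) \<le> (2 / sqrt (2 * pi)) * (1 / (1 + (r * y)\<^sup>2))" for y
    proof -
      have "std_normal_density y * (2 / (1 + (r * y)\<^sup>2)) \<le> 1 / sqrt (2 * pi) * (2 / (1 + (r * y)\<^sup>2))"
        using b[of y] by (intro mult_right_mono) auto
      then show ?thesis by simp
    qed
    show "integrable lborel (\<lambda>y. std_normal_density y * (2 / (1 + (r * y)\<^sup>2)))"
      by (rule Bochner_Integration.integrable_bound[OF i]) (use m in \<open>auto intro!: AE_I2\<close>)
  qed
  also have "\<dots> = (2 / sqrt (2 * pi)) * (pi / r)"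
    using full r by (subst integral_mult_right_zero) (simp add: has_bochner_integral_iff)
  also have "\<dots> = sqrt (2 * pi) / r"
  proof -
    have "2 * pi = sqrt (2 * pi) * sqrt (2 * pi)" by simp
    then have 1: "2 * pi / sqrt (2 * pi) = sqrt (2 * pi)"
      by (metis nonzero_eq_divide_eq pi_neq_zero real_sqrt_eq_zero_cancel_iff mult_eq_0_iff zero_neq_numeral)
    have "2 / sqrt (2 * pi) * (pi / r) = 2 * pi / sqrt (2 * pi) / r" by simp
    then show ?thesis unfolding 1 .
  qed
  finally show ?thesis .
qed

context isonormal_process begin

text \<open>As \<open>exp (- s\<^sup>2 / 2)\<close> is the characteristic function of a standard normal variable, the left-hand side is
the average of the characteristic function of \<open>X\<close> over the points \<open>\<rho> x\<close> with \<open>x\<close> standard Gaussian. The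
decay in the largest coordinate is converted into the product bound \<open>\<Prod>j\<in>J. 2 / (1 + (t j / \<kappa>)\<^sup>2)\<close>, whose
average factorizes; where all coordinates are at most \<open>\<kappa>\<close>, every factor is at least \<open>1\<close>.\<close>

lemma expectation_exp_square_bound:
  fixes X :: "'j \<Rightarrow> 'a \<Rightarrow> real"
  assumes J: "finite J" "J \<noteq> {}" and X [measurable]: "\<And>j. j \<in> J \<Longrightarrow> X j \<in> borel_measurable M"
    and \<kappa>: "\<kappa> > 0" and \<rho>: "\<rho> > 0"
    and \<phi>: "\<And>t i. i \<in> J \<Longrightarrow> t i \<noteq> 0 \<Longrightarrow> (\<And>j. j \<in> J \<Longrightarrow> \<bar>t j\<bar> \<le> \<bar>t i\<bar>) \<Longrightarrow>
       cmod (CLINT \<omega>|M. iexp (\<Sum>j\<in>J. t j * X j \<omega>)) \<le> (\<kappa> / \<bar>t i\<bar>) ^ (2 * card J)"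
  shows "(LINT \<omega>|M. exp (- (\<Sum>j\<in>J. (\<rho> * X j \<omega>)\<^sup>2) / 2)) \<le> (sqrt (2 * pi) * \<kappa> / \<rho>) ^ card J"
proof -
  let ?G = "std_normal_pow J"
  interpret G: prob_space ?G by (rule prob_space_std_normal_pow)
  interpret P: pair_prob_space ?G M ..
  have bound: "cmod (CLINT \<omega>|M. iexp (\<Sum>j\<in>J. t j * X j \<omega>)) \<le> (\<Prod>j\<in>J. 2 / (1 + (t j / \<kappa>)\<^sup>2))" for t
  proof -
    have le1: "cmod (CLINT \<omega>|M. iexp (\<Sum>j\<in>J. t j * X j \<omega>)) \<le> 1"
      by (rule order.trans[OF integral_norm_bound]) (simp add: prob_space)
    obtain i where i: "i \<in> J" "\<And>j. j \<in> J \<Longrightarrow> \<bar>t j\<bar> \<le> \<bar>t i\<bar>"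
    proof -
      have "Max ((\<lambda>l. \<bar>t l\<bar>) ` J) \<in> (\<lambda>l. \<bar>t l\<bar>) ` J" using J by (intro Max_in) auto
      then obtain l0 where "l0 \<in> J" "Max ((\<lambda>l. \<bar>t l\<bar>) ` J) = \<bar>t l0\<bar>" by auto
      then show ?thesis using that[of l0] J by (metis (no_types, lifting) Max_ge finite_imageI imageI)
    qed
    have mono: "2 / (1 + (\<bar>t i\<bar> / \<kappa>)\<^sup>2) \<le> 2 / (1 + (t j / \<kappa>)\<^sup>2)" if "j \<in> J" for j
    proof -
      have "(t j / \<kappa>)\<^sup>2 \<le> (\<bar>t i\<bar> / \<kappa>)\<^sup>2"
        using i(2)[OF that] \<kappa> unfolding power_divide by (intro divide_right_mono) (auto simp: abs_le_square_iff)
      then show ?thesis by (intro divide_left_mono add_left_mono) (auto intro!: mult_pos_pos add_pos_nonneg)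
    qed
    have pm: "(2 / (1 + (\<bar>t i\<bar> / \<kappa>)\<^sup>2)) ^ card J \<le> (\<Prod>j\<in>J. 2 / (1 + (t j / \<kappa>)\<^sup>2))"
      unfolding prod_constant[symmetric] using mono by (intro prod_mono) auto
    show ?thesis
    proof (cases "\<bar>t i\<bar> \<le> \<kappa>")
      case True
      have "(\<bar>t i\<bar> / \<kappa>)\<^sup>2 \<le> 1" using True \<kappa> by (simp add: power_le_one divide_le_eq)
      then have "1 \<le> 2 / (1 + (\<bar>t i\<bar> / \<kappa>)\<^sup>2)" by (simp add: le_divide_eq add_pos_nonneg)
      then have "1 \<le> (2 / (1 + (\<bar>t i\<bar> / \<kappa>)\<^sup>2)) ^ card J" by (rule one_le_power)
      with le1 pm show ?thesis by linarith
    next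
      case False
      define z where "z = \<bar>t i\<bar> / \<kappa>"
      have z: "z > 1" "z\<^sup>2 \<ge> 1" using False \<kappa> by (auto simp: z_def one_le_power)
      have "cmod (CLINT \<omega>|M. iexp (\<Sum>j\<in>J. t j * X j \<omega>)) \<le> (\<kappa> / \<bar>t i\<bar>) ^ (2 * card J)"
        using i False \<kappa> by (intro \<phi>) auto
      also have "\<dots> = (1 / z\<^sup>2) ^ card J"
        by (simp add: z_def power_mult power_divide)
      also have "\<dots> \<le> (2 / (1 + z\<^sup>2)) ^ card J"
      proof (intro power_mono)
        have "1 / z\<^sup>2 = 2 / (2 * z\<^sup>2)" by simp
        also have "\<dots> \<le> 2 / (1 + z\<^sup>2)" using z by (intro divide_left_mono mult_pos_pos add_pos_pos) auto
        finally show "1 / z\<^sup>2 \<le> 2 / (1 + z\<^sup>2)" .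
      qed auto
      finally show ?thesis using pm unfolding z_def by linarith
    qed
  qed
  have int: "integrable (?G \<Otimes>\<^sub>M M) (\<lambda>(x, \<omega>). iexp (\<Sum>j\<in>J. (\<rho> * X j \<omega>) * x j))"
  proof (rule P.integrable_bounded_complex[where C = 1])
    show "(\<lambda>(x, \<omega>). iexp (\<Sum>j\<in>J. (\<rho> * X j \<omega>) * x j)) \<in> borel_measurable (?G \<Otimes>\<^sub>M M)"
      unfolding case_prod_unfold by measurable
  qed auto
  have "complex_of_real (LINT \<omega>|M. exp (- (\<Sum>j\<in>J. (\<rho> * X j \<omega>)\<^sup>2) / 2)) =
      (CLINT \<omega>|M. CLINT x|?G. iexp (\<Sum>j\<in>J. (\<rho> * X j \<omega>) * x j))"
    unfolding char_std_normal_pow[OF J(1)] by simp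
  also have "\<dots> = (CLINT x|?G. CLINT \<omega>|M. iexp (\<Sum>j\<in>J. (\<rho> * X j \<omega>) * x j))"
    by (rule P.Fubini_integral[OF int])
  also have "\<dots> = (CLINT x|?G. CLINT \<omega>|M. iexp (\<Sum>j\<in>J. (\<rho> * x j) * X j \<omega>))"
    by (simp add: mult_ac)
  finally have eq: "complex_of_real (LINT \<omega>|M. exp (- (\<Sum>j\<in>J. (\<rho> * X j \<omega>)\<^sup>2) / 2)) =
      (CLINT x|?G. CLINT \<omega>|M. iexp (\<Sum>j\<in>J. (\<rho> * x j) * X j \<omega>))" .
  have "(LINT \<omega>|M. exp (- (\<Sum>j\<in>J. (\<rho> * X j \<omega>)\<^sup>2) / 2)) \<le> cmod (complex_of_real (LINT \<omega>|M. exp (- (\<Sum>j\<in>J. (\<rho> * X j \<omega>)\<^sup>2) / 2)))"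
    by simp
  also have "\<dots> \<le> (LINT x|?G. cmod (CLINT \<omega>|M. iexp (\<Sum>j\<in>J. (\<rho> * x j) * X j \<omega>)))"
    unfolding eq by (rule integral_norm_bound)
  also have "\<dots> \<le> (LINT x|?G. (\<Prod>j\<in>J. 2 / (1 + (\<rho> / \<kappa> * x j)\<^sup>2)))"
  proof (rule integral_mono)
    have "integrable ?G (\<lambda>x. CLINT \<omega>|M. iexp (\<Sum>j\<in>J. (\<rho> * x j) * X j \<omega>))"
      using P.integrable_fst'[OF int] by (simp add: mult_ac)
    then show "integrable ?G (\<lambda>x. cmod (CLINT \<omega>|M. iexp (\<Sum>j\<in>J. (\<rho> * x j) * X j \<omega>)))"
      by (rule integrable_norm)
    show "integrable ?G (\<lambda>x. (\<Prod>j\<in>J. 2 / (1 + (\<rho> / \<kappa> * x j)\<^sup>2)))"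
      using J by (intro std_normal_product.product_integrable_prod std_normal.integrable_bounded_real[where C = 2])
        (auto simp: divide_le_eq add_pos_nonneg)
    show "cmod (CLINT \<omega>|M. iexp (\<Sum>j\<in>J. (\<rho> * x j) * X j \<omega>)) \<le> (\<Prod>j\<in>J. 2 / (1 + (\<rho> / \<kappa> * x j)\<^sup>2))" for x
      using bound[of "\<lambda>j. \<rho> * x j"] by simp
  qed
  also have "\<dots> = (\<Prod>j\<in>J. LINT y|std_normal_distribution. 2 / (1 + (\<rho> / \<kappa> * y)\<^sup>2))"
    using J by (intro std_normal_product.product_integral_prod std_normal.integrable_bounded_real[where C = 2])
      (auto simp: divide_le_eq add_pos_nonneg)
  also have "\<dots> \<le> (\<Prod>j\<in>J. sqrt (2 * pi) / (\<rho> / \<kappa>))"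
    using \<kappa> \<rho> by (intro prod_mono conjI std_normal_average_Cauchy integral_nonneg_AE) auto
  also have "\<dots> = (sqrt (2 * pi) * \<kappa> / \<rho>) ^ card J" by simp
  finally show ?thesis .
qed

end

text \<open>One row of a linear combination of nonnegative matrices \<open>m j\<close> with diagonal entry at \<open>\<sigma> k\<close>. The matrix \<open>i\<close>
contributes the large diagonal entry \<open>\<mu>\<close>. The earlier matrices may be equally large there, but have
coefficients smaller by the factor \<open>4 n\<close>; the later ones, like all entries off the diagonal, have coefficients
up to \<open>Q \<bar>t i\<bar>\<close>, but entries bounded by \<open>A\<close>, which is tiny compared with \<open>D\<close>.\<close>

lemma triangular_dominance:
  fixes m :: "nat \<Rightarrow> 'k \<Rightarrow> 'l \<Rightarrow> real" and t :: "nat \<Rightarrow> real" and A D Q :: real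
  assumes n: "i < n" and K: "finite K" "\<sigma> k \<in> K"
    and m0: "\<And>j l. j < n \<Longrightarrow> l \<in> K \<Longrightarrow> 0 \<le> m j k l"
    and before: "\<And>j. j < i \<Longrightarrow> m j k (\<sigma> k) \<le> m i k (\<sigma> k)"
    and after: "\<And>j. i < j \<Longrightarrow> j < n \<Longrightarrow> m j k (\<sigma> k) \<le> A"
    and off: "\<And>j l. j < n \<Longrightarrow> l \<in> K \<Longrightarrow> l \<noteq> \<sigma> k \<Longrightarrow> m j k l \<le> A"
    and D: "D \<le> m i k (\<sigma> k)" "8 * card K * n * Q * A \<le> D" and Q: "1 \<le> Q" and A: "0 \<le> A"
    and t: "\<And>j. j < i \<Longrightarrow> \<bar>t j\<bar> \<le> \<bar>t i\<bar> / (4 * n)" "\<And>j. j < n \<Longrightarrow> \<bar>t j\<bar> \<le> Q * \<bar>t i\<bar>"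
  defines "H \<equiv> \<lambda>k l. \<Sum>j<n. t j * m j k l"
  shows "\<bar>t i\<bar> * D / 2 \<le> \<bar>H k (\<sigma> k)\<bar>" "(\<Sum>l\<in>K - {\<sigma> k}. \<bar>H k l\<bar>) \<le> \<bar>H k (\<sigma> k)\<bar> / 2"
proof -
  define \<mu> where "\<mu> = m i k (\<sigma> k)"
  have card: "1 \<le> card K" using K by (simp add: Suc_le_eq card_gt_0_iff) auto
  have n0: "0 < real n" using n by simp
  have QA: "0 \<le> real n * Q * A" using n0 Q A by simp
  have nQA: "real n * Q * A \<le> \<mu> / 8"
  proof -
    have "1 * (real n * Q * A) \<le> real (card K) * (real n * Q * A)"
      using card QA by (intro mult_right_mono) auto
    then show ?thesis using D by (simp add: \<mu>_def mult_ac)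
  qed
  have off_small: "card K * (real n * Q * A) \<le> \<mu> / 8" using D by (simp add: \<mu>_def mult_ac)
  have mu0: "0 \<le> \<mu>" using m0[of i "\<sigma> k"] n K by (simp add: \<mu>_def)
  have rest: "\<bar>\<Sum>j\<in>{..<n} - {i}. t j * m j k (\<sigma> k)\<bar> \<le> \<bar>t i\<bar> * \<mu> / 4 + \<bar>t i\<bar> * (real n * Q * A)"
  proof -
    have "\<bar>\<Sum>j\<in>{..<n} - {i}. t j * m j k (\<sigma> k)\<bar> \<le> (\<Sum>j\<in>{..<n} - {i}. \<bar>t i\<bar> * \<mu> / (4 * n) + \<bar>t i\<bar> * (Q * A))"
    proof (intro order.trans[OF sum_abs] sum_mono)
      fix j assume j: "j \<in> {..<n} - {i}"
      have mj: "0 \<le> m j k (\<sigma> k)" using m0 j K by auto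
      show "\<bar>t j * m j k (\<sigma> k)\<bar> \<le> \<bar>t i\<bar> * \<mu> / (4 * n) + \<bar>t i\<bar> * (Q * A)"
      proof (cases "j < i")
        case True
        have "\<bar>t j\<bar> * m j k (\<sigma> k) \<le> \<bar>t i\<bar> / (4 * n) * \<mu>"
          using t(1)[OF True] before[OF True] mj by (intro mult_mono) (auto simp: \<mu>_def)
        moreover have "0 \<le> \<bar>t i\<bar> * (Q * A)" using Q A by simp
        ultimately show ?thesis using mj by (simp add: abs_mult)
      next
        case False
        then have "i < j" using j by auto
        then have "\<bar>t j\<bar> * m j k (\<sigma> k) \<le> (Q * \<bar>t i\<bar>) * A"
          using t(2)[of j] after[of j] j mj Q by (intro mult_mono) auto
        moreover have "0 \<le> \<bar>t i\<bar> * \<mu> / (4 * n)" using mu0 by simp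
        ultimately show ?thesis using mj by (simp add: abs_mult mult_ac)
      qed
    qed
    also have "\<dots> = real (n - 1) * (\<bar>t i\<bar> * \<mu> / (4 * n) + \<bar>t i\<bar> * (Q * A))" using n by simp
    also have "\<dots> \<le> real n * (\<bar>t i\<bar> * \<mu> / (4 * n) + \<bar>t i\<bar> * (Q * A))"
      using mu0 Q A by (intro mult_right_mono) auto
    also have "\<dots> = \<bar>t i\<bar> * \<mu> / 4 + \<bar>t i\<bar> * (real n * Q * A)"
      using n0 by (simp add: field_simps)
    finally show ?thesis .
  qed
  have diag: "\<bar>t i\<bar> * \<mu> / 2 \<le> \<bar>H k (\<sigma> k)\<bar>"
  proof -
    have "H k (\<sigma> k) = t i * \<mu> + (\<Sum>j\<in>{..<n} - {i}. t j * m j k (\<sigma> k))"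
      unfolding H_def \<mu>_def using n by (subst sum.remove[of _ i]) auto
    then have "\<bar>H k (\<sigma> k)\<bar> \<ge> \<bar>t i * \<mu>\<bar> - \<bar>\<Sum>j\<in>{..<n} - {i}. t j * m j k (\<sigma> k)\<bar>" by linarith
    moreover have "\<bar>t i * \<mu>\<bar> = \<bar>t i\<bar> * \<mu>" using mu0 by (simp add: abs_mult)
    moreover have "\<bar>t i\<bar> * (real n * Q * A) \<le> \<bar>t i\<bar> * (\<mu> / 8)" using nQA by (intro mult_left_mono) auto
    moreover have "\<bar>t i\<bar> * (\<mu> / 8) = \<bar>t i\<bar> * \<mu> / 8" by simp
    moreover have "0 \<le> \<bar>t i\<bar> * \<mu>" using mu0 by simp
    ultimately show ?thesis using rest by linarith
  qed
  moreover have "\<bar>t i\<bar> * D / 2 \<le> \<bar>t i\<bar> * \<mu> / 2" using D by (simp add: \<mu>_def mult_left_mono)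
  ultimately show "\<bar>t i\<bar> * D / 2 \<le> \<bar>H k (\<sigma> k)\<bar>" by linarith
  have "(\<Sum>l\<in>K - {\<sigma> k}. \<bar>H k l\<bar>) \<le> (\<Sum>l\<in>K - {\<sigma> k}. \<bar>t i\<bar> * (real n * Q * A))"
  proof (intro sum_mono)
    fix l assume l: "l \<in> K - {\<sigma> k}"
    have "\<bar>H k l\<bar> \<le> (\<Sum>j<n. \<bar>t j * m j k l\<bar>)" unfolding H_def by (rule sum_abs)
    also have "\<dots> \<le> (\<Sum>j<n. (Q * \<bar>t i\<bar>) * A)"
    proof (intro sum_mono)
      fix j assume j: "j \<in> {..<n}"
      then have "\<bar>t j\<bar> * m j k l \<le> (Q * \<bar>t i\<bar>) * A"
        using t(2)[of j] off[of j l] m0[of j l] l Q by (intro mult_mono) auto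
      then show "\<bar>t j * m j k l\<bar> \<le> (Q * \<bar>t i\<bar>) * A" using m0[of j l] j l by (simp add: abs_mult)
    qed
    also have "\<dots> = \<bar>t i\<bar> * (real n * Q * A)" by simp
    finally show "\<bar>H k l\<bar> \<le> \<bar>t i\<bar> * (real n * Q * A)" .
  qed
  also have "\<dots> = card (K - {\<sigma> k}) * (\<bar>t i\<bar> * (real n * Q * A))" by simp
  also have "\<dots> \<le> card K * (\<bar>t i\<bar> * (real n * Q * A))"
    using QA K by (intro mult_right_mono) (auto intro!: card_mono mult_nonneg_nonneg)
  also have "\<dots> = \<bar>t i\<bar> * (card K * (real n * Q * A))" by simp
  also have "\<dots> \<le> \<bar>t i\<bar> * (\<mu> / 8)" using off_small by (intro mult_left_mono) auto
  also have "\<dots> \<le> \<bar>t i\<bar> * \<mu> / 4" using mu0 by (simp add: field_simps)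
  also have "\<dots> \<le> \<bar>H k (\<sigma> k)\<bar> / 2" using diag by linarith
  finally show "(\<Sum>l\<in>K - {\<sigma> k}. \<bar>H k l\<bar>) \<le> \<bar>H k (\<sigma> k)\<bar> / 2" .
qed

section \<open>Size of the Hermite kernel near its singularity\<close>

definition triple_kernel :: "real \<Rightarrow> real \<Rightarrow> real \<Rightarrow> real \<Rightarrow> real" where
  "triple_kernel a u v r = (LINT s:{0..1}|lborel. pos_powr (s - u) a * pos_powr (s - v) a * pos_powr (s - r) a)"

lemma pos_powr_nonneg: "0 \<le> pos_powr x a"
  by (simp add: pos_powr_def)

lemma pos_powr_measurable [measurable]: "(\<lambda>x. pos_powr x a) \<in> borel_measurable borel"
  unfolding pos_powr_def by measurable

lemma pos_powr_antimono: "a \<le> 0 \<Longrightarrow> 0 < x \<Longrightarrow> x \<le> y \<Longrightarrow> pos_powr y a \<le> pos_powr x a"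
  by (simp add: pos_powr_def powr_mono2')

lemma triple_kernel_commute: "triple_kernel a u v r = triple_kernel a v u r"
  by (simp add: triple_kernel_def mult_ac)

context
  fixes a :: real
  assumes a: "-1 < a" "a \<le> 0"
begin

lemma nn_integral_shifted_powr:
  assumes w: "0 \<le> w"
  shows "(\<integral>\<^sup>+s. ennreal (indicator {0..1} s * pos_powr (s - w) a) \<partial>lborel) \<le> ennreal (1 / (a + 1))"
proof -
  have "(\<integral>\<^sup>+s. ennreal (indicator {0..1} s * pos_powr (s - w) a) \<partial>lborel) =
    (\<integral>\<^sup>+x. ennreal (indicator {0..1} (w + 1 * x) * pos_powr (w + 1 * x - w) a) \<partial>lborel)"
    by (subst nn_integral_real_affine[where c = 1 and t = w]) auto
  also have "\<dots> \<le> (\<integral>\<^sup>+x. ennreal (indicator {0..1} x * (x powr a)) \<partial>lborel)"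
    using w by (intro nn_integral_mono) (auto simp: indicator_def pos_powr_def)
  also have "\<dots> = ennreal (1 / (a + 1))"
  proof (rule nn_integral_has_integral_lborel)
    have "((\<lambda>x. x powr a) has_integral 1 powr (a + 1) / (a + 1)) {0..1}"
      using a by (intro has_integral_powr_from_0) auto
    then have "((\<lambda>x. if x \<in> {0..1} then x powr a else 0) has_integral 1 / (a + 1)) UNIV"
      by (subst has_integral_restrict_UNIV) simp
    moreover have "(\<lambda>x. if x \<in> {0..1} then x powr a else 0) = (\<lambda>x. indicator {0..1} x * (x powr a))"
      by (auto simp: indicator_def)
    ultimately show "((\<lambda>x. indicator {0..1} x * (x powr a)) has_integral 1 / (a + 1)) UNIV" by simp
  qed auto
  finally show ?thesis .
qed

lemma shifted_powr_integrable:
  assumes w: "0 \<le> w"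
  shows "set_integrable lborel {0..1} (\<lambda>s. pos_powr (s - w) a)"
    "(LINT s:{0..1}|lborel. pos_powr (s - w) a) \<le> 1 / (a + 1)"
proof -
  have m [measurable]: "(\<lambda>s. indicator {0..1} s * pos_powr (s - w) a) \<in> borel_measurable lborel" by measurable
  show "set_integrable lborel {0..1} (\<lambda>s. pos_powr (s - w) a)"
    unfolding set_integrable_def
  proof (rule integrableI_nonneg)
    show "(\<integral>\<^sup>+s. ennreal (indicator {0..1} s *\<^sub>R pos_powr (s - w) a) \<partial>lborel) < \<infinity>"
      using nn_integral_shifted_powr[OF w] by (auto intro: le_less_trans)
  qed (auto simp: pos_powr_nonneg)
  then have "ennreal (LINT s:{0..1}|lborel. pos_powr (s - w) a) = (\<integral>\<^sup>+s. ennreal (indicator {0..1} s * pos_powr (s - w) a) \<partial>lborel)"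
    unfolding set_lebesgue_integral_def set_integrable_def
    by (subst nn_integral_eq_integral[symmetric]) (auto simp: pos_powr_nonneg)
  also note nn_integral_shifted_powr[OF w]
  finally show "(LINT s:{0..1}|lborel. pos_powr (s - w) a) \<le> 1 / (a + 1)"
    using a by (simp add: ennreal_le_iff)
qed

lemma triple_kernel_nonneg: "0 \<le> triple_kernel a u v r"
  unfolding triple_kernel_def set_lebesgue_integral_def
  by (intro integral_nonneg_AE) (auto simp: pos_powr_nonneg)

lemma triple_kernel_le:
  assumes h: "set_integrable lborel {0..1} h"
    and le: "\<And>s. pos_powr (s - u) a * pos_powr (s - v) a * pos_powr (s - r) a \<le> h s"
  shows "set_integrable lborel {0..1} (\<lambda>s. pos_powr (s - u) a * pos_powr (s - v) a * pos_powr (s - r) a)"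
    "triple_kernel a u v r \<le> (LINT s:{0..1}|lborel. h s)"
proof -
  show 1: "set_integrable lborel {0..1} (\<lambda>s. pos_powr (s - u) a * pos_powr (s - v) a * pos_powr (s - r) a)"
  proof (rule set_integrable_bound[OF h])
    show "AE s in lborel. s \<in> {0..1} \<longrightarrow> norm (pos_powr (s - u) a * pos_powr (s - v) a * pos_powr (s - r) a) \<le> norm (h s)"
    proof (intro AE_I2 impI)
      fix s
      have "0 \<le> pos_powr (s - u) a * pos_powr (s - v) a * pos_powr (s - r) a" by (simp add: pos_powr_nonneg)
      then show "norm (pos_powr (s - u) a * pos_powr (s - v) a * pos_powr (s - r) a) \<le> norm (h s)"
        using le[of s] by simp
    qed
  qed (auto simp: set_borel_measurable_def)
  show "triple_kernel a u v r \<le> (LINT s:{0..1}|lborel. h s)"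
    unfolding triple_kernel_def by (rule set_integral_mono[OF 1 h le])
qed

text \<open>To the right of three points at mutual distance \<open>d\<close>, at least two of them are at distance \<open>d\<close> or more.\<close>

lemma triple_product_separated:
  assumes d: "0 < d" and sep: "d \<le> \<bar>u - v\<bar>" "d \<le> \<bar>u - r\<bar>" "d \<le> \<bar>v - r\<bar>"
  shows "pos_powr (s - u) a * pos_powr (s - v) a * pos_powr (s - r) a \<le>
    d powr (2 * a) * (pos_powr (s - u) a + pos_powr (s - v) a + pos_powr (s - r) a)"
proof (cases "u < s \<and> v < s \<and> r < s")
  case False
  then have "pos_powr (s - u) a * pos_powr (s - v) a * pos_powr (s - r) a = 0"
    by (auto simp: pos_powr_def)
  also have "0 \<le> d powr (2 * a) * (pos_powr (s - u) a + pos_powr (s - v) a + pos_powr (s - r) a)"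
    by (intro mult_nonneg_nonneg add_nonneg_nonneg pos_powr_nonneg powr_ge_zero)
  finally show ?thesis .
next
  case True
  define X Y Z where "X = pos_powr (s - u) a" and "Y = pos_powr (s - v) a" and "Z = pos_powr (s - r) a"
  have nn: "0 \<le> X" "0 \<le> Y" "0 \<le> Z" by (auto simp: X_def Y_def Z_def pos_powr_nonneg)
  have far: "pos_powr (s - w) a \<le> d powr a" if "d \<le> s - w" for w
    using pos_powr_antimono[OF a(2) d that] d by (simp add: pos_powr_def)
  have two: "d powr (2 * a) = d powr a * d powr a" by (simp add: powr_add[symmetric])
  have pair: "x * y \<le> d powr (2 * a)" if "0 \<le> x" "0 \<le> y" "x \<le> d powr a" "y \<le> d powr a" for x y
    unfolding two using that by (intro mult_mono) auto
  consider "d \<le> s - u" "d \<le> s - v" | "d \<le> s - u" "d \<le> s - r" | "d \<le> s - v" "d \<le> s - r"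
    using sep True by linarith
  then have "X * Y \<le> d powr (2 * a) \<or> X * Z \<le> d powr (2 * a) \<or> Y * Z \<le> d powr (2 * a)"
    unfolding X_def Y_def Z_def by cases (auto intro!: pair far pos_powr_nonneg)
  then have "X * Y * Z \<le> d powr (2 * a) * (X + Y + Z)"
  proof (elim disjE)
    assume "X * Y \<le> d powr (2 * a)"
    then have "(X * Y) * Z \<le> d powr (2 * a) * Z" using nn by (intro mult_right_mono)
    also have "\<dots> \<le> d powr (2 * a) * (X + Y + Z)" using nn by (intro mult_left_mono) auto
    finally show ?thesis .
  next
    assume "X * Z \<le> d powr (2 * a)"
    then have "(X * Z) * Y \<le> d powr (2 * a) * Y" using nn by (intro mult_right_mono)
    also have "\<dots> \<le> d powr (2 * a) * (X + Y + Z)" using nn by (intro mult_left_mono) auto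
    finally show ?thesis by (simp add: mult_ac)
  next
    assume "Y * Z \<le> d powr (2 * a)"
    then have "(Y * Z) * X \<le> d powr (2 * a) * X" using nn by (intro mult_right_mono)
    also have "\<dots> \<le> d powr (2 * a) * (X + Y + Z)" using nn by (intro mult_left_mono) auto
    finally show ?thesis by (simp add: mult_ac)
  qed
  then show ?thesis by (simp add: X_def Y_def Z_def)
qed

lemma triple_kernel_separated:
  assumes d: "0 < d" and sep: "d \<le> \<bar>u - v\<bar>" "d \<le> \<bar>u - r\<bar>" "d \<le> \<bar>v - r\<bar>"
    and nn: "0 \<le> u" "0 \<le> v" "0 \<le> r"
  shows "set_integrable lborel {0..1} (\<lambda>s. pos_powr (s - u) a * pos_powr (s - v) a * pos_powr (s - r) a)"
    "triple_kernel a u v r \<le> 3 * d powr (2 * a) / (a + 1)"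
proof -
  let ?h = "\<lambda>s. d powr (2 * a) * (pos_powr (s - u) a + pos_powr (s - v) a + pos_powr (s - r) a)"
  note i = shifted_powr_integrable(1)[OF nn(1)] shifted_powr_integrable(1)[OF nn(2)] shifted_powr_integrable(1)[OF nn(3)]
  have i2: "set_integrable lborel {0..1} (\<lambda>s. pos_powr (s - u) a + pos_powr (s - v) a)"
    by (intro set_integral_add(1) i)
  have i3: "set_integrable lborel {0..1} (\<lambda>s. pos_powr (s - u) a + pos_powr (s - v) a + pos_powr (s - r) a)"
    by (intro set_integral_add(1) i i2)
  have h: "set_integrable lborel {0..1} ?h" by (intro set_integrable_mult_right i3)
  note t = triple_kernel_le[OF h triple_product_separated[OF d sep]]
  show "set_integrable lborel {0..1} (\<lambda>s. pos_powr (s - u) a * pos_powr (s - v) a * pos_powr (s - r) a)" by (rule t)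
  have "triple_kernel a u v r \<le> (LINT s:{0..1}|lborel. ?h s)" by (rule t)
  also have "\<dots> = d powr (2 * a) * ((LINT s:{0..1}|lborel. pos_powr (s - u) a) + (LINT s:{0..1}|lborel. pos_powr (s - v) a) +
     (LINT s:{0..1}|lborel. pos_powr (s - r) a))"
    by (subst set_integral_mult_right) (simp add: set_integral_add(2)[OF i2 i(3)] set_integral_add(2)[OF i(1,2)])
  also have "\<dots> \<le> d powr (2 * a) * (1 / (a + 1) + 1 / (a + 1) + 1 / (a + 1))"
    using nn by (intro mult_left_mono add_mono shifted_powr_integrable(2)) auto
  finally show "triple_kernel a u v r \<le> 3 * d powr (2 * a) / (a + 1)" by (simp add: mult.commute)
qed

text \<open>Only \<open>s > r\<close> contributes, where the factors of \<open>u\<close> and \<open>v\<close> are bounded; \<open>u\<close> and \<open>v\<close> may be arbitrarily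
close to each other.\<close>

lemma triple_kernel_late:
  assumes d: "0 < d" and sep: "u + d \<le> r" "v + d \<le> r" and nn: "0 \<le> r"
  shows "triple_kernel a u v r \<le> 3 * d powr (2 * a) / (a + 1)"
proof -
  have h: "set_integrable lborel {0..1} (\<lambda>s. d powr (2 * a) * pos_powr (s - r) a)"
    by (intro set_integrable_mult_right shifted_powr_integrable nn)
  have le: "pos_powr (s - u) a * pos_powr (s - v) a * pos_powr (s - r) a \<le> d powr (2 * a) * pos_powr (s - r) a" for s
  proof (cases "r < s")
    case True
    have far: "pos_powr (s - w) a \<le> d powr a" if "w + d \<le> r" for w
      using pos_powr_antimono[OF a(2) d, of "s - w"] d that True by (simp add: pos_powr_def)
    have "pos_powr (s - u) a * pos_powr (s - v) a \<le> d powr a * d powr a"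
      by (intro mult_mono far sep) (auto simp: pos_powr_nonneg)
    also have "\<dots> = d powr (2 * a)" by (simp add: powr_add[symmetric])
    finally show ?thesis by (intro mult_right_mono) (auto simp: pos_powr_nonneg)
  qed (simp add: pos_powr_def)
  have "triple_kernel a u v r \<le> (LINT s:{0..1}|lborel. d powr (2 * a) * pos_powr (s - r) a)"
    by (rule triple_kernel_le(2)[OF h le])
  also have "\<dots> = d powr (2 * a) * (LINT s:{0..1}|lborel. pos_powr (s - r) a)" by simp
  also have "\<dots> \<le> d powr (2 * a) * (1 / (a + 1))"
    using nn by (intro mult_left_mono shifted_powr_integrable(2)) auto
  also have "\<dots> \<le> 3 * d powr (2 * a) / (a + 1)"
    using a by (simp add: divide_right_mono)
  finally show ?thesis .
qed

lemma triple_product_integrable: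
  assumes "u \<noteq> v" "u \<noteq> r" "v \<noteq> r" "0 \<le> u" "0 \<le> v" "0 \<le> r"
  shows "set_integrable lborel {0..1} (\<lambda>s. pos_powr (s - u) a * pos_powr (s - v) a * pos_powr (s - r) a)"
  by (rule triple_kernel_separated(1)[where d = "Min {\<bar>u - v\<bar>, \<bar>u - r\<bar>, \<bar>v - r\<bar>}"]) (use assms in auto)

lemma triple_kernel_mono:
  assumes r: "r \<le> r'" "r' < u" and neq: "u \<noteq> v" "v \<noteq> r'" and nn: "0 \<le> r'" "0 \<le> u" "0 \<le> v"
  shows "triple_kernel a u v r \<le> triple_kernel a u v r'"
  unfolding triple_kernel_def[of a u v r']
proof (rule triple_kernel_le(2))
  show "set_integrable lborel {0..1} (\<lambda>s. pos_powr (s - u) a * pos_powr (s - v) a * pos_powr (s - r') a)"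
    using assms by (intro triple_product_integrable) auto
  show "pos_powr (s - u) a * pos_powr (s - v) a * pos_powr (s - r) a \<le> pos_powr (s - u) a * pos_powr (s - v) a * pos_powr (s - r') a" for s
  proof (cases "u < s")
    case True
    then show ?thesis using r a by (intro mult_left_mono pos_powr_antimono) (auto simp: pos_powr_nonneg)
  qed (simp add: pos_powr_def)
qed

text \<open>On the interval of length \<open>h\<close> to the right of \<open>v\<close> the three factors are at least \<open>(3 h) powr a\<close>, \<open>h powr a\<close> and \<open>1\<close>.
For \<open>a < - 1 / 2\<close> the exponent \<open>2 * a + 1\<close> is negative, and the bound tends to infinity as \<open>h\<close> tends to \<open>0\<close>.\<close>

lemma triple_kernel_lower:
  assumes h: "0 < h" and ord: "0 \<le> r" "r < u" "u < v" "v \<le> u + 2 * h" "v + h \<le> 1"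
  shows "3 powr a * h powr (2 * a + 1) \<le> triple_kernel a u v r"
proof -
  have int: "set_integrable lborel {0..1} (\<lambda>s. pos_powr (s - u) a * pos_powr (s - v) a * pos_powr (s - r) a)"
    using ord by (intro triple_product_integrable) auto
  let ?S = "{v<..v + h}"
  have "3 powr a * h powr (2 * a + 1) = h * ((3 * h) powr a * h powr a)"
    using h by (simp add: powr_mult powr_add mult.commute[of 2] powr_add[of h a a, symmetric] mult_2_right[symmetric])
  also have "\<dots> = (LINT s:?S|lborel. (3 * h) powr a * h powr a)"
    using h by (simp add: set_lebesgue_integral_def)
  also have "\<dots> \<le> (LINT s:?S|lborel. pos_powr (s - u) a * pos_powr (s - v) a * pos_powr (s - r) a)"
  proof (rule set_integral_mono)
    show "set_integrable lborel ?S (\<lambda>s. (3 * h) powr a * h powr a)"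
      unfolding set_integrable_def using h by (intro integrable_scaleR_left integrable_real_indicator) auto
    show "set_integrable lborel ?S (\<lambda>s. pos_powr (s - u) a * pos_powr (s - v) a * pos_powr (s - r) a)"
      by (rule set_integrable_subset[OF int]) (use ord in auto)
    fix s assume s: "s \<in> ?S"
    have 1: "(3 * h) powr a \<le> pos_powr (s - u) a"
      using s ord h a by (auto simp: pos_powr_def intro!: powr_mono2')
    have 2: "h powr a \<le> pos_powr (s - v) a"
      using s ord h a by (auto simp: pos_powr_def intro!: powr_mono2')
    have 3: "1 \<le> pos_powr (s - r) a"
    proof -
      have "1 powr a \<le> (s - r) powr a" using s ord h a by (intro powr_mono2') auto
      then show ?thesis using s ord by (simp add: pos_powr_def)
    qed
    have "((3 * h) powr a * h powr a) * 1 \<le> (pos_powr (s - u) a * pos_powr (s - v) a) * pos_powr (s - r) a"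
      using 1 2 3 by (intro mult_mono) (auto simp: pos_powr_nonneg)
    then show "(3 * h) powr a * h powr a \<le> pos_powr (s - u) a * pos_powr (s - v) a * pos_powr (s - r) a" by simp
  qed
  also have "\<dots> \<le> triple_kernel a u v r"
    unfolding triple_kernel_def set_lebesgue_integral_def
  proof (rule integral_mono)
    show "integrable lborel (\<lambda>s. indicat_real ?S s *\<^sub>R (pos_powr (s - u) a * pos_powr (s - v) a * pos_powr (s - r) a))"
    proof -
      have "?S \<subseteq> {0..1}" using ord by auto
      then show ?thesis using set_integrable_subset[OF int, of ?S] by (simp add: set_integrable_def)
    qed
    show "integrable lborel (\<lambda>s. indicat_real {0..1} s *\<^sub>R (pos_powr (s - u) a * pos_powr (s - v) a * pos_powr (s - r) a))"
      using int by (simp add: set_integrable_def)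
    show "indicat_real ?S s *\<^sub>R (pos_powr (s - u) a * pos_powr (s - v) a * pos_powr (s - r) a) \<le>
      indicat_real {0..1} s *\<^sub>R (pos_powr (s - u) a * pos_powr (s - v) a * pos_powr (s - r) a)" for s
      using ord by (intro scaleR_right_mono mult_nonneg_nonneg pos_powr_nonneg) (auto simp: indicator_def)
  qed
  finally show ?thesis .
qed

end

section \<open>The kernel tested on pairs of small intervals\<close>

text \<open>Each cell is the first half of its interval in the division of \<open>[0, 1]\<close> into \<open>N\<close> parts, which keeps
different cells apart.\<close>

definition cell :: "nat \<Rightarrow> nat \<Rightarrow> real set" where
  "cell N m = {real m / real N .. real m / real N + 1 / (2 * real N)}"

lemma cell_separated:
  assumes "0 < N" "m < m'" "u \<in> cell N m" "v \<in> cell N m'"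
  shows "u + 1 / (2 * real N) \<le> v"
proof -
  have "real (m + 1) / real N \<le> real m' / real N"
    using assms by (intro divide_right_mono) auto
  then have "real m / real N + 1 / real N \<le> real m' / real N" by (simp add: add_divide_distrib)
  moreover have "1 / real N = 1 / (2 * real N) + 1 / (2 * real N)" by simp
  ultimately show ?thesis using assms(3,4) unfolding cell_def atLeastAtMost_iff by linarith
qed

lemma cell_bounds:
  assumes "m < N" "u \<in> cell N m"
  shows "0 \<le> u" "u + 1 / (2 * real N) \<le> 1"
proof -
  have "real (m + 1) / real N \<le> real N / real N" using assms by (intro divide_right_mono) auto
  then have "real m / real N + 1 / real N \<le> 1" using assms by (simp add: add_divide_distrib)
  moreover have "1 / real N = 1 / (2 * real N) + 1 / (2 * real N)" by simp
  ultimately show "u + 1 / (2 * real N) \<le> 1" using assms(2) unfolding cell_def atLeastAtMost_iff by linarith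
  have "0 \<le> real m / real N" by simp
  then show "0 \<le> u" using assms unfolding cell_def by (meson atLeastAtMost_iff order.trans)
qed

text \<open>The pair with number \<open>p\<close> of a cluster consists of the adjacent intervals \<open>Inl p\<close> and \<open>Inr p\<close> at the beginning
of the cell \<open>b + p\<close>.\<close>

definition slot :: "nat \<Rightarrow> real \<Rightarrow> nat \<Rightarrow> nat + nat \<Rightarrow> real set" where
  "slot N h b k = (case k of
      Inl p \<Rightarrow> {real (b + p) / real N ..< real (b + p) / real N + h}
    | Inr p \<Rightarrow> {real (b + p) / real N + h ..< real (b + p) / real N + 2 * h})"

definition bump :: "nat \<Rightarrow> real \<Rightarrow> nat \<Rightarrow> nat + nat \<Rightarrow> real \<Rightarrow> real" where
  "bump N h b k x = indicator (slot N h b k) x / sqrt h"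

lemma slot_sets [measurable]: "slot N h b k \<in> sets lborel"
  by (auto simp: slot_def split: sum.split)

lemma measure_slot: "0 < h \<Longrightarrow> measure lborel (slot N h b k) = h" "emeasure lborel (slot N h b k) < \<infinity>"
proof -
  show "measure lborel (slot N h b k) = h" if "0 < h"
    using that by (auto simp: slot_def split: sum.split)
  have "bounded (slot N h b k)"
    by (auto simp: slot_def intro: bounded_subset[OF bounded_cbox[of "_ :: real"]] split: sum.split)
  then show "emeasure lborel (slot N h b k) < \<infinity>" by (rule emeasure_bounded_finite)
qed

lemma slot_cell:
  assumes "0 < h" "h \<le> 1 / (8 * real N)" "x \<in> slot N h b k"
  shows "x \<in> cell N (b + (case k of Inl p \<Rightarrow> p | Inr p \<Rightarrow> p))"
proof -
  have "2 * h \<le> 1 / (2 * real N)" using assms(1,2) by simp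
  then show ?thesis using assms(1,3) by (auto simp: slot_def cell_def split: sum.splits)
qed

lemma slot_order: "u \<in> slot N h b (Inl p) \<Longrightarrow> v \<in> slot N h b (Inr p) \<Longrightarrow> u < v \<and> v \<le> u + 2 * h"
  by (auto simp: slot_def)

lemma slot_disjoint:
  assumes N: "0 < N" and h: "0 < h" "h \<le> 1 / (8 * real N)" and "k \<noteq> l"
  shows "slot N h b k \<inter> slot N h b l = {}"
proof (rule ccontr)
  assume "slot N h b k \<inter> slot N h b l \<noteq> {}"
  then obtain x where x: "x \<in> slot N h b k" "x \<in> slot N h b l" by auto
  let ?p = "\<lambda>k. case k of Inl p \<Rightarrow> p | Inr p \<Rightarrow> (p :: nat)"
  have pos: "0 < 1 / (2 * real N)" using N by simp
  have "?p k = ?p l"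
  proof (rule ccontr)
    assume "?p k \<noteq> ?p l"
    then consider "b + ?p k < b + ?p l" | "b + ?p l < b + ?p k" by linarith
    then show False
      using cell_separated[OF N _ slot_cell[OF h x(1)] slot_cell[OF h x(2)]]
        cell_separated[OF N _ slot_cell[OF h x(2)] slot_cell[OF h x(1)]] pos by cases auto
  qed
  then show False using x \<open>k \<noteq> l\<close> by (auto simp: slot_def split: sum.splits)
qed

lemma bump_L2: "bump N h b k \<in> L2 lborel"
proof -
  have "(\<lambda>x. (1 / sqrt h) * indicator (slot N h b k) x) \<in> L2 lborel"
    by (intro L2_scale L2_indicator slot_sets measure_slot)
  then show ?thesis by (simp add: bump_def[abs_def])
qed

lemma bump_orthonormal:
  assumes "0 < N" "0 < h" "h \<le> 1 / (8 * real N)"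
  shows "inner_L2 lborel (bump N h b k) (bump N h b l) = (if k = l then 1 else 0)"
proof -
  have "inner_L2 lborel (bump N h b k) (bump N h b l) =
    (LINT x|lborel. (1 / h) * (indicator (slot N h b k) x * indicator (slot N h b l) x))"
    using assms by (intro Bochner_Integration.integral_cong) (auto simp: bump_def)
  also have "\<dots> = (1 / h) * measure lborel (slot N h b k \<inter> slot N h b l)"
    by (subst integral_mult_right_zero) (simp only: inner_L2_indicator slot_sets)
  also have "\<dots> = (if k = l then 1 else 0)"
    using assms slot_disjoint[of N h k l b] by (simp add: measure_slot)
  finally show ?thesis .
qed

lemma bump_nonneg: "0 < h \<Longrightarrow> 0 \<le> bump N h b k x"
  by (simp add: bump_def)

abbreviation bump2 :: "nat \<Rightarrow> real \<Rightarrow> nat \<Rightarrow> nat + nat \<Rightarrow> nat + nat \<Rightarrow> (nat \<Rightarrow> real) \<Rightarrow> real" where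
  "bump2 N h b k l \<equiv> \<lambda>y. bump N h b k (y 0) * bump N h b l (y 1)"

lemma bump2_L2: "bump2 N h b k l \<in> L2 (lborel_pow 2)"
  using L2_product[of 2 "\<lambda>i. if i = 0 then bump N h b k else bump N h b l"] bump_L2
  by (simp add: prod_lessThan_2)

lemma bump2_integral:
  assumes "0 < h"
  shows "integrable (lborel_pow 2) (bump2 N h b k l)" "(LINT y|lborel_pow 2. bump2 N h b k l y) = h"
proof -
  have i: "integrable lborel (bump N h b k)" for k
    unfolding bump_def[abs_def] by (intro integrable_divide integrable_real_indicator slot_sets measure_slot)
  have v: "(LINT x|lborel. bump N h b k x) = sqrt h" for k
    using assms by (simp add: bump_def measure_slot real_div_sqrt)
  let ?f = "\<lambda>i::nat. if i = 0 then bump N h b k else bump N h b l"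
  show "integrable (lborel_pow 2) (bump2 N h b k l)"
    using lborel_product.product_integrable_prod[of "{..<2}" ?f] i by (simp add: prod_lessThan_2)
  have "(LINT y|lborel_pow 2. bump2 N h b k l y) = (LINT y|lborel_pow 2. (\<Prod>i\<in>{..<2}. ?f i (y i)))"
    by (simp add: prod_lessThan_2)
  also have "\<dots> = (\<Prod>i\<in>{..<2}. integral\<^sup>L lborel (?f i))"
    using i by (intro lborel_product.product_integral_prod) auto
  also have "\<dots> = h" using assms by (simp add: prod_lessThan_2 v)
  finally show "(LINT y|lborel_pow 2. bump2 N h b k l y) = h" .
qed

lemma inner_bump2_mono:
  assumes h: "0 < h" and f: "integrable (lborel_pow 2) (\<lambda>y. f y * bump2 N h b k l y)"
    "integrable (lborel_pow 2) (\<lambda>y. g y * bump2 N h b k l y)"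
    and le: "\<And>y. y 0 \<in> slot N h b k \<Longrightarrow> y 1 \<in> slot N h b l \<Longrightarrow> f y \<le> g y"
  shows "inner_L2 (lborel_pow 2) f (bump2 N h b k l) \<le> inner_L2 (lborel_pow 2) g (bump2 N h b k l)"
proof (rule integral_mono[OF f])
  fix y :: "nat \<Rightarrow> real"
  show "f y * bump2 N h b k l y \<le> g y * bump2 N h b k l y"
  proof (cases "y 0 \<in> slot N h b k \<and> y 1 \<in> slot N h b l")
    case True
    then show ?thesis using le h by (intro mult_right_mono) (auto simp: bump_nonneg)
  qed (auto simp: bump_def)
qed

lemma inner_bump2_bounds:
  assumes h: "0 < h" and f: "f \<in> L2 (lborel_pow 2)"
  shows "(\<And>y. y 0 \<in> slot N h b k \<Longrightarrow> y 1 \<in> slot N h b l \<Longrightarrow> f y \<le> C) \<Longrightarrow> inner_L2 (lborel_pow 2) f (bump2 N h b k l) \<le> C * h"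
    "(\<And>y. y 0 \<in> slot N h b k \<Longrightarrow> y 1 \<in> slot N h b l \<Longrightarrow> C \<le> f y) \<Longrightarrow> C * h \<le> inner_L2 (lborel_pow 2) f (bump2 N h b k l)"
proof -
  have i: "integrable (lborel_pow 2) (\<lambda>y. f y * bump2 N h b k l y)" by (rule L2_integrable_mult[OF f bump2_L2])
  have c: "integrable (lborel_pow 2) (\<lambda>y. C * bump2 N h b k l y)" by (intro integrable_mult_right bump2_integral h)
  have v: "inner_L2 (lborel_pow 2) (\<lambda>_. C) (bump2 N h b k l) = C * h"
    by (subst integral_mult_right_zero) (simp only: bump2_integral[OF h])
  show "(\<And>y. y 0 \<in> slot N h b k \<Longrightarrow> y 1 \<in> slot N h b l \<Longrightarrow> f y \<le> C) \<Longrightarrow> inner_L2 (lborel_pow 2) f (bump2 N h b k l) \<le> C * h"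
    using inner_bump2_mono[OF h i c] unfolding v .
  show "(\<And>y. y 0 \<in> slot N h b k \<Longrightarrow> y 1 \<in> slot N h b l \<Longrightarrow> C \<le> f y) \<Longrightarrow> C * h \<le> inner_L2 (lborel_pow 2) f (bump2 N h b k l)"
    using inner_bump2_mono[OF h c i] unfolding v .
qed

lemma hermite_kernel_3_section:
  "hermite_kernel 3 H c 1 (y(2 := r)) = c * triple_kernel ((H - 1) / 3 - 1 / 2) (y 0) (y 1) r"
  by (simp add: hermite_kernel_def triple_kernel_def prod_lessThan_3 Let_def)

lemma hermite_kernel_symmetric: "symmetric_kernel q (hermite_kernel q H c t)"
proof -
  have "(\<Prod>j<q. pos_powr (s - (x \<circ> \<pi>) j) e) = (\<Prod>j<q. pos_powr (s - x j) e)"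
    if "\<pi> permutes {..<q}" for \<pi> s e and x :: "nat \<Rightarrow> real"
    using prod.permute[OF that, of "\<lambda>j. pos_powr (s - x j) e"] by (simp add: o_def)
  then show ?thesis by (simp add: symmetric_kernel_def hermite_kernel_def Let_def)
qed

text \<open>The index maximizes \<open>\<bar>t j\<bar> / (4 * real n) ^ j\<close>.\<close>

lemma exists_dominant_index:
  fixes t :: "nat \<Rightarrow> real"
  assumes n: "0 < n"
  obtains i where "i < n" "\<And>j. j < i \<Longrightarrow> \<bar>t j\<bar> \<le> \<bar>t i\<bar> / (4 * real n)"
    "\<And>j. j < n \<Longrightarrow> \<bar>t j\<bar> \<le> (4 * real n) ^ n * \<bar>t i\<bar>"
proof -
  define w where "w j = \<bar>t j\<bar> / (4 * real n) ^ j" for j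
  have b: "1 \<le> 4 * real n" using n by simp
  have "Max (w ` {..<n}) \<in> w ` {..<n}" using n by (intro Max_in) auto
  then obtain i where i: "i < n" "Max (w ` {..<n}) = w i" by auto
  have max: "w j \<le> w i" if "j < n" for j
    using that i(2) Max_ge[of "w ` {..<n}" "w j"] by simp
  show ?thesis
  proof (rule that[OF i(1)])
    fix j
    have pos: "0 < (4 * real n) ^ k" for k using n by simp
    have le: "\<bar>t j\<bar> \<le> (4 * real n) ^ j / (4 * real n) ^ i * \<bar>t i\<bar>" if "j < n"
      using max[OF that] pos[of j] pos[of i] by (simp add: w_def field_simps)
    show "\<bar>t j\<bar> \<le> \<bar>t i\<bar> / (4 * real n)" if "j < i"
    proof -
      have "(4 * real n) ^ j / (4 * real n) ^ i = 1 / (4 * real n) ^ (i - j)"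
        using that b by (simp add: power_diff)
      also have "\<dots> \<le> 1 / (4 * real n) ^ 1"
        using that b pos by (intro divide_left_mono power_increasing mult_pos_pos) auto
      finally have "(4 * real n) ^ j / (4 * real n) ^ i * \<bar>t i\<bar> \<le> 1 / (4 * real n) ^ 1 * \<bar>t i\<bar>"
        by (intro mult_right_mono) auto
      with le that i show ?thesis by simp
    qed
    show "\<bar>t j\<bar> \<le> (4 * real n) ^ n * \<bar>t i\<bar>" if "j < n"
    proof -
      have "(4 * real n) ^ j / (4 * real n) ^ i \<le> (4 * real n) ^ j / 1"
        using b pos by (intro divide_left_mono one_le_power) auto
      also have "\<dots> \<le> (4 * real n) ^ n" using b that by (simp only: div_by_1) (intro power_increasing; simp)
      finally have "(4 * real n) ^ j / (4 * real n) ^ i * \<bar>t i\<bar> \<le> (4 * real n) ^ n * \<bar>t i\<bar>"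
        by (intro mult_right_mono) auto
      with le[OF that] show ?thesis by linarith
    qed
  qed
qed

text \<open>The cells are grouped into blocks of \<open>P + 1\<close> consecutive ones. The first cell of block \<open>i\<close> is the range of the
point \<open>r i\<close>, the others contain the pairs of the cluster that tests the section at \<open>r i\<close>.\<close>

definition cluster_start :: "nat \<Rightarrow> nat \<Rightarrow> nat" where
  "cluster_start P i = i * (P + 1) + 1"

text \<open>The matrices of the sections at \<open>r j\<close>, tested on the cluster \<open>i\<close>, satisfy the hypotheses of
\<open>triangular_dominance\<close>. Different pairs lie in different cells, so that all three points are separated off the
diagonal. On the diagonal the two intervals are adjacent: there the kernel is bounded if \<open>r j\<close> lies to the right of
the cluster, and grows with \<open>r j\<close> as long as \<open>r j\<close> lies to its left.\<close>

lemma kernel_matrix_bounds: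
  fixes H c h :: real and n P N :: nat
  assumes H: "1 / 2 < H" "H < 1" and c: "0 < c" and N: "N = n * (P + 1)"
    and h: "0 < h" "h \<le> 1 / (8 * real N)"
    and r: "\<And>j. j < n \<Longrightarrow> r j \<in> cell N (j * (P + 1))"
    and L: "\<And>j. j < n \<Longrightarrow> (\<lambda>y. hermite_kernel 3 H c 1 (y(2 := r j))) \<in> L2 (lborel_pow 2)"
    and i: "i < n" and p: "p < P"
  defines "a \<equiv> (H - 1) / 3 - 1 / 2"
  defines "A \<equiv> 3 * (1 / (2 * real N)) powr (2 * a) / (a + 1)"
  defines "m \<equiv> \<lambda>j k l. inner_L2 (lborel_pow 2) (\<lambda>y. hermite_kernel 3 H c 1 (y(2 := r j))) (bump2 N h (cluster_start P i) k l)
     + inner_L2 (lborel_pow 2) (\<lambda>y. hermite_kernel 3 H c 1 (y(2 := r j))) (bump2 N h (cluster_start P i) l k)"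
  shows "j < n \<Longrightarrow> 0 \<le> m j k l"
    and "j < i \<Longrightarrow> m j (Inl p) (Inr p) \<le> m i (Inl p) (Inr p)"
    and "i < j \<Longrightarrow> j < n \<Longrightarrow> m j (Inl p) (Inr p) \<le> 2 * (c * A * h)"
    and "j < n \<Longrightarrow> q < P \<Longrightarrow> q \<noteq> p \<Longrightarrow> m j (Inl p) (Inr q) \<le> 2 * (c * A * h)"
    and "2 * (c * (3 powr a * h powr (2 * a + 1)) * h) \<le> m i (Inl p) (Inr p)"
proof -
  have "a = H / 3 - 5 / 6" by (simp add: a_def field_simps)
  then have a: "-1 < a" "a \<le> 0" using H by linarith+
  have N0: "0 < N" using i N by simp
  define d where "d = 1 / (2 * real N)"
  have d: "0 < d" using N0 by (simp add: d_def)
  have h8: "4 * h \<le> d" using h by (simp add: d_def field_simps)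
  let ?b = "cluster_start P i"
  let ?L = "\<lambda>j y. hermite_kernel 3 H c 1 (y(2 := r j))"
  have Leq: "?L j y = c * triple_kernel a (y 0) (y 1) (r j)" for j y
    unfolding a_def by (rule hermite_kernel_3_section)
  have sc: "x \<in> cell N (?b + q)" if "x \<in> slot N h ?b (Inl q) \<or> x \<in> slot N h ?b (Inr q)" for x q
    using that slot_cell[OF h, of x ?b "Inl q"] slot_cell[OF h, of x ?b "Inr q"] by auto
  have idx: "?b + q < N" if "q < P" for q
  proof -
    have "?b + q < (i + 1) * (P + 1)" using that by (simp add: cluster_start_def)
    also have "\<dots> \<le> n * (P + 1)" using i by (intro mult_le_mono1) auto
    finally show ?thesis using N by simp
  qed
  have ridx: "j * (P + 1) < N" if "j < n" for j
    unfolding N using that by (intro mult_strict_right_mono) auto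
  have rpos: "0 \<le> r j" if "j < n" for j using cell_bounds(1)[OF ridx r] that by auto
  have upos: "0 \<le> x" "x + d \<le> 1" if "x \<in> cell N (?b + q)" "q < P" for x q
    using cell_bounds[OF idx[OF that(2)] that(1)] by (auto simp: d_def)
  have early: "r j + d \<le> x" if "j \<le> i" "x \<in> cell N (?b + q)" for j x q
  proof -
    have "j * (P + 1) < ?b + q" using that(1) mult_le_mono1[OF that(1), of "P + 1"] by (simp add: cluster_start_def)
    from cell_separated[OF N0 this r that(2)] show ?thesis using that i by (auto simp: d_def)
  qed
  have late: "x + d \<le> r j" if "i < j" "j < n" "x \<in> cell N (?b + q)" "q < P" for j x q
  proof -
    have "?b + q < (i + 1) * (P + 1)" using that by (simp add: cluster_start_def)
    also have "\<dots> \<le> j * (P + 1)" using that by (intro mult_le_mono1) auto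
    finally show ?thesis using cell_separated[OF N0 _ that(3) r[OF that(2)]] by (simp add: d_def)
  qed
  have rsep: "d \<le> \<bar>x - r j\<bar>" if "j < n" "x \<in> cell N (?b + q)" "q < P" for j x q
    using early[OF _ that(2), of j] late[OF _ that] by (cases "j \<le> i") auto
  have ppsep: "d \<le> \<bar>x - y\<bar>" if "x \<in> cell N (?b + q)" "y \<in> cell N (?b + q')" "q \<noteq> q'" for x y q q'
    using cell_separated[OF N0 _ that(1,2)] cell_separated[OF N0 _ that(2,1)] that(3)
    by (cases "q < q'") (auto simp: d_def)
  have int: "integrable (lborel_pow 2) (\<lambda>y. ?L j y * bump2 N h ?b k l y)" if "j < n" for j k l
    by (rule L2_integrable_mult[OF L[OF that] bump2_L2])
  show "0 \<le> m j k l" if "j < n" for j k l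
  proof -
    have "0 * h \<le> inner_L2 (lborel_pow 2) (?L j) (bump2 N h ?b k l)" for k l
      using c a by (intro inner_bump2_bounds(2)[OF h(1) L[OF that]]) (simp add: Leq triple_kernel_nonneg)
    then show ?thesis unfolding m_def by simp
  qed
  show "m j (Inl p) (Inr p) \<le> m i (Inl p) (Inr p)" if "j < i" for j
  proof -
    have j: "j < n" using that i by simp
    have T: "triple_kernel a u v (r j) \<le> triple_kernel a u v (r i)"
      if "u \<in> slot N h ?b (Inl p)" "v \<in> slot N h ?b (Inr p)" for u v
    proof -
      have uv: "u \<in> cell N (?b + p)" "v \<in> cell N (?b + p)" using sc that by auto
      have "r j \<le> r i"
      proof -
        have "j * (P + 1) < i * (P + 1)" using \<open>j < i\<close> by (intro mult_strict_right_mono) auto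
        from cell_separated[OF N0 this r[OF j] r[OF i]] d show ?thesis unfolding d_def[symmetric] by linarith
      qed
      then show ?thesis
        using early[of i, OF _ uv(1)] early[of i, OF _ uv(2)] d slot_order[OF that] rpos[OF i] upos[OF uv(1) p] upos[OF uv(2) p]
        by (intro triple_kernel_mono a) auto
    qed
    have T': "triple_kernel a v u (r j) \<le> triple_kernel a v u (r i)"
      if "u \<in> slot N h ?b (Inl p)" "v \<in> slot N h ?b (Inr p)" for u v
      using T[OF that] by (simp add: triple_kernel_commute[of a v u])
    have "inner_L2 (lborel_pow 2) (?L j) (bump2 N h ?b (Inl p) (Inr p)) \<le> inner_L2 (lborel_pow 2) (?L i) (bump2 N h ?b (Inl p) (Inr p))"
      by (rule inner_bump2_mono[OF h(1) int[OF j] int[OF i]]) (use c T in \<open>simp add: Leq\<close>)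
    moreover have "inner_L2 (lborel_pow 2) (?L j) (bump2 N h ?b (Inr p) (Inl p)) \<le> inner_L2 (lborel_pow 2) (?L i) (bump2 N h ?b (Inr p) (Inl p))"
      by (rule inner_bump2_mono[OF h(1) int[OF j] int[OF i]]) (use c T' in \<open>simp add: Leq\<close>)
    ultimately show ?thesis unfolding m_def by (rule add_mono)
  qed
  have upper: "m j (Inl p) (Inr q) \<le> 2 * (c * A * h)"
    if j: "j < n" and T: "\<And>u v. u \<in> slot N h ?b (Inl p) \<Longrightarrow> v \<in> slot N h ?b (Inr q) \<Longrightarrow> triple_kernel a u v (r j) \<le> A" for j q
  proof -
    have T': "triple_kernel a v u (r j) \<le> A" if "u \<in> slot N h ?b (Inl p)" "v \<in> slot N h ?b (Inr q)" for u v
      using T[OF that] by (simp add: triple_kernel_commute[of a v u])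
    have "inner_L2 (lborel_pow 2) (?L j) (bump2 N h ?b (Inl p) (Inr q)) \<le> (c * A) * h"
      using c by (intro inner_bump2_bounds(1)[OF h(1) L[OF j]]) (simp add: Leq T)
    moreover have "inner_L2 (lborel_pow 2) (?L j) (bump2 N h ?b (Inr q) (Inl p)) \<le> (c * A) * h"
      using c by (intro inner_bump2_bounds(1)[OF h(1) L[OF j]]) (simp add: Leq T')
    ultimately show ?thesis unfolding m_def by simp
  qed
  show "m j (Inl p) (Inr p) \<le> 2 * (c * A * h)" if "i < j" "j < n" for j
  proof (rule upper[OF that(2)])
    fix u v assume "u \<in> slot N h ?b (Inl p)" "v \<in> slot N h ?b (Inr p)"
    then have "u \<in> cell N (?b + p)" "v \<in> cell N (?b + p)" using sc by auto
    then show "triple_kernel a u v (r j) \<le> A"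
      unfolding A_def d_def[symmetric] using late that p d rpos by (intro triple_kernel_late a) auto
  qed
  show "m j (Inl p) (Inr q) \<le> 2 * (c * A * h)" if "j < n" "q < P" "q \<noteq> p" for j q
  proof (rule upper[OF that(1)])
    fix u v assume "u \<in> slot N h ?b (Inl p)" "v \<in> slot N h ?b (Inr q)"
    then have uv: "u \<in> cell N (?b + p)" "v \<in> cell N (?b + q)" using sc by auto
    show "triple_kernel a u v (r j) \<le> A"
      unfolding A_def d_def[symmetric]
      using rsep[OF that(1) uv(1) p] rsep[OF that(1) uv(2) that(2)] ppsep[OF uv] that(3)
        upos(1)[OF uv(1) p] upos(1)[OF uv(2) that(2)] rpos[OF that(1)] d
      by (intro triple_kernel_separated(2) a) auto
  qed
  show "2 * (c * (3 powr a * h powr (2 * a + 1)) * h) \<le> m i (Inl p) (Inr p)"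
  proof -
    have T: "3 powr a * h powr (2 * a + 1) \<le> triple_kernel a u v (r i)"
      if "u \<in> slot N h ?b (Inl p)" "v \<in> slot N h ?b (Inr p)" for u v
    proof -
      have uv: "u \<in> cell N (?b + p)" "v \<in> cell N (?b + p)" using sc that by auto
      show ?thesis
        using early[of i, OF _ uv(1)] d slot_order[OF that] rpos[OF i] upos[OF uv(2) p] h8 h
        by (intro triple_kernel_lower a) auto
    qed
    have T': "3 powr a * h powr (2 * a + 1) \<le> triple_kernel a v u (r i)"
      if "u \<in> slot N h ?b (Inl p)" "v \<in> slot N h ?b (Inr p)" for u v
      using T[OF that] by (simp add: triple_kernel_commute[of a v u])
    have "(c * (3 powr a * h powr (2 * a + 1))) * h \<le> inner_L2 (lborel_pow 2) (?L i) (bump2 N h ?b (Inl p) (Inr p))"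
      using c by (intro inner_bump2_bounds(2)[OF h(1) L[OF i]]) (simp add: Leq T)
    moreover have "(c * (3 powr a * h powr (2 * a + 1))) * h \<le> inner_L2 (lborel_pow 2) (?L i) (bump2 N h ?b (Inr p) (Inl p))"
      using c by (intro inner_bump2_bounds(2)[OF h(1) L[OF i]]) (simp add: Leq T')
    ultimately show ?thesis unfolding m_def by simp
  qed
qed

section \<open>Small balls for the Malliavin derivative\<close>

abbreviation slot_indices :: "nat \<Rightarrow> (nat + nat) set" where
  "slot_indices P \<equiv> Inl ` {..<P} \<union> Inr ` {..<P}"

context isonormal_process begin

text \<open>The squared characteristic function is bounded by the power \<open>- P\<close> of \<open>\<bar>t\<bar>\<close>, one factor for each of the \<open>P\<close>
pairs; \<open>P = 4 * n\<close> gives the power \<open>- 2 n\<close> needed in \<open>expectation_exp_square_bound\<close>. The kernels \<open>f j\<close> are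
compared with the sections of the Hermite kernel only through the entries of the matrices, because only
these are known to agree for the kernel that defines the derivative.\<close>

lemma second_chaos_small_ball:
  fixes H c :: real and n P N :: nat
  assumes H: "1 / 2 < H" "H < 1" and c: "0 < c" and n: "0 < n"
    and P: "P = 4 * n" and N: "N = n * (P + 1)"
  obtains h \<kappa> :: real where "0 < h" "h \<le> 1 / (8 * real N)" "0 < \<kappa>"
    "\<And>r f X \<rho>. (\<And>j. j < n \<Longrightarrow> r j \<in> cell N (j * (P + 1))) \<Longrightarrow>
      (\<And>j. j < n \<Longrightarrow> (\<lambda>y. hermite_kernel 3 H c 1 (y(2 := r j))) \<in> L2 (lborel_pow 2)) \<Longrightarrow>
      (\<And>j. j < n \<Longrightarrow> wiener_ito M B 2 (f j) (X j)) \<Longrightarrow>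
      (\<And>i j k l. i < n \<Longrightarrow> j < n \<Longrightarrow> k \<in> slot_indices P \<Longrightarrow> l \<in> slot_indices P \<Longrightarrow>
         inner_L2 (lborel_pow 2) (f j) (bump2 N h (cluster_start P i) k l) =
         inner_L2 (lborel_pow 2) (\<lambda>y. hermite_kernel 3 H c 1 (y(2 := r j))) (bump2 N h (cluster_start P i) k l)) \<Longrightarrow>
      0 < \<rho> \<Longrightarrow> (LINT \<omega>|M. exp (- (\<Sum>j<n. (\<rho> * X j \<omega>)\<^sup>2) / 2)) \<le> (sqrt (2 * pi) * \<kappa> / \<rho>) ^ n"
proof -
  define a where "a = (H - 1) / 3 - 1 / 2"
  define A where "A = 3 * (1 / (2 * real N)) powr (2 * a) / (a + 1)"
  define Q where "Q = (4 * real n) ^ n"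
  have "a = H / 3 - 5 / 6" by (simp add: a_def field_simps)
  then have a: "-1 < a" "2 * a + 1 < 0" using H by linarith+
  have N0: "0 < N" using n N by simp
  have P0: "0 < P" using n P by simp
  have A0: "0 < A" using a N0 by (simp add: A_def)
  have Q1: "1 \<le> Q" unfolding Q_def by (rule one_le_power) (use n in simp)
  define Y where "Y = 8 * real P * real n * Q * A / 3 powr a"
  have Y0: "0 < Y" using P0 n Q1 A0 by (simp add: Y_def)
  \<comment> \<open>\<open>2 * a + 1 < 0\<close>, so that \<open>h powr (2 * a + 1)\<close> exceeds \<open>Y\<close> for small \<open>h\<close>. This is the dominance condition of \<open>triangular_dominance\<close>.\<close>
  define h where "h = min (1 / (8 * real N)) (Y powr (1 / (2 * a + 1)))"
  have h: "0 < h" "h \<le> 1 / (8 * real N)" using N0 Y0 by (auto simp: h_def)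
  have hY: "Y \<le> h powr (2 * a + 1)"
  proof -
    have "Y = (Y powr (1 / (2 * a + 1))) powr (2 * a + 1)" using a Y0 by (simp add: powr_powr)
    also have "\<dots> \<le> h powr (2 * a + 1)" using a h by (intro powr_mono2') (auto simp: h_def)
    finally show ?thesis .
  qed
  define D where "D = 2 * (c * (3 powr a * h powr (2 * a + 1)) * h)"
  have D0: "0 < D" using c h by (simp add: D_def)
  have DA: "8 * real P * real n * Q * (2 * (c * A * h)) \<le> D"
  proof -
    have "8 * real P * real n * Q * A = 3 powr a * Y" by (simp add: Y_def)
    also have "\<dots> \<le> 3 powr a * h powr (2 * a + 1)" using hY by (intro mult_left_mono) auto
    finally have "(2 * c * h) * (8 * real P * real n * Q * A) \<le> (2 * c * h) * (3 powr a * h powr (2 * a + 1))"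
      using c h by (intro mult_left_mono) auto
    then show ?thesis by (simp add: D_def mult_ac)
  qed
  define \<kappa> where "\<kappa> = 4 * sqrt (real P) * Q / D"
  have \<kappa>: "0 < \<kappa>" using P0 Q1 D0 by (simp add: \<kappa>_def)
  let ?K1 = "Inl ` {..<P} :: (nat + nat) set" and ?K2 = "Inr ` {..<P} :: (nat + nat) set"
  define \<sigma> :: "nat + nat \<Rightarrow> nat + nat" where "\<sigma> = case_sum Inr Inr"
  show ?thesis
  proof (rule that[OF h \<kappa>])
    fix r :: "nat \<Rightarrow> real" and f X and \<rho> :: real
    assume r: "\<And>j. j < n \<Longrightarrow> r j \<in> cell N (j * (P + 1))"
      and L: "\<And>j. j < n \<Longrightarrow> (\<lambda>y. hermite_kernel 3 H c 1 (y(2 := r j))) \<in> L2 (lborel_pow 2)"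
      and X: "\<And>j. j < n \<Longrightarrow> wiener_ito M B 2 (f j) (X j)"
      and fL: "\<And>i j k l. i < n \<Longrightarrow> j < n \<Longrightarrow> k \<in> slot_indices P \<Longrightarrow> l \<in> slot_indices P \<Longrightarrow>
         inner_L2 (lborel_pow 2) (f j) (bump2 N h (cluster_start P i) k l) =
         inner_L2 (lborel_pow 2) (\<lambda>y. hermite_kernel 3 H c 1 (y(2 := r j))) (bump2 N h (cluster_start P i) k l)"
      and \<rho>: "0 < \<rho>"
    have "(LINT \<omega>|M. exp (- (\<Sum>j\<in>{..<n}. (\<rho> * X j \<omega>)\<^sup>2) / 2)) \<le> (sqrt (2 * pi) * \<kappa> / \<rho>) ^ card {..<n}"
    proof (rule expectation_exp_square_bound)
      show "finite {..<n}" "{..<n} \<noteq> {}" using n by auto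
      show "X j \<in> borel_measurable M" if "j \<in> {..<n}" for j
        using X[of j] that by (auto simp: wiener_ito_def L2_def)
      fix t :: "nat \<Rightarrow> real" and i0
      assume i0: "i0 \<in> {..<n}" "t i0 \<noteq> 0"
      from exists_dominant_index[OF n] obtain i where i: "i < n"
        "\<And>j. j < i \<Longrightarrow> \<bar>t j\<bar> \<le> \<bar>t i\<bar> / (4 * real n)" "\<And>j. j < n \<Longrightarrow> \<bar>t j\<bar> \<le> Q * \<bar>t i\<bar>"
        unfolding Q_def by blast
      define m where "m j k l = inner_L2 (lborel_pow 2) (f j) (bump2 N h (cluster_start P i) k l)
        + inner_L2 (lborel_pow 2) (f j) (bump2 N h (cluster_start P i) l k)" for j k l
      have ti: "0 < \<bar>t i\<bar>" using i(3)[of i0] i0 Q1 by auto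
      define \<delta> where "\<delta> = \<bar>t i\<bar> * D / 2"
      have \<delta>: "0 < \<delta>" using ti D0 by (simp add: \<delta>_def)
      have m_eq: "m j k l = inner_L2 (lborel_pow 2) (\<lambda>y. hermite_kernel 3 H c 1 (y(2 := r j))) (bump2 N h (cluster_start P i) k l)
        + inner_L2 (lborel_pow 2) (\<lambda>y. hermite_kernel 3 H c 1 (y(2 := r j))) (bump2 N h (cluster_start P i) l k)"
        if "j < n" "k \<in> slot_indices P" "l \<in> slot_indices P" for j k l
        unfolding m_def using fL[OF i(1)] that by simp
      note kb = kernel_matrix_bounds[OF H c N h r L i(1), folded a_def, folded A_def]
      have dom: "\<bar>t i\<bar> * D / 2 \<le> \<bar>\<Sum>j<n. t j * m j k (\<sigma> k)\<bar>"
        "(\<Sum>l\<in>?K2 - {\<sigma> k}. \<bar>\<Sum>j<n. t j * m j k l\<bar>) \<le> \<bar>\<Sum>j<n. t j * m j k (\<sigma> k)\<bar> / 2"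
        if k: "k \<in> ?K1" for k
      proof -
        from k obtain p where p: "p < P" "k = Inl p" by auto
        have card: "card ?K2 = P" by (simp add: card_image)
        have sk: "\<sigma> k = Inr p" using p by (simp add: \<sigma>_def)
        have ks: "k \<in> slot_indices P" "Inr p \<in> slot_indices P" using p by auto
        have m0: "0 \<le> m j k l" if "j < n" "l \<in> ?K2" for j l
          using kb(1)[OF _ _ p(1) that(1)] that ks by (subst m_eq) auto
        have before: "m j k (\<sigma> k) \<le> m i k (\<sigma> k)" if "j < i" for j
          using kb(2)[OF _ _ p(1) that] that ks i(1) unfolding sk by (subst (1 2) m_eq) (auto simp: p)
        have after: "m j k (\<sigma> k) \<le> 2 * (c * A * h)" if "i < j" "j < n" for j
          using kb(3)[OF _ _ p(1) that] that ks unfolding sk by (subst m_eq) (auto simp: p)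
        have off: "m j k l \<le> 2 * (c * A * h)" if "j < n" "l \<in> ?K2" "l \<noteq> \<sigma> k" for j l
        proof -
          from that sk obtain q where q: "q < P" "l = Inr q" "q \<noteq> p" by auto
          have "l \<in> slot_indices P" using q by auto
          then show ?thesis
            using kb(4)[OF _ _ p(1) that(1) q(1) q(3)] that(1) ks by (subst m_eq) (auto simp: p q)
        qed
        have big: "D \<le> m i k (\<sigma> k)"
          using kb(5)[OF _ _ p(1)] ks i(1) unfolding sk D_def by (subst m_eq) (auto simp: p)
        have large: "real (8 * card ?K2 * n) * Q * (2 * (c * A * h)) \<le> D"
          unfolding card using DA by simp
        have "0 \<le> 2 * (c * A * h)" using c A0 h by simp
        note dominance = triangular_dominance[where m = m and K = ?K2 and \<sigma> = \<sigma> and t = t,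
            OF i(1) _ _ m0 before after off big large Q1 this i(2,3)]
        show "\<bar>t i\<bar> * D / 2 \<le> \<bar>\<Sum>j<n. t j * m j k (\<sigma> k)\<bar>"
          by (rule dominance(1)) (use sk p in auto)
        show "(\<Sum>l\<in>?K2 - {\<sigma> k}. \<bar>\<Sum>j<n. t j * m j k l\<bar>) \<le> \<bar>\<Sum>j<n. t j * m j k (\<sigma> k)\<bar> / 2"
          by (rule dominance(2)) (use sk p in auto)
      qed
      let ?\<phi> = "CLINT \<omega>|M. iexp (\<Sum>j\<in>{..<n}. t j * X j \<omega>)"
      have "(cmod ?\<phi>)\<^sup>2 \<le> decoupled ?K1 ?K2 (\<lambda>k l. \<Sum>j<n. t j * m j k l)"
        unfolding m_def
      proof (rule char_second_chaos_bound)
        show "bump N h (cluster_start P i) k \<in> L2 lborel" for k by (rule bump_L2)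
        show "inner_L2 lborel (bump N h (cluster_start P i) k) (bump N h (cluster_start P i) l) = (if k = l then 1 else 0)" for k l
          by (rule bump_orthonormal[OF N0 h])
      qed (use X in auto)
      also have "\<dots> \<le> (2 * sqrt (card ?K2) / \<delta>) ^ card ?K2"
      proof (rule decoupled_diagonally_dominant[where \<sigma> = \<sigma>])
        show "bij_betw \<sigma> ?K1 ?K2" by (auto simp: bij_betw_def inj_on_def \<sigma>_def image_iff)
        show "?K1 \<noteq> {}" using P0 by auto
        show "\<delta> \<le> \<bar>\<Sum>j<n. t j * m j k (\<sigma> k)\<bar>" if "k \<in> ?K1" for k
          using dom(1)[OF that] by (simp add: \<delta>_def)
        show "(\<Sum>l\<in>?K2 - {\<sigma> k}. \<bar>\<Sum>j<n. t j * m j k l\<bar>) \<le> \<bar>\<Sum>j<n. t j * m j k (\<sigma> k)\<bar> / 2" if "k \<in> ?K1" for k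
          by (rule dom(2)[OF that])
      qed (use \<delta> in auto)
      also have "card ?K2 = P" by (simp add: card_image)
      also have "(2 * sqrt (real P) / \<delta>) ^ P = ((2 * sqrt (real P) / \<delta>) ^ (2 * n))\<^sup>2"
        by (simp add: P power_mult[symmetric] mult.commute)
      finally have "cmod ?\<phi> \<le> (2 * sqrt (real P) / \<delta>) ^ (2 * n)"
        using \<delta> by (elim power2_le_imp_le) simp
      also have "\<dots> \<le> (\<kappa> / \<bar>t i0\<bar>) ^ (2 * n)"
      proof (rule power_mono)
        have "2 * sqrt (real P) / \<delta> = 4 * sqrt (real P) / (D * \<bar>t i\<bar>)"
          by (simp add: \<delta>_def field_simps)
        also have "\<dots> = \<kappa> / (Q * \<bar>t i\<bar>)" using Q1 by (simp add: \<kappa>_def)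
        also have "\<dots> \<le> \<kappa> / \<bar>t i0\<bar>"
          using \<kappa> i(3)[of i0] i0 ti Q1 by (intro divide_left_mono mult_pos_pos) auto
        finally show "2 * sqrt (real P) / \<delta> \<le> \<kappa> / \<bar>t i0\<bar>" .
      qed (use \<delta> in simp)
      finally show "cmod ?\<phi> \<le> (\<kappa> / \<bar>t i0\<bar>) ^ (2 * card {..<n})" by simp
    qed (use \<kappa> \<rho> in auto)
    then show "(LINT \<omega>|M. exp (- (\<Sum>j<n. (\<rho> * X j \<omega>)\<^sup>2) / 2)) \<le> (sqrt (2 * pi) * \<kappa> / \<rho>) ^ n" by simp
  qed
qed

text \<open>The mean of \<open>\<integral> (U r)\<^sup>2 dr\<close> is at most \<open>9 \<cdot> 4\<close> times the squared norm of \<open>f\<close>, hence finite. On a path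
where this integral diverges, the Bochner integral in the norm would be zero.\<close>

lemma chaos_derivative_square_integrable:
  assumes Um: "(\<lambda>(r, \<omega>). U r \<omega>) \<in> borel_measurable (lborel \<Otimes>\<^sub>M M)"
    and f: "f \<in> L2 (lborel_pow 3)"
    and U: "AE r in lborel. \<exists>X. wiener_ito M B 2 (\<lambda>y. f (y(2 := r))) X \<and> (AE \<omega> in M. U r \<omega> = 3 * X \<omega>)"
  shows "AE \<omega> in M. integrable lborel (\<lambda>r. (U r \<omega>)\<^sup>2)"
proof -
  interpret P: pair_sigma_finite "lborel :: real measure" M ..
  note [measurable] = Um
  have Ur [measurable]: "(\<lambda>\<omega>. U r \<omega>) \<in> borel_measurable M" for r
    using measurable_Pair2[OF Um, of r] by simp
  have f3: "f \<in> borel_measurable (lborel_pow 3)" by (rule L2_measurable[OF f])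
  have "(\<integral>\<^sup>+\<omega>. \<integral>\<^sup>+r. ennreal ((U r \<omega>)\<^sup>2) \<partial>lborel \<partial>M) = (\<integral>\<^sup>+r. \<integral>\<^sup>+\<omega>. ennreal ((U r \<omega>)\<^sup>2) \<partial>M \<partial>lborel)"
    by (rule P.Fubini') measurable
  also have "\<dots> \<le> (\<integral>\<^sup>+r. \<integral>\<^sup>+y. 36 * ennreal ((f (y(2 := r)))\<^sup>2) \<partial>lborel_pow 2 \<partial>lborel)"
  proof (rule nn_integral_mono_AE, rule AE_mp[OF U], intro AE_I2 impI)
    fix r assume "\<exists>X. wiener_ito M B 2 (\<lambda>y. f (y(2 := r))) X \<and> (AE \<omega> in M. U r \<omega> = 3 * X \<omega>)"
    then obtain X where X: "wiener_ito M B 2 (\<lambda>y. f (y(2 := r))) X" and UX: "AE \<omega> in M. U r \<omega> = 3 * X \<omega>" by auto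
    have L: "(\<lambda>y. f (y(2 := r))) \<in> L2 (lborel_pow 2)" "X \<in> L2 M" using X by (auto simp: wiener_ito_def)
    have "(\<integral>\<^sup>+\<omega>. ennreal ((U r \<omega>)\<^sup>2) \<partial>M) = (\<integral>\<^sup>+\<omega>. ennreal (9 * (X \<omega>)\<^sup>2) \<partial>M)"
      by (rule nn_integral_cong_AE, rule AE_mp[OF UX]) (auto simp: power_mult_distrib)
    also have "\<dots> = ennreal (LINT \<omega>|M. 9 * (X \<omega>)\<^sup>2)"
      using L by (intro nn_integral_eq_integral) (auto simp: L2_def)
    also have "\<dots> \<le> ennreal (LINT y|lborel_pow 2. 36 * (f (y(2 := r)))\<^sup>2)"
      using wiener_ito_second_moment[OF X] by (intro ennreal_leI) simp
    also have "\<dots> = (\<integral>\<^sup>+y. ennreal (36 * (f (y(2 := r)))\<^sup>2) \<partial>lborel_pow 2)"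
      using L by (intro nn_integral_eq_integral[symmetric]) (auto simp: L2_def)
    also have "\<dots> = (\<integral>\<^sup>+y. 36 * ennreal ((f (y(2 := r)))\<^sup>2) \<partial>lborel_pow 2)"
      by (simp add: ennreal_mult)
    finally show "(\<integral>\<^sup>+\<omega>. ennreal ((U r \<omega>)\<^sup>2) \<partial>M) \<le> (\<integral>\<^sup>+y. 36 * ennreal ((f (y(2 := r)))\<^sup>2) \<partial>lborel_pow 2)" .
  qed
  also have "\<dots> = (\<integral>\<^sup>+x. 36 * ennreal ((f x)\<^sup>2) \<partial>lborel_pow 3)"
  proof -
    have "{..<3::nat} = insert 2 {..<2}" by auto
    then show ?thesis
      using f3 by (subst lborel_product.product_nn_integral_insert_rev[symmetric]) auto
  qed
  also have "\<dots> < \<infinity>"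
  proof -
    have "(\<integral>\<^sup>+x. ennreal (norm (36 * (f x)\<^sup>2)) \<partial>lborel_pow 3) < \<infinity>"
      using f integrable_mult_right[of 36 "lborel_pow 3" "\<lambda>x. (f x)\<^sup>2"] unfolding L2_def integrable_iff_bounded by auto
    then show ?thesis by (simp add: ennreal_mult)
  qed
  finally have fin: "(\<integral>\<^sup>+\<omega>. \<integral>\<^sup>+r. ennreal ((U r \<omega>)\<^sup>2) \<partial>lborel \<partial>M) \<noteq> \<infinity>" by auto
  have "(\<lambda>\<omega>. \<integral>\<^sup>+r. ennreal ((U r \<omega>)\<^sup>2) \<partial>lborel) \<in> borel_measurable M"
  proof -
    have "(\<lambda>(\<omega>, r). ennreal ((U r \<omega>)\<^sup>2)) \<in> borel_measurable (M \<Otimes>\<^sub>M lborel)"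
      using measurable_compose[OF measurable_pair_swap' Um] by (simp add: case_prod_unfold)
    then show ?thesis by (rule sigma_finite_measure.borel_measurable_nn_integral[OF sigma_finite_lborel, where f = "\<lambda>\<omega> r. ennreal ((U r \<omega>)\<^sup>2)"])
  qed
  from nn_integral_PInf_AE[OF this fin]
  show ?thesis
  proof (rule AE_mp, intro AE_I2 impI)
    fix \<omega> assume \<omega>: "\<omega> \<in> space M" and "(\<integral>\<^sup>+r. ennreal ((U r \<omega>)\<^sup>2) \<partial>lborel) \<noteq> \<infinity>"
    moreover have "(\<lambda>r. U r \<omega>) \<in> borel_measurable lborel"
      using measurable_Pair1[OF Um \<omega>] by simp
    ultimately show "integrable lborel (\<lambda>r. (U r \<omega>)\<^sup>2)"
      by (intro integrableI_nonneg) (auto simp: less_top)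
  qed
qed

end

text \<open>Jensen's inequality for the uniform distribution on \<open>S\<close>, by integrating the tangent of the exponential
function at the mean of \<open>- \<eta> V\<close>. Lebesgue integrals in \<open>[0, \<infinity>]\<close> are convenient for the exchange of
integrals that follows.\<close>

lemma exp_Jensen_set:
  fixes V :: "real \<Rightarrow> real"
  assumes S: "S \<in> sets lborel" "emeasure lborel S = ennreal \<eta>" "0 < \<eta>"
    and V: "set_integrable lborel S V" "\<And>r. 0 \<le> V r" and [measurable]: "V \<in> borel_measurable lborel"
  shows "ennreal (exp (- (LINT r:S|lborel. V r))) \<le> ennreal (1 / \<eta>) * (\<integral>\<^sup>+r. indicator S r * ennreal (exp (- (\<eta> * V r))) \<partial>lborel)"
proof -
  define \<mu> where "\<mu> = (LINT r:S|lborel. V r)"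
  note [measurable] = S(1)
  have m: "measure lborel S = \<eta>" using S by (simp add: measure_def)
  have c: "set_integrable lborel S (\<lambda>r. x)" for x :: real
    unfolding set_integrable_def using S by (intro integrable_scaleR_left integrable_real_indicator) auto
  have e: "set_integrable lborel S (\<lambda>r. exp (- (\<eta> * V r)))"
  proof (rule set_integrable_bound[OF c[of 1]])
    show "set_borel_measurable lborel S (\<lambda>r. exp (- (\<eta> * V r)))"
      unfolding set_borel_measurable_def by measurable
  qed (use V S in auto)
  have l: "set_integrable lborel S (\<lambda>r. exp (- \<mu>) * (1 + \<mu>) - (exp (- \<mu>) * \<eta>) * V r)"
    by (intro set_integral_diff(1) c set_integrable_mult_right V)
  have "exp (- \<mu>) * \<eta> = exp (- \<mu>) * (1 + \<mu>) * \<eta> - (exp (- \<mu>) * \<eta>) * \<mu>" by (simp add: algebra_simps)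
  also have "\<dots> = (LINT r:S|lborel. exp (- \<mu>) * (1 + \<mu>) - (exp (- \<mu>) * \<eta>) * V r)"
  proof -
    have 1: "(LINT r:S|lborel. K) = K * \<eta>" for K :: real
      using S by (simp add: set_lebesgue_integral_def m)
    have 2: "(LINT r:S|lborel. K * V r) = K * \<mu>" for K :: real
      by (simp add: \<mu>_def)
    show ?thesis
      by (subst set_integral_diff(2)[OF c set_integrable_mult_right[OF V(1)]]) (simp only: 1 2)
  qed
  also have "\<dots> \<le> (LINT r:S|lborel. exp (- (\<eta> * V r)))"
  proof (rule set_integral_mono[OF l e])
    fix r
    have "1 + (\<mu> - \<eta> * V r) \<le> exp (\<mu> - \<eta> * V r)" by (rule exp_ge_add_one_self)
    then have "exp (- \<mu>) * (1 + (\<mu> - \<eta> * V r)) \<le> exp (- \<mu>) * exp (\<mu> - \<eta> * V r)"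
      by (intro mult_left_mono) auto
    also have "\<dots> = exp (- (\<eta> * V r))" by (simp add: exp_add[symmetric])
    finally show "exp (- \<mu>) * (1 + \<mu>) - (exp (- \<mu>) * \<eta>) * V r \<le> exp (- (\<eta> * V r))"
      by (simp add: algebra_simps)
  qed
  finally have "exp (- \<mu>) \<le> (1 / \<eta>) * (LINT r:S|lborel. exp (- (\<eta> * V r)))"
    using S(3) by (simp add: field_simps)
  then have "ennreal (exp (- \<mu>)) \<le> ennreal (1 / \<eta>) * ennreal (LINT r:S|lborel. exp (- (\<eta> * V r)))"
    using S(3) by (subst ennreal_mult[symmetric]) (auto intro!: ennreal_leI integral_nonneg_AE simp: set_lebesgue_integral_def)
  also have "ennreal (LINT r:S|lborel. exp (- (\<eta> * V r))) = (\<integral>\<^sup>+r. indicator S r * ennreal (exp (- (\<eta> * V r))) \<partial>lborel)"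
    unfolding set_lebesgue_integral_def using e unfolding set_integrable_def
    by (subst nn_integral_eq_integral[symmetric]) (auto intro!: nn_integral_cong simp: indicator_def)
  finally show ?thesis by (simp add: \<mu>_def)
qed

lemma cell_measure: "0 < N \<Longrightarrow> emeasure lborel (cell N m) = ennreal (1 / (2 * real N))"
  by (simp add: cell_def)

context isonormal_process begin

text \<open>Finitely many test functions occur, so that \<open>wiener_ito_section_unique\<close> applies to all of them outside of one
null set.\<close>

lemma AE_sections_match_hermite_kernel:
  fixes H c h :: real and n P N :: nat and F :: "'a \<Rightarrow> real" and U :: "real \<Rightarrow> 'a \<Rightarrow> real"
  assumes L: "wiener_ito M B 3 (hermite_kernel 3 H c 1) F"
    and f: "symmetric_kernel 3 f" "wiener_ito M B 3 f F"
    and U: "AE r in lborel. \<exists>X. wiener_ito M B 2 (\<lambda>y. f (y(2 := r))) X \<and> (AE \<omega> in M. U r \<omega> = 3 * X \<omega>)"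
  shows "AE r in lborel. r \<in> {0..1} \<longrightarrow>
    (\<exists>X. wiener_ito M B 2 (\<lambda>y. f (y(2 := r))) X \<and> (AE \<omega> in M. U r \<omega> = 3 * X \<omega>)) \<and>
    (\<lambda>y. hermite_kernel 3 H c 1 (y(2 := r))) \<in> L2 (lborel_pow 2) \<and>
    (\<forall>i\<in>{..<n}. \<forall>k\<in>slot_indices P. \<forall>l\<in>slot_indices P.
      inner_L2 (lborel_pow 2) (\<lambda>y. f (y(2 := r))) (bump2 N h (cluster_start P i) k l) =
      inner_L2 (lborel_pow 2) (\<lambda>y. hermite_kernel 3 H c 1 (y(2 := r))) (bump2 N h (cluster_start P i) k l))"
proof -
  let ?L = "hermite_kernel 3 H c 1"
  have LL: "?L \<in> L2 (lborel_pow 3)" using L by (simp add: wiener_ito_def)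
  have three: "Suc 2 = 3" by simp
  have Lm: "?L \<in> borel_measurable (lborel_pow (Suc 2))" using L2_measurable[OF LL] unfolding three .
  have sm: "(\<lambda>y. ?L (y(2 := r))) \<in> borel_measurable (lborel_pow 2)" for r
    using measurable_compose[OF measurable_compose[OF measurable_Pair2'[of r lborel "lborel_pow 2"] measurable_append] Lm] by simp
  have 1: "AE r in lborel. integrable (lborel_pow 2) (\<lambda>y. (?L (y(2 := r)))\<^sup>2)"
    by (rule AE_integrable_section) (use LL in \<open>simp add: L2_def three\<close>)
  have 2: "AE r in lborel. \<forall>i\<in>{..<n}. \<forall>k\<in>slot_indices P. \<forall>l\<in>slot_indices P. r \<in> {0..1} \<longrightarrow>
      inner_L2 (lborel_pow 2) (\<lambda>y. f (y(2 := r))) (bump2 N h (cluster_start P i) k l) =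
      inner_L2 (lborel_pow 2) (\<lambda>y. ?L (y(2 := r))) (bump2 N h (cluster_start P i) k l)"
  proof (intro AE_finite_allI)
    fix i k l
    let ?g = "\<lambda>j::nat. if j = 0 then bump N h (cluster_start P i) k else bump N h (cluster_start P i) l"
    have "AE r in lborel. r \<in> {0..1} \<longrightarrow>
     inner_L2 (lborel_pow 2) (\<lambda>y. f (y(2 := r))) (\<lambda>y. \<Prod>j<2. ?g j (y j)) =
     inner_L2 (lborel_pow 2) (\<lambda>y. ?L (y(2 := r))) (\<lambda>y. \<Prod>j<2. ?g j (y j))"
      by (rule wiener_ito_section_unique[OF f(2,1) L hermite_kernel_symmetric]) (auto intro: bump_L2)
    then show "AE r in lborel. r \<in> {0..1} \<longrightarrow>
      inner_L2 (lborel_pow 2) (\<lambda>y. f (y(2 := r))) (bump2 N h (cluster_start P i) k l) =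
      inner_L2 (lborel_pow 2) (\<lambda>y. ?L (y(2 := r))) (bump2 N h (cluster_start P i) k l)"
      by (simp add: prod_lessThan_2)
  qed auto
  from U 1 2 show ?thesis
    by eventually_elim (auto simp: L2_def sm)
qed

text \<open>The sets \<open>S j\<close> are the first cells of the blocks, without the points where the section of the kernel is
not the expected one. Jensen's inequality on each \<open>S j\<close> and Tonelli's theorem leave the estimate of
\<open>second_chaos_small_ball\<close> at \<open>\<rho> = 3 * sqrt \<eta> / \<epsilon>\<close>, where the factor \<open>3\<close> stems from \<open>U r = 3 * X\<close>.\<close>

lemma H1_norm_small_ball:
  fixes H c :: real and n :: nat and F :: "'a \<Rightarrow> real" and U :: "real \<Rightarrow> 'a \<Rightarrow> real"
  assumes H: "1 / 2 < H" "H < 1" and c: "0 < c" and n: "0 < n"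
    and L: "wiener_ito M B 3 (hermite_kernel 3 H c 1) F"
    and D: "malliavin_derivative M B 3 F U"
  shows "\<exists>C\<ge>0. \<forall>\<epsilon>>0. measure M {\<omega> \<in> space M. H1_norm U \<omega> \<le> \<epsilon>} \<le> C * \<epsilon> ^ n"
proof -
  have Um: "(\<lambda>(r, \<omega>). U r \<omega>) \<in> borel_measurable (lborel \<Otimes>\<^sub>M M)"
    using D by (simp add: malliavin_derivative_def)
  from D obtain f where f: "symmetric_kernel 3 f" "wiener_ito M B 3 f F"
    and UX: "AE r in lborel. \<exists>X. wiener_ito M B 2 (\<lambda>y. f (y(2 := r))) X \<and> (AE \<omega> in M. U r \<omega> = 3 * X \<omega>)"
    unfolding malliavin_derivative_def by auto
  define P where "P = 4 * n"
  define N where "N = n * (P + 1)"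
  have N0: "0 < N" using n by (simp add: N_def P_def)
  show ?thesis
  proof (rule second_chaos_small_ball[OF H c n P_def N_def])
    fix h \<kappa> :: real
    assume h: "0 < h" "h \<le> 1 / (8 * real N)" "0 < \<kappa>"
      and ball: "\<And>r f X \<rho>. (\<And>j. j < n \<Longrightarrow> r j \<in> cell N (j * (P + 1))) \<Longrightarrow>
        (\<And>j. j < n \<Longrightarrow> (\<lambda>y. hermite_kernel 3 H c 1 (y(2 := r j))) \<in> L2 (lborel_pow 2)) \<Longrightarrow>
        (\<And>j. j < n \<Longrightarrow> wiener_ito M B 2 (f j) (X j)) \<Longrightarrow>
        (\<And>i j k l. i < n \<Longrightarrow> j < n \<Longrightarrow> k \<in> slot_indices P \<Longrightarrow> l \<in> slot_indices P \<Longrightarrow>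
           inner_L2 (lborel_pow 2) (f j) (bump2 N h (cluster_start P i) k l) =
           inner_L2 (lborel_pow 2) (\<lambda>y. hermite_kernel 3 H c 1 (y(2 := r j))) (bump2 N h (cluster_start P i) k l)) \<Longrightarrow>
        0 < \<rho> \<Longrightarrow> (LINT \<omega>|M. exp (- (\<Sum>j<n. (\<rho> * X j \<omega>)\<^sup>2) / 2)) \<le> (sqrt (2 * pi) * \<kappa> / \<rho>) ^ n"
    define good where "good r \<longleftrightarrow> (\<exists>X. wiener_ito M B 2 (\<lambda>y. f (y(2 := r))) X \<and> (AE \<omega> in M. U r \<omega> = 3 * X \<omega>)) \<and>
      (\<lambda>y. hermite_kernel 3 H c 1 (y(2 := r))) \<in> L2 (lborel_pow 2) \<and>
      (\<forall>i\<in>{..<n}. \<forall>k\<in>slot_indices P. \<forall>l\<in>slot_indices P.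
        inner_L2 (lborel_pow 2) (\<lambda>y. f (y(2 := r))) (bump2 N h (cluster_start P i) k l) =
        inner_L2 (lborel_pow 2) (\<lambda>y. hermite_kernel 3 H c 1 (y(2 := r))) (bump2 N h (cluster_start P i) k l))" for r
    have "AE r in lborel. r \<in> {0..1} \<longrightarrow> good r"
      unfolding good_def by (rule AE_sections_match_hermite_kernel[OF L f UX])
    then obtain Z where Z: "{r \<in> space lborel. \<not> (r \<in> {0..1} \<longrightarrow> good r)} \<subseteq> Z" "emeasure lborel Z = 0" "Z \<in> sets lborel"
      by (rule AE_E)
    define \<eta> where "\<eta> = 1 / (2 * real N)"
    have \<eta>: "0 < \<eta>" using N0 by (simp add: \<eta>_def)
    define S where "S j = cell N (j * (P + 1)) - Z" for j
    have Sm [measurable]: "S j \<in> sets lborel" for j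
      unfolding S_def using Z(3) by (auto simp: cell_def)
    have Se: "emeasure lborel (S j) = ennreal \<eta>" for j
    proof -
      have "cell N (j * (P + 1)) \<in> sets lborel" by (simp add: cell_def)
      moreover have "Z \<in> null_sets lborel" using Z by (auto simp: null_sets_def)
      ultimately show ?thesis
        unfolding S_def \<eta>_def by (subst emeasure_Diff_null_set) (auto simp: cell_measure[OF N0])
    qed
    have idx: "j * (P + 1) < N" if "j < n" for j
      unfolding N_def using that by (intro mult_strict_right_mono) auto
    have S01: "S j \<subseteq> {0..1}" if "j < n" for j
      using cell_bounds[OF idx[OF that]] \<eta> unfolding S_def \<eta>_def[symmetric] by fastforce
    have Sgood: "good r" "r \<in> cell N (j * (P + 1))" if "j < n" "r \<in> S j" for r j
    proof -
      have "r \<in> {0..1}" "r \<notin> Z" using S01[OF that(1)] that(2) by (auto simp only: S_def)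
      then show "good r" using Z(1) by auto
      show "r \<in> cell N (j * (P + 1))" using that(2) by (simp add: S_def)
    qed
    have Sdisj: "disjoint_family_on S {..<n}"
      unfolding disjoint_family_on_def
    proof (intro ballI impI, rule ccontr)
      fix i j assume ij: "i \<in> {..<n}" "j \<in> {..<n}" "i \<noteq> j" "S i \<inter> S j \<noteq> {}"
      then obtain x where x: "x \<in> cell N (i * (P + 1))" "x \<in> cell N (j * (P + 1))" by (auto simp: S_def)
      have "i * (P + 1) < j * (P + 1) \<or> j * (P + 1) < i * (P + 1)"
        using ij(3) by (metis add_is_0 linorder_neqE_nat mult_less_cancel2 one_neq_zero zero_less_iff_neq_zero)
      then show False
        using cell_separated[OF N0 _ x] cell_separated[OF N0 _ x(2,1)] \<eta> unfolding \<eta>_def[symmetric] by auto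
    qed
    have int: "AE \<omega> in M. integrable lborel (\<lambda>r. (U r \<omega>)\<^sup>2)"
      by (rule chaos_derivative_square_integrable[OF Um _ UX]) (use f in \<open>simp add: wiener_ito_def\<close>)
    have U1 [measurable]: "(\<lambda>r. U r \<omega>) \<in> borel_measurable lborel" if "\<omega> \<in> space M" for \<omega>
      using measurable_Pair1[OF Um that] by simp
    have U2 [measurable]: "(\<lambda>\<omega>. U r \<omega>) \<in> borel_measurable M" for r
      using measurable_Pair2[OF Um, of r] by simp
    define C where "C = exp (1 / 2) * (sqrt (2 * pi) * \<kappa> / (3 * sqrt \<eta>)) ^ n"
    show ?thesis
    proof (intro exI[of _ C] conjI allI impI)
      show "0 \<le> C" using h \<eta> by (simp add: C_def)
      fix \<epsilon> :: real assume \<epsilon>: "0 < \<epsilon>"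
      define V where "V r \<omega> = (U r \<omega>)\<^sup>2 / (2 * \<epsilon>\<^sup>2)" for r \<omega>
      define G where "G j r \<omega> = indicator (S j) r * ennreal (exp (- (\<eta> * V r \<omega>)))" for j r \<omega>
      have Gm: "(\<lambda>(r, \<omega>). G j r \<omega>) \<in> borel_measurable (lborel \<Otimes>\<^sub>M M)" for j
        unfolding G_def V_def using Um by (simp add: case_prod_unfold) measurable
      have G1: "(\<lambda>r. G j r \<omega>) \<in> borel_measurable lborel" if "\<omega> \<in> space M" for j \<omega>
        using measurable_Pair1[OF Gm that] by simp
      have step: "AE \<omega> in M. H1_norm U \<omega> \<le> \<epsilon> \<longrightarrow>
        1 \<le> ennreal (exp (1 / 2)) * (\<Prod>j<n. ennreal (1 / \<eta>) * (\<integral>\<^sup>+r. G j r \<omega> \<partial>lborel))"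
      proof (rule AE_mp[OF int], intro AE_I2 impI)
        fix \<omega> assume \<omega>: "\<omega> \<in> space M" and iU: "integrable lborel (\<lambda>r. (U r \<omega>)\<^sup>2)" and small: "H1_norm U \<omega> \<le> \<epsilon>"
        have iV: "integrable lborel (\<lambda>r. V r \<omega>)" unfolding V_def using iU by (rule integrable_divide)
        have sV: "set_integrable lborel A (\<lambda>r. V r \<omega>)" if "A \<in> sets lborel" for A
          unfolding set_integrable_def using integrable_mult_indicator[OF that iV] .
        have Vm: "(\<lambda>r. V r \<omega>) \<in> borel_measurable lborel" using iV by auto
        have V0: "0 \<le> V r \<omega>" for r by (simp add: V_def)
        define v where "v j = (LINT r:S j|lborel. V r \<omega>)" for j
        have "(\<Sum>j<n. v j) \<le> (LINT r:{0..1}|lborel. V r \<omega>)"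
        proof -
          have "(\<Sum>j<n. v j) = (LINT r|lborel. (\<Sum>j<n. indicat_real (S j) r *\<^sub>R V r \<omega>))"
            unfolding v_def set_lebesgue_integral_def
            using sV[OF Sm] by (subst Bochner_Integration.integral_sum) (auto simp: set_integrable_def)
          also have "\<dots> \<le> (LINT r:{0..1}|lborel. V r \<omega>)"
            unfolding set_lebesgue_integral_def
          proof (rule integral_mono)
            show "integrable lborel (\<lambda>r. \<Sum>j<n. indicat_real (S j) r *\<^sub>R V r \<omega>)"
              using sV[OF Sm] by (intro Bochner_Integration.integrable_sum) (simp add: set_integrable_def)
            show "integrable lborel (\<lambda>r. indicat_real {0..1} r *\<^sub>R V r \<omega>)"
              using sV[of "{0..1}"] by (simp add: set_integrable_def)
            fix r
            have "(\<Sum>j<n. indicat_real (S j) r) = indicat_real (\<Union> (S ` {..<n})) r"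
              by (rule indicator_UN_disjoint[OF finite_lessThan Sdisj, symmetric])
            also have "\<dots> \<le> indicat_real {0..1} r"
              by (rule indicator_leI) (use S01 in blast)
            finally have "(\<Sum>j<n. indicat_real (S j) r) * V r \<omega> \<le> indicat_real {0..1} r * V r \<omega>"
              using V0 by (intro mult_right_mono)
            then show "(\<Sum>j<n. indicat_real (S j) r *\<^sub>R V r \<omega>) \<le> indicat_real {0..1} r *\<^sub>R V r \<omega>"
              by (simp add: sum_distrib_right)
          qed
          finally show ?thesis .
        qed
        also have "\<dots> = (LINT r:{0..1}|lborel. (U r \<omega>)\<^sup>2) / (2 * \<epsilon>\<^sup>2)"
          unfolding V_def by simp
        also have "\<dots> \<le> \<epsilon>\<^sup>2 / (2 * \<epsilon>\<^sup>2)"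
        proof (rule divide_right_mono)
          show "(LINT r:{0..1}|lborel. (U r \<omega>)\<^sup>2) \<le> \<epsilon>\<^sup>2"
            using small by (simp add: H1_norm_def sqrt_le_D)
        qed simp
        also have "\<dots> = 1 / 2" using \<epsilon> by simp
        finally have "1 \<le> exp (1 / 2 - (\<Sum>j<n. v j))" by simp
        also have "\<dots> = exp (1 / 2) * (\<Prod>j<n. exp (- v j))"
          by (simp add: exp_sum[symmetric] exp_add[symmetric] sum_negf)
        finally have "ennreal 1 \<le> ennreal (exp (1 / 2) * (\<Prod>j<n. exp (- v j)))" by (rule ennreal_leI)
        also have "\<dots> = ennreal (exp (1 / 2)) * (\<Prod>j<n. ennreal (exp (- v j)))"
          by (simp add: ennreal_mult prod_nonneg prod_ennreal)
        also have "\<dots> \<le> ennreal (exp (1 / 2)) * (\<Prod>j<n. ennreal (1 / \<eta>) * (\<integral>\<^sup>+r. G j r \<omega> \<partial>lborel))"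
        proof (intro mult_left_mono prod_mono_ennreal)
          show "ennreal (exp (- v j)) \<le> ennreal (1 / \<eta>) * (\<integral>\<^sup>+r. G j r \<omega> \<partial>lborel)" for j
            unfolding v_def G_def by (rule exp_Jensen_set[OF Sm Se \<eta> sV[OF Sm] V0 Vm])
        qed simp
        finally show "1 \<le> ennreal (exp (1 / 2)) * (\<Prod>j<n. ennreal (1 / \<eta>) * (\<integral>\<^sup>+r. G j r \<omega> \<partial>lborel))" by simp
      qed
      define \<rho> where "\<rho> = 3 * sqrt \<eta> / \<epsilon>"
      have \<rho>: "0 < \<rho>" using \<eta> \<epsilon> by (simp add: \<rho>_def)
      define K where "K = (sqrt (2 * pi) * \<kappa> / \<rho>) ^ n"
      have K0: "0 \<le> K" using h \<rho> by (simp add: K_def)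
      have cond: "(\<integral>\<^sup>+\<omega>. (\<Prod>j<n. G j (x j) \<omega>) \<partial>M) \<le> (\<Prod>j<n. indicator (S j) (x j)) * ennreal K" for x
      proof (cases "\<forall>j<n. x j \<in> S j")
        case False
        then obtain j where "j < n" "x j \<notin> S j" by auto
        then have "(\<Prod>j<n. G j (x j) \<omega>) = 0" for \<omega> by (intro prod_zero) (auto simp: G_def intro!: bexI[of _ j])
        then have "(\<integral>\<^sup>+\<omega>. (\<Prod>j<n. G j (x j) \<omega>) \<partial>M) = (\<integral>\<^sup>+\<omega>. 0 \<partial>M)"
          by (intro nn_integral_cong)
        then show ?thesis by simp
      next
        case True
        then have g: "good (x j)" "x j \<in> cell N (j * (P + 1))" if "j < n" for j using Sgood that by auto
        have "\<forall>j\<in>{..<n}. \<exists>X. wiener_ito M B 2 (\<lambda>y. f (y(2 := x j))) X \<and> (AE \<omega> in M. U (x j) \<omega> = 3 * X \<omega>)"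
          using g by (simp add: good_def)
        from bchoice[OF this] obtain X where X: "\<And>j. j < n \<Longrightarrow> wiener_ito M B 2 (\<lambda>y. f (y(2 := x j))) (X j)"
          "\<And>j. j < n \<Longrightarrow> AE \<omega> in M. U (x j) \<omega> = 3 * X j \<omega>" by auto
        have Xm: "X j \<in> borel_measurable M" if "j < n" for j
          using X(1)[OF that] by (auto simp: wiener_ito_def L2_def)
        have "AE \<omega> in M. \<forall>j\<in>{..<n}. U (x j) \<omega> = 3 * X j \<omega>"
          using X(2) by (intro AE_finite_allI) auto
        then have "(\<integral>\<^sup>+\<omega>. (\<Prod>j<n. G j (x j) \<omega>) \<partial>M) = (\<integral>\<^sup>+\<omega>. ennreal (exp (- (\<Sum>j<n. (\<rho> * X j \<omega>)\<^sup>2) / 2)) \<partial>M)"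
        proof (intro nn_integral_cong_AE, eventually_elim)
          case (elim \<omega>)
          have "(\<Prod>j<n. G j (x j) \<omega>) = (\<Prod>j<n. ennreal (exp (- ((\<rho> * X j \<omega>)\<^sup>2 / 2))))"
          proof (intro prod.cong refl)
            fix j assume j: "j \<in> {..<n}"
            have "\<eta> * V (x j) \<omega> = (\<rho> * X j \<omega>)\<^sup>2 / 2"
              using elim j \<eta> \<epsilon> by (simp add: V_def \<rho>_def power_mult_distrib power_divide)
            then show "G j (x j) \<omega> = ennreal (exp (- ((\<rho> * X j \<omega>)\<^sup>2 / 2)))"
              using True j by (simp add: G_def)
          qed
          also have "\<dots> = ennreal (exp (- (\<Sum>j<n. (\<rho> * X j \<omega>)\<^sup>2) / 2))"
            by (simp add: prod_ennreal exp_sum[symmetric] sum_negf sum_divide_distrib)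
          finally show ?case .
        qed
        also have "\<dots> = ennreal (LINT \<omega>|M. exp (- (\<Sum>j<n. (\<rho> * X j \<omega>)\<^sup>2) / 2))"
          using Xm by (intro nn_integral_eq_integral integrable_bounded_real[where C = 1]) (auto simp: sum_nonneg)
        also have "\<dots> \<le> ennreal K"
          unfolding K_def
        proof (rule ennreal_leI, rule ball[of x "\<lambda>j y. f (y(2 := x j))" X \<rho>])
        qed (use g X \<rho> in \<open>auto simp: good_def\<close>)
        finally show ?thesis using True by simp
      qed
      have set_m: "{\<omega> \<in> space M. H1_norm U \<omega> \<le> \<epsilon>} \<in> sets M"
      proof -
        have "(\<lambda>(\<omega>, r). indicat_real {0..1} r *\<^sub>R (U r \<omega>)\<^sup>2) \<in> borel_measurable (M \<Otimes>\<^sub>M lborel)"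
          using measurable_compose[OF measurable_pair_swap' Um] by (simp add: case_prod_unfold)
        then have "(\<lambda>\<omega>. LINT r:{0..1}|lborel. (U r \<omega>)\<^sup>2) \<in> borel_measurable M"
          unfolding set_lebesgue_integral_def
          by (rule sigma_finite_measure.borel_measurable_lebesgue_integral[OF sigma_finite_lborel, where f = "\<lambda>\<omega> r. indicat_real {0..1} r *\<^sub>R (U r \<omega>)\<^sup>2"])
        then show ?thesis unfolding H1_norm_def by measurable
      qed
      let ?Pi = "lborel_pow n"
      interpret PM: pair_sigma_finite ?Pi M
        by (intro pair_sigma_finite.intro sigma_finite_lborel_pow sigma_finite_measure_axioms)
      have prodm: "(\<lambda>(x, \<omega>). \<Prod>j<n. G j (x j) \<omega>) \<in> borel_measurable (?Pi \<Otimes>\<^sub>M M)"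
      proof -
        have "(\<lambda>p. G j (fst p j) (snd p)) \<in> borel_measurable (?Pi \<Otimes>\<^sub>M M)" if "j \<in> {..<n}" for j
        proof -
          have "(\<lambda>p. (fst p j, snd p)) \<in> measurable (?Pi \<Otimes>\<^sub>M M) (lborel \<Otimes>\<^sub>M M)"
            using that by measurable
          from measurable_compose[OF this Gm[of j]] show ?thesis by simp
        qed
        then show ?thesis by (simp add: case_prod_unfold borel_measurable_prod_ennreal)
      qed
      have "emeasure M {\<omega> \<in> space M. H1_norm U \<omega> \<le> \<epsilon>} = (\<integral>\<^sup>+\<omega>. indicator {\<omega> \<in> space M. H1_norm U \<omega> \<le> \<epsilon>} \<omega> \<partial>M)"
        using set_m by simp
      also have "\<dots> \<le> (\<integral>\<^sup>+\<omega>. ennreal (exp (1 / 2)) * (\<Prod>j<n. ennreal (1 / \<eta>) * (\<integral>\<^sup>+r. G j r \<omega> \<partial>lborel)) \<partial>M)"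
        by (rule nn_integral_mono_AE, rule AE_mp[OF step]) (auto simp: indicator_def)
      also have "\<dots> = (\<integral>\<^sup>+\<omega>. (ennreal (exp (1 / 2)) * ennreal (1 / \<eta>) ^ n) * (\<integral>\<^sup>+x. (\<Prod>j<n. G j (x j) \<omega>) \<partial>?Pi) \<partial>M)"
      proof (intro nn_integral_cong)
        fix \<omega> assume \<omega>: "\<omega> \<in> space M"
        have "(\<integral>\<^sup>+x. (\<Prod>j<n. G j (x j) \<omega>) \<partial>?Pi) = (\<Prod>j<n. \<integral>\<^sup>+r. G j r \<omega> \<partial>lborel)"
          by (rule lborel_product.product_nn_integral_prod) (use G1 \<omega> in auto)
        then show "ennreal (exp (1 / 2)) * (\<Prod>j<n. ennreal (1 / \<eta>) * (\<integral>\<^sup>+r. G j r \<omega> \<partial>lborel)) =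
          (ennreal (exp (1 / 2)) * ennreal (1 / \<eta>) ^ n) * (\<integral>\<^sup>+x. (\<Prod>j<n. G j (x j) \<omega>) \<partial>?Pi)"
          by (simp add: prod.distrib mult.assoc)
      qed
      also have "\<dots> = (ennreal (exp (1 / 2)) * ennreal (1 / \<eta>) ^ n) * (\<integral>\<^sup>+\<omega>. \<integral>\<^sup>+x. (\<Prod>j<n. G j (x j) \<omega>) \<partial>?Pi \<partial>M)"
      proof (rule nn_integral_cmult)
        have "(\<lambda>(\<omega>, x). \<Prod>j<n. G j (x j) \<omega>) \<in> borel_measurable (M \<Otimes>\<^sub>M ?Pi)"
          using measurable_compose[OF measurable_pair_swap' prodm] by (simp add: case_prod_unfold)
        then show "(\<lambda>\<omega>. \<integral>\<^sup>+x. (\<Prod>j<n. G j (x j) \<omega>) \<partial>?Pi) \<in> borel_measurable M"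
          by (rule sigma_finite_measure.borel_measurable_nn_integral[OF sigma_finite_lborel_pow, where f = "\<lambda>\<omega> x. \<Prod>j<n. G j (x j) \<omega>"])
      qed
      also have "(\<integral>\<^sup>+\<omega>. \<integral>\<^sup>+x. (\<Prod>j<n. G j (x j) \<omega>) \<partial>?Pi \<partial>M) = (\<integral>\<^sup>+x. \<integral>\<^sup>+\<omega>. (\<Prod>j<n. G j (x j) \<omega>) \<partial>M \<partial>?Pi)"
        by (rule PM.Fubini'[OF prodm])
      also have "\<dots> \<le> (\<integral>\<^sup>+x. (\<Prod>j<n. indicator (S j) (x j)) * ennreal K \<partial>?Pi)"
        by (intro nn_integral_mono cond)
      also have "\<dots> = (\<integral>\<^sup>+x. (\<Prod>j<n. indicator (S j) (x j)) \<partial>?Pi) * ennreal K"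
      proof (rule nn_integral_multc)
        show "(\<lambda>x. \<Prod>j<n. indicator (S j) (x j) :: ennreal) \<in> borel_measurable ?Pi"
          by (intro borel_measurable_prod_ennreal measurable_compose[OF measurable_component_singleton]) auto
      qed
      also have "(\<integral>\<^sup>+x. (\<Prod>j<n. indicator (S j) (x j)) \<partial>?Pi) = (\<Prod>j<n. emeasure lborel (S j))"
        by (subst lborel_product.product_nn_integral_prod[where f = "\<lambda>j. indicator (S j)"])
          (use Sm in auto)
      also have "\<dots> = ennreal \<eta> ^ n" by (simp add: Se)
      finally have "emeasure M {\<omega> \<in> space M. H1_norm U \<omega> \<le> \<epsilon>} \<le>
        (ennreal (exp (1 / 2)) * ennreal (1 / \<eta>) ^ n) * (ennreal \<eta> ^ n * ennreal K)"
        by (simp add: mult_left_mono)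
      also have "\<dots> = ennreal (exp (1 / 2) * (1 / \<eta>) ^ n * (\<eta> ^ n * K))"
        using \<eta> K0 by (simp add: ennreal_mult ennreal_power)
      also have "exp (1 / 2) * (1 / \<eta>) ^ n * (\<eta> ^ n * K) = C * \<epsilon> ^ n"
        using \<eta> \<epsilon> by (simp add: C_def K_def \<rho>_def power_divide power_mult_distrib)
      finally have "ennreal (measure M {\<omega> \<in> space M. H1_norm U \<omega> \<le> \<epsilon>}) \<le> ennreal (C * \<epsilon> ^ n)"
        by (simp add: emeasure_eq_measure)
      then show "measure M {\<omega> \<in> space M. H1_norm U \<omega> \<le> \<epsilon>} \<le> C * \<epsilon> ^ n"
        using \<open>0 \<le> C\<close> \<epsilon> by (simp add: ennreal_le_iff)
    qed
  qed
qed

end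

text \<open>For \<open>(1/2) ^ Suc k < Y \<le> (1/2) ^ k\<close> the power \<open>Y powr - p\<close> is at most \<open>b k = 2 powr (p * (k + 1))\<close>, and the
tail estimate with an exponent \<open>m \<ge> p + 1\<close> makes the expectations summable. Where \<open>Y = 0\<close>, both sides
of the pointwise bound are infinite.\<close>

lemma negative_moment_finite_if_small_ball:
  assumes M: "prob_space M" and Y: "Y \<in> borel_measurable M" "\<And>\<omega>. 0 \<le> Y \<omega>" and p: "0 < p"
    and tail: "\<And>m::nat. 0 < m \<Longrightarrow> \<exists>C\<ge>0. \<forall>\<epsilon>>0. measure M {\<omega> \<in> space M. Y \<omega> \<le> \<epsilon>} \<le> C * \<epsilon> ^ m"
  shows "negative_moment M Y p < \<infinity>"
proof -
  interpret prob_space M by fact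
  note [measurable] = Y(1)
  obtain m :: nat where m: "p + 1 \<le> real m" using real_arch_simple by blast
  then have m0: "0 < m" using p by (cases m) auto
  from tail[OF m0] obtain C where C: "0 \<le> C" "\<And>\<epsilon>. 0 < \<epsilon> \<Longrightarrow> measure M {\<omega> \<in> space M. Y \<omega> \<le> \<epsilon>} \<le> C * \<epsilon> ^ m"
    by blast
  define A where "A k = {\<omega> \<in> space M. Y \<omega> \<le> (1 / 2) ^ k}" for k
  have A [measurable]: "A k \<in> sets M" for k unfolding A_def by measurable
  define b where "b k = (2::real) powr (p * (real k + 1))" for k
  have point: "inverse (ennreal (Y \<omega> powr p)) \<le> 1 + (\<Sum>k. ennreal (b k) * indicator (A k) \<omega>)" if \<omega>: "\<omega> \<in> space M" for \<omega>
  proof -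
    consider "Y \<omega> = 0" | "0 < Y \<omega>" "Y \<omega> \<le> 1" | "1 < Y \<omega>" using Y(2)[of \<omega>] by linarith
    then show ?thesis
    proof cases
      case 1
      have "(\<Sum>k. ennreal (b k) * indicator (A k) \<omega>) = \<top>"
      proof -
        have "1 \<le> ennreal (b k) * indicator (A k) \<omega>" for k
          using 1 \<omega> p by (simp add: A_def b_def ge_one_powr_ge_zero)
        then have "(\<Sum>k. 1 :: ennreal) \<le> (\<Sum>k. ennreal (b k) * indicator (A k) \<omega>)"
          by (intro suminf_le) auto
        moreover have "(\<Sum>k::nat. 1 :: ennreal) = \<top>"
          by (simp add: nn_integral_count_space_nat[symmetric])
        ultimately show ?thesis by (simp add: top_unique)
      qed
      then show ?thesis by simp
    next
      case 2
      have "\<exists>k. Y \<omega> \<le> (1 / 2) ^ k \<and> (1 / 2) ^ Suc k < Y \<omega>"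
      proof -
        obtain k0 where "(1 / 2) ^ k0 < Y \<omega>" using real_arch_pow_inv[OF 2(1), of "1 / 2"] by auto
        then have ex: "\<exists>k. (1 / 2) ^ k < Y \<omega>" ..
        define k where "k = (LEAST k. (1 / 2 :: real) ^ k < Y \<omega>)"
        have k: "(1 / 2) ^ k < Y \<omega>" unfolding k_def using ex by (rule LeastI_ex)
        have "k \<noteq> 0"
        proof
          assume "k = 0"
          with k have "1 < Y \<omega>" by simp
          then show False using 2 by simp
        qed
        then obtain j where j: "k = Suc j" by (cases k) auto
        have "\<not> (1 / 2) ^ j < Y \<omega>" using not_less_Least[of j "\<lambda>k. (1 / 2 :: real) ^ k < Y \<omega>"] j by (simp add: k_def[symmetric])
        then show ?thesis using k j by (intro exI[of _ j]) (simp add: not_less)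
      qed
      then obtain k where k: "Y \<omega> \<le> (1 / 2) ^ k" "(1 / 2) ^ Suc k < Y \<omega>" by auto
      have "1 / (Y \<omega> powr p) \<le> b k"
      proof -
        have "((1 / 2) ^ Suc k) powr p \<le> Y \<omega> powr p" using k p by (intro powr_mono2) auto
        moreover have "((1 / 2 :: real) ^ Suc k) powr p = 1 / b k"
        proof -
          have e: "((1 / 2 :: real) ^ Suc k) = 2 powr (- (real k + 1))"
          proof -
            have "(2::real) powr (- (real k + 1)) = 1 / 2 powr real (Suc k)"
              unfolding powr_minus_divide by (simp add: add.commute)
            also have "\<dots> = 1 / 2 ^ Suc k" by (simp only: powr_realpow zero_less_numeral)
            finally show ?thesis by (simp only: power_one_over)
          qed
          have "((1 / 2 :: real) ^ Suc k) powr p = 2 powr (- (p * (real k + 1)))"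
            unfolding e powr_powr by (simp add: algebra_simps)
          then show ?thesis unfolding b_def powr_minus_divide .
        qed
        moreover have "0 < b k" by (simp add: b_def)
        ultimately have "1 / b k \<le> Y \<omega> powr p" "0 < b k" by simp_all
        then show ?thesis using 2 by (simp add: divide_le_eq mult.commute)
      qed
      then have "inverse (ennreal (Y \<omega> powr p)) \<le> ennreal (b k)"
        using 2 by (subst inverse_ennreal) (auto simp: inverse_eq_divide intro!: ennreal_leI)
      also have "\<dots> = ennreal (b k) * indicator (A k) \<omega>" using k \<omega> by (simp add: A_def)
      also have "\<dots> \<le> (\<Sum>k. ennreal (b k) * indicator (A k) \<omega>)"
      proof -
        define g where "g k = ennreal (b k) * indicator (A k) \<omega>" for k
        have "sum g {k} \<le> suminf g" by (rule sum_le_suminf) auto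
        then show ?thesis by (simp add: g_def[symmetric])
      qed
      finally show ?thesis by (simp add: add_increasing)
    next
      case 3
      then have "1 \<le> Y \<omega> powr p" using p by (simp add: ge_one_powr_ge_zero)
      then have "inverse (ennreal (Y \<omega> powr p)) \<le> 1"
        using 3 by (subst inverse_ennreal) (auto simp: inverse_le_1_iff)
      then show ?thesis by (rule order.trans) simp
    qed
  qed
  have "negative_moment M Y p \<le> (\<integral>\<^sup>+\<omega>. 1 + (\<Sum>k. ennreal (b k) * indicator (A k) \<omega>) \<partial>M)"
    unfolding negative_moment_def by (intro nn_integral_mono point)
  also have "\<dots> = 1 + (\<Sum>k. ennreal (b k) * emeasure M (A k))"
    by (subst nn_integral_add) (auto simp: emeasure_space_1 nn_integral_suminf nn_integral_cmult_indicator)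
  also have "\<dots> \<le> 1 + (\<Sum>k. ennreal (2 powr p * C * (1 / 2) ^ k))"
  proof (intro add_left_mono suminf_le)
    fix k
    have "emeasure M (A k) \<le> ennreal (C * ((1 / 2) ^ k) ^ m)"
      unfolding emeasure_eq_measure A_def by (intro ennreal_leI C(2)) simp
    then have "ennreal (b k) * emeasure M (A k) \<le> ennreal (b k) * ennreal (C * ((1 / 2) ^ k) ^ m)"
      by (intro mult_left_mono) auto
    also have "\<dots> = ennreal (b k * (C * ((1 / 2) ^ k) ^ m))" using C by (simp add: b_def ennreal_mult)
    also have "\<dots> \<le> ennreal (2 powr p * C * (1 / 2) ^ k)"
    proof (rule ennreal_leI)
      have "b k = 2 powr p * 2 powr (p * real k)" by (simp add: b_def powr_add[symmetric] algebra_simps)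
      moreover have "((1 / 2 :: real) ^ k) ^ m = 2 powr (- (real k * real m))"
        by (simp add: power_mult[symmetric] powr_minus_divide powr_realpow[symmetric] power_one_over powr_powr)
      moreover have "(1 / 2 :: real) ^ k = 2 powr (- real k)"
        by (simp add: powr_minus powr_realpow power_divide inverse_eq_divide)
      moreover have "(2::real) powr (p * real k) * 2 powr (- (real k * real m)) \<le> 2 powr (- real k)"
      proof -
        have "(p + 1) * real k \<le> real m * real k" using m by (intro mult_right_mono) auto
        then have "p * real k + - (real k * real m) \<le> - real k" by (simp add: algebra_simps)
        then show ?thesis unfolding powr_add[symmetric] by (intro powr_mono) auto
      qed
      ultimately have "b k * (C * ((1 / 2) ^ k) ^ m) = (2 powr p * C) * (2 powr (p * real k) * 2 powr (- (real k * real m)))"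
         "2 powr p * C * (1 / 2) ^ k = (2 powr p * C) * 2 powr (- real k)"
        "(2::real) powr (p * real k) * 2 powr (- (real k * real m)) \<le> 2 powr (- real k)" by simp_all
      then show "b k * (C * ((1 / 2) ^ k) ^ m) \<le> 2 powr p * C * (1 / 2) ^ k"
        using C by (simp only:) (intro mult_left_mono; simp)
    qed
    finally show "ennreal (b k) * emeasure M (A k) \<le> ennreal (2 powr p * C * (1 / 2) ^ k)" .
  qed auto
  also have "\<dots> = 1 + ennreal (\<Sum>k. 2 powr p * C * (1 / 2) ^ k)"
    using C by (subst suminf_ennreal2) (auto intro!: summable_mult summable_geometric)
  also have "\<dots> < \<infinity>" by simp
  finally show ?thesis .
qed

theorem theorem2p1:
  fixes M :: "'a measure" and B :: "(real \<Rightarrow> real) \<Rightarrow> 'a \<Rightarrow> real" and H :: real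
    and Z :: "real \<Rightarrow> 'a \<Rightarrow> real" and F :: "'a \<Rightarrow> real" and DF :: "real \<Rightarrow> 'a \<Rightarrow> real"
  assumes "isonormal M B"
    and "1/2 < H" and "H < 1"
    and "hermite_process M B 3 H Z"
    and "F = Z 1"
    and "malliavin_derivative M B 3 F DF"
  shows "(\<forall>p>0. negative_moment M (H1_norm DF) p < \<infinity>) \<and>
    (\<forall>m\<ge>(1::nat). \<exists>C::real. \<forall>\<epsilon>>0.
       measure M {\<omega> \<in> space M. H1_norm DF \<omega> \<le> \<epsilon>} \<le> C * \<epsilon> ^ m)"
proof -
  interpret isonormal_process M B by unfold_locales fact
  from assms(4) obtain c where c: "0 < c" and "\<forall>t\<ge>0. wiener_ito M B 3 (hermite_kernel 3 H c t) (Z t)"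
    unfolding hermite_process_def by auto
  then have L: "wiener_ito M B 3 (hermite_kernel 3 H c 1) F" using assms(5) by simp
  have ball: "\<exists>C\<ge>0. \<forall>\<epsilon>>0. measure M {\<omega> \<in> space M. H1_norm DF \<omega> \<le> \<epsilon>} \<le> C * \<epsilon> ^ m" if "0 < m" for m
    using H1_norm_small_ball[OF assms(2,3) c that L assms(6)] .
  have m: "H1_norm DF \<in> borel_measurable M"
  proof -
    have Um: "(\<lambda>(r, \<omega>). DF r \<omega>) \<in> borel_measurable (lborel \<Otimes>\<^sub>M M)"
      using assms(6) by (simp add: malliavin_derivative_def)
    have "(\<lambda>(\<omega>, r). indicat_real {0..1} r *\<^sub>R (DF r \<omega>)\<^sup>2) \<in> borel_measurable (M \<Otimes>\<^sub>M lborel)"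
      using measurable_compose[OF measurable_pair_swap' Um] by (simp add: case_prod_unfold)
    then have "(\<lambda>\<omega>. LINT r:{0..1}|lborel. (DF r \<omega>)\<^sup>2) \<in> borel_measurable M"
      unfolding set_lebesgue_integral_def
      by (rule sigma_finite_measure.borel_measurable_lebesgue_integral[OF sigma_finite_lborel, where f = "\<lambda>\<omega> r. indicat_real {0..1} r *\<^sub>R (DF r \<omega>)\<^sup>2"])
    then show ?thesis unfolding H1_norm_def[abs_def] by measurable
  qed
  have nn: "0 \<le> H1_norm DF \<omega>" for \<omega>
    unfolding H1_norm_def set_lebesgue_integral_def by (intro real_sqrt_ge_zero integral_nonneg_AE) auto
  show ?thesis
  proof (intro conjI allI impI)
    show "negative_moment M (H1_norm DF) p < \<infinity>" if "0 < p" for p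
      by (rule negative_moment_finite_if_small_ball[OF prob_space_axioms m nn that ball])
    show "\<exists>C. \<forall>\<epsilon>>0. measure M {\<omega> \<in> space M. H1_norm DF \<omega> \<le> \<epsilon>} \<le> C * \<epsilon> ^ m" if "1 \<le> m" for m
      using ball[of m] that by auto
  qed
qed

end
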